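(* Let $(R,m)$ be a Noetherian local ring of positive prime characteristic $p$, and let $S$ be an $R$-algebra. Then $S$ is a seed over $R$ if and only if there is an $R$-algebra homomorphism $S\to T$ such that $T$ has a durable colon-killer over $R$. Likewise, $S$ is a seed over $R$ if and only if there is an $R$-algebra homomorphism $S\to T$ such that $T$ has a weak durable colon-killer over $R$.
   Context: All rings are commutative with identity and all modules are unital. Let $(R,m)$ be a Noetherian local ring. A big Cohen-Macaulay $R$-algebra is an $R$-algebra $B$ (not necessarily Noetherian or finitely generated) such that some system of parameters of $R$ is a regular sequence on $B$ (a regular sequence $x_1,\ldots,x_d$ on $B$ is required to satisfy $(x_1,\ldots,x_d)B\neq B$; consequently $mB\neq B$). An $R$-algebra $S$ is a seed over $R$ if there is an $R$-algebra homomorphism from $S$ to some big Cohen-Macaulay $R$-algebra. For an $R$-algebra $T$, an element $c\in T$ is a weak durable colon-killer over $R$ if (1) for some system of parameters $x_1,\ldots,x_n$ of $R$, $$c\big((x_1^t,\ldots,x_k^t)T:_T x_{k+1}^t\big)\subseteq (x_1^t,\ldots,x_k^t)T$$ for all $0\leq k\leq n-1$ and all integers $t\geq 1$ (for $k=0$ the ideal $(x_1^t,\ldots,x_k^t)T$ is $0$), and (2) for every $N\geq 1$ there exists $k\geq 1$ such that $c^N\notin m^kT$. An element $c\in T$ is a durable colon-killer over $R$ if it is a weak durable colon-killer for every system of parameters of $R$, i.e. condition (1) holds for every system of parameters $x_1,\ldots,x_n$ of $R$ and condition (2) holds. *)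

theory Defs
  imports
    "HOL-Algebra.Algebra"
    "HOL-Library.Extended_Nat"
    "HOL-Library.Equipollence"
begin

text \<open>
  \<^const>\<open>algebra\<close> is the library's locale of commutative unital algebras over a commutative ring.
  The structure map sends \<open>r\<close> to \<open>r \<odot> \<one>\<close>.
\<close>

definition algebra_hom ::
  "('a, 'k) ring_scheme \<Rightarrow> ('a, 'b, 'l) module_scheme \<Rightarrow> ('a, 'c, 'n) module_scheme
     \<Rightarrow> ('b \<Rightarrow> 'c) set"
  where "algebra_hom R S T =
    {h \<in> ring_hom S T.
       \<forall>r\<in>carrier R. \<forall>s\<in>carrier S. h (r \<odot>\<^bsub>S\<^esub> s) = r \<odot>\<^bsub>T\<^esub> h s}"

text \<open>The ideal \<open>A T\<close> of the algebra \<open>T\<close> generated by the image of a set \<open>A\<close> of ring elements.\<close>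

definition extended_ideal :: "('a, 'b, 'l) module_scheme \<Rightarrow> 'a set \<Rightarrow> 'b set"
  where "extended_ideal T A = Idl\<^bsub>T\<^esub> ((\<lambda>r. r \<odot>\<^bsub>T\<^esub> \<one>\<^bsub>T\<^esub>) ` A)"

text \<open>The colon ideal \<open>I :\<^sub>T x\<close>, for \<open>x\<close> an element of the base ring.\<close>

definition colon_ideal :: "('a, 'b, 'l) module_scheme \<Rightarrow> 'b set \<Rightarrow> 'a \<Rightarrow> 'b set"
  where "colon_ideal T I x = {u \<in> carrier T. x \<odot>\<^bsub>T\<^esub> u \<in> I}"

text \<open>The powers of an ideal, with respect to the library's product of ideals.\<close>

primrec ideal_power :: "('a, 'k) ring_scheme \<Rightarrow> 'a set \<Rightarrow> nat \<Rightarrow> 'a set"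
  where
    "ideal_power R I 0 = carrier R"
  | "ideal_power R I (Suc k) = ideal_power R I k \<cdot>\<^bsub>R\<^esub> I"

text \<open>
  The additive order of the unit is the library's \<^const>\<open>group.ord\<close>, which is \<open>0\<close> for elements of
  infinite order.
\<close>

definition ring_char :: "('a, 'k) ring_scheme \<Rightarrow> nat"
  where "ring_char R = group.ord (add_monoid R) \<one>\<^bsub>R\<^esub>"

definition noetherian_local_ring :: "('a, 'k) ring_scheme \<Rightarrow> 'a set \<Rightarrow> bool"
  where "noetherian_local_ring R m \<longleftrightarrow>
    cring R \<and> noetherian_ring R \<and> maximalideal m R \<and> (\<forall>m'. maximalideal m' R \<longrightarrow> m' = m)"

definition krull_dim :: "('a, 'k) ring_scheme \<Rightarrow> enat"
  where "krull_dim R =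
    Sup {enat n | n. \<exists>P :: nat \<Rightarrow> 'a set.
           (\<forall>i\<le>n. primeideal (P i) R) \<and> (\<forall>i<n. P i \<subset> P (Suc i))}"

text \<open>
  A system of parameters: \<open>dim R\<close> elements of \<open>m\<close> generating an ideal whose radical is \<open>m\<close>.
  The list \<open>xs\<close> holds \<open>x\<^sub>1, \<dots>, x\<^sub>n\<close>, so that \<open>xs ! k\<close> is \<open>x\<^sub>k\<^sub>+\<^sub>1\<close> and
  \<open>set (take k xs)\<close> consists of \<open>x\<^sub>1, \<dots>, x\<^sub>k\<close>.
\<close>

definition system_of_parameters ::
  "('a, 'k) ring_scheme \<Rightarrow> 'a set \<Rightarrow> 'a list \<Rightarrow> bool"
  where "system_of_parameters R m xs \<longleftrightarrow>
    enat (length xs) = krull_dim R \<and> set xs \<subseteq> m \<and>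
    (\<forall>a\<in>m. \<exists>k::nat. a [^]\<^bsub>R\<^esub> k \<in> Idl\<^bsub>R\<^esub> (set xs))"

text \<open>
  The first condition says that \<open>x\<^sub>k\<^sub>+\<^sub>1\<close> is a nonzerodivisor on \<open>B / (x\<^sub>1, \<dots>, x\<^sub>k) B\<close>.
\<close>

definition regular_sequence :: "('a, 'b, 'l) module_scheme \<Rightarrow> 'a list \<Rightarrow> bool"
  where "regular_sequence B xs \<longleftrightarrow>
    (\<forall>k<length xs. \<forall>b\<in>carrier B.
       (xs ! k) \<odot>\<^bsub>B\<^esub> b \<in> extended_ideal B (set (take k xs)) \<longrightarrow>
       b \<in> extended_ideal B (set (take k xs))) \<and>
    extended_ideal B (set xs) \<noteq> carrier B"

definition big_CM_algebra ::
  "('a, 'k) ring_scheme \<Rightarrow> 'a set \<Rightarrow> ('a, 'b, 'l) module_scheme \<Rightarrow> bool"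
  where "big_CM_algebra R m B \<longleftrightarrow>
    algebra R B \<and> (\<exists>xs. system_of_parameters R m xs \<and> regular_sequence B xs)"

text \<open>
  HOL cannot quantify existentially over types, so the type \<open>'u\<close> of the elements of the big
  Cohen-Macaulay algebra is a parameter, playing the role of a universe. The notion does not depend
  on it as soon as \<open>'u\<close> is infinite and at least as large as \<open>S\<close>: if \<open>S\<close> maps to a big
  Cohen-Macaulay algebra \<open>B\<close> of any size, then it maps to a subalgebra of \<open>B\<close> of cardinality at most
  \<open>max \<bar>S\<bar> \<aleph>\<^sub>0\<close>, obtained by closing the image of \<open>S\<close> under the ring operations and under a choice
  of coefficients witnessing regularity, which is again big Cohen-Macaulay.
\<close>

definition seed ::
  "'u itself \<Rightarrow> ('a, 'k) ring_scheme \<Rightarrow> 'a set \<Rightarrow> ('a, 'b, 'l) module_scheme \<Rightarrow> bool"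
  where "seed U R m S \<longleftrightarrow>
    algebra R S \<and>
    (\<exists>(B :: ('a, 'u) module) h. big_CM_algebra R m B \<and> h \<in> algebra_hom R S B)"

definition colon_killing ::
  "('a, 'k) ring_scheme \<Rightarrow> ('a, 'b, 'l) module_scheme \<Rightarrow> 'b \<Rightarrow> 'a list \<Rightarrow> bool"
  where "colon_killing R T c xs \<longleftrightarrow>
    (\<forall>k<length xs. \<forall>t\<ge>1::nat.
       (\<lambda>u. c \<otimes>\<^bsub>T\<^esub> u) `
         colon_ideal T (extended_ideal T ((\<lambda>x. x [^]\<^bsub>R\<^esub> t) ` set (take k xs)))
           ((xs ! k) [^]\<^bsub>R\<^esub> t)
       \<subseteq> extended_ideal T ((\<lambda>x. x [^]\<^bsub>R\<^esub> t) ` set (take k xs)))"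

definition powers_escape ::
  "('a, 'k) ring_scheme \<Rightarrow> 'a set \<Rightarrow> ('a, 'b, 'l) module_scheme \<Rightarrow> 'b \<Rightarrow> bool"
  where "powers_escape R m T c \<longleftrightarrow>
    (\<forall>N\<ge>1::nat. \<exists>k\<ge>1. c [^]\<^bsub>T\<^esub> N \<notin> extended_ideal T (ideal_power R m k))"

definition weak_durable_colon_killer ::
  "('a, 'k) ring_scheme \<Rightarrow> 'a set \<Rightarrow> ('a, 'b, 'l) module_scheme \<Rightarrow> 'b \<Rightarrow> bool"
  where "weak_durable_colon_killer R m T c \<longleftrightarrow>
    c \<in> carrier T \<and>
    (\<exists>xs. system_of_parameters R m xs \<and> colon_killing R T c xs) \<and>
    powers_escape R m T c"

definition durable_colon_killer ::
  "('a, 'k) ring_scheme \<Rightarrow> 'a set \<Rightarrow> ('a, 'b, 'l) module_scheme \<Rightarrow> 'b \<Rightarrow> bool"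
  where "durable_colon_killer R m T c \<longleftrightarrow>
    c \<in> carrier T \<and>
    (\<forall>xs. system_of_parameters R m xs \<longrightarrow> colon_killing R T c xs) \<and>
    powers_escape R m T c"

end

theory Submission
  imports Defs "HOL-Computational_Algebra.Primes"
begin

text \<open>
  Let \<open>T\<close> have a weak durable colon-killer \<open>c\<close> for the parameters \<open>x\<^sub>1, \<dots>, x\<^sub>n\<close>. In characteristic
  \<open>p\<close> the ring \<open>R\<close> acts on the \<open>e\<close>-th factor of the product \<open>T \<times> T \<times> \<dots>\<close> through
  \<open>r \<mapsto> r^(p^e)\<close>, and \<open>S\<close> maps to that factor by its homomorphism to \<open>T\<close> followed by the \<open>e\<close>-th
  power of the Frobenius. Let \<open>B\<close> be the localisation of this product at the constant sequence \<open>c\<close>.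
  A relation \<open>x\<^sub>k\<^sub>+\<^sub>1 u \<in> (x\<^sub>1, \<dots>, x\<^sub>k) B\<close> says, componentwise and up to a fixed power of \<open>c\<close>, that
  \<open>x\<^sub>k\<^sub>+\<^sub>1^(p^e) u\<^sub>e\<close> lies in the ideal of the \<open>p^e\<close>-th powers; one more factor \<open>c\<close> removes
  \<open>x\<^sub>k\<^sub>+\<^sub>1^(p^e)\<close>, and \<open>c\<close> is a unit of \<open>B\<close>. If the parameters generated the unit ideal of \<open>B\<close>, then
  one power of \<open>c\<close> would lie in \<open>m^(p^e) T\<close> for every \<open>e\<close>, which durability forbids.

  Conversely, let the parameters \<open>x\<close> be a regular sequence on \<open>B\<close>. Here \<open>T\<close> is the ring of sequences
  in \<open>B\<close> modulo those whose \<open>e\<close>-th term lies in \<open>(x\<^sub>1^(p^(e-s)), \<dots>, x\<^sub>n^(p^(e-s))) B\<close> for large \<open>e\<close>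
  and some fixed shift \<open>s\<close>, and \<open>1\<close> is a durable colon-killer of \<open>T\<close>. Indeed, for other parameters \<open>y\<close>
  the inclusion \<open>(y\<^sub>1^t, \<dots>, y\<^sub>k^t) : y\<^sub>k\<^sub>+\<^sub>1^t \<subseteq> (y\<^sub>1^t, \<dots>, y\<^sub>k^t)\<close> holds in \<open>B\<close> up to Frobenius powers
  of \<open>(x)\<close>, with a loss in the exponent that depends only on \<open>y\<close> and \<open>t\<close>
  (\<open>colon_approximation\<close>); the shift \<open>s\<close> absorbs this loss. The approximation rests on
  \<open>colon_trivial_of_regular\<close>, a form of the depth sensitivity of the Koszul complex: if \<open>n\<close>
  elements \<open>y\<close> generate an ideal whose radical contains a regular sequence \<open>x\<close> of length \<open>n\<close>, then
  \<open>H\<^sub>1(y; B) = 0\<close>. One shows \<open>H\<^sub>k\<^sub>+\<^sub>1(y; B/(x\<^sub>1, \<dots>, x\<^sub>k)B) = 0\<close> by descending induction on \<open>k\<close>. For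
  \<open>k = n\<close> the Koszul complex is too short to have homology in degree \<open>n + 1\<close>; if the homology of
  \<open>M/xM\<close> vanishes in degree \<open>k + 2\<close>, then \<open>x\<close> is injective on that of \<open>M\<close> in degree \<open>k + 1\<close>, where
  it is also nilpotent because \<open>(y)\<close> annihilates Koszul homology.

  Two further points are needed. A durable colon-killer is a weak one only because \<open>R\<close> has a system
  of parameters at all; this is the dimension theorem for Noetherian local rings, obtained from
  Krull's principal ideal theorem and prime avoidance. And the rings constructed above must be
  replaced by subalgebras small enough for the prescribed type: \<open>small_algebra\<close> closes the image of
  \<open>S\<close> under the ring operations and under a choice of coefficients for memberships in finitely
  generated ideals.
\<close>

section \<open>Ideals\<close>

context cring
begin

lemma ideal_closedI:
  assumes "I \<subseteq> carrier R" and "\<zero> \<in> I"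
    and "\<And>a b. a \<in> I \<Longrightarrow> b \<in> I \<Longrightarrow> a \<oplus> b \<in> I"
    and mult: "\<And>r a. r \<in> carrier R \<Longrightarrow> a \<in> I \<Longrightarrow> r \<otimes> a \<in> I"
  shows "ideal I R"
proof (rule idealI)
  show "subgroup I (add_monoid R)"
  proof (rule add.subgroupI)
    fix a assume a: "a \<in> I"
    then have "\<ominus> a = (\<ominus> \<one>) \<otimes> a"
      using assms(1) by (simp add: l_minus subsetD)
    then show "\<ominus> a \<in> I"
      using mult[of "\<ominus> \<one>" a] a by simp
  qed (use assms in auto)
  fix a x assume ax: "a \<in> I" "x \<in> carrier R"
  then show "x \<otimes> a \<in> I" by (rule mult[rotated])
  then show "a \<otimes> x \<in> I" using ax assms(1) m_comm by auto
qed (rule ring_axioms)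

lemma ideal_add: "ideal I R \<Longrightarrow> a \<in> I \<Longrightarrow> b \<in> I \<Longrightarrow> a \<oplus> b \<in> I"
  by (rule additive_subgroup.a_closed[OF ideal.axioms(1)])

lemma ideal_mult: "ideal I R \<Longrightarrow> a \<in> I \<Longrightarrow> r \<in> carrier R \<Longrightarrow> r \<otimes> a \<in> I"
  by (rule ideal.I_l_closed)

lemma ideal_mult_right: "ideal I R \<Longrightarrow> a \<in> I \<Longrightarrow> r \<in> carrier R \<Longrightarrow> a \<otimes> r \<in> I"
  by (rule ideal.I_r_closed)

lemma ideal_zero: "ideal I R \<Longrightarrow> \<zero> \<in> I"
  by (simp add: additive_subgroup.zero_closed ideal.axioms(1))

lemma ideal_subset: "ideal I R \<Longrightarrow> I \<subseteq> carrier R"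
  by (simp add: additive_subgroup.a_subset ideal.axioms(1))

lemma ideal_neg: "ideal I R \<Longrightarrow> a \<in> I \<Longrightarrow> \<ominus> a \<in> I"
  by (simp add: additive_subgroup.a_inv_closed ideal.axioms(1))

lemma ideal_diff: "ideal I R \<Longrightarrow> a \<in> I \<Longrightarrow> b \<in> I \<Longrightarrow> a \<ominus> b \<in> I"
  by (simp add: ideal_add ideal_neg minus_eq)

lemma ideal_add_cancel:
  assumes "ideal I R" "a \<in> carrier R" "b \<in> I" "a \<oplus> b \<in> I"
  shows "a \<in> I"
proof -
  have "b \<in> carrier R" using assms ideal_subset by blast
  then have "a = (a \<oplus> b) \<ominus> b" using assms(2) by algebra
  then show ?thesis using ideal_diff[OF assms(1,4,3)] by simp
qed

lemma Idl_of_ideal: "ideal I R \<Longrightarrow> Idl I = I"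
  by (meson genideal_minimal genideal_self ideal_subset subset_antisym subset_refl)

lemma Idl_insert:
  assumes "A \<subseteq> carrier R" "b \<in> carrier R"
  shows "Idl (insert b A) = {i \<oplus> r \<otimes> b | i r. i \<in> Idl A \<and> r \<in> carrier R}" (is "_ = ?J")
proof
  have I: "ideal (Idl A) R" by (rule genideal_ideal[OF assms(1)])
  have sub: "Idl A \<subseteq> carrier R" by (rule ideal_subset[OF I])
  have "ideal ?J R"
  proof (rule ideal_closedI)
    show "?J \<subseteq> carrier R" using sub assms by auto
    have "\<zero> = \<zero> \<oplus> \<zero> \<otimes> b" using assms by simp
    then show "\<zero> \<in> ?J" using ideal_zero[OF I] by blast
  next
    fix u v assume "u \<in> ?J" "v \<in> ?J"
    then obtain i r j s where *: "u = i \<oplus> r \<otimes> b" "v = j \<oplus> s \<otimes> b"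
      "i \<in> Idl A" "j \<in> Idl A" "r \<in> carrier R" "s \<in> carrier R" by blast
    have "i \<in> carrier R" "j \<in> carrier R" using * sub by auto
    then have "u \<oplus> v = (i \<oplus> j) \<oplus> (r \<oplus> s) \<otimes> b"
      unfolding *(1,2) using *(5,6) assms(2) by algebra
    then show "u \<oplus> v \<in> ?J" using ideal_add[OF I *(3,4)] *(5,6) by blast
  next
    fix t u assume t: "t \<in> carrier R" and "u \<in> ?J"
    then obtain i r where *: "u = i \<oplus> r \<otimes> b" "i \<in> Idl A" "r \<in> carrier R" by blast
    have "i \<in> carrier R" using * sub by auto
    then have "t \<otimes> u = t \<otimes> i \<oplus> (t \<otimes> r) \<otimes> b"
      unfolding *(1) using *(3) t assms(2) by algebra
    then show "t \<otimes> u \<in> ?J" using ideal_mult[OF I *(2) t] *(3) t by blast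
  qed
  moreover have "insert b A \<subseteq> ?J"
  proof
    fix a assume "a \<in> insert b A"
    then consider "a = b" | "a \<in> Idl A" using genideal_self[OF assms(1)] by blast
    then show "a \<in> ?J"
    proof cases
      case 1
      then have "a = \<zero> \<oplus> \<one> \<otimes> b" using assms by simp
      then show ?thesis using ideal_zero[OF I] by blast
    next
      case 2
      then have "a = a \<oplus> \<zero> \<otimes> b" using assms sub by auto
      then show ?thesis using 2 by blast
    qed
  qed
  ultimately show "Idl (insert b A) \<subseteq> ?J" by (rule genideal_minimal)
  have J: "ideal (Idl (insert b A)) R" using assms by (intro genideal_ideal) auto
  have "Idl A \<subseteq> Idl (insert b A)" "b \<in> Idl (insert b A)"
    using assms genideal_self[of "insert b A"] subset_Idl_subset[of "insert b A" A] by auto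
  then show "?J \<subseteq> Idl (insert b A)"
    using ideal_add[OF J] ideal_mult[OF J] by blast
qed

lemma Idl_mono: "A \<subseteq> B \<Longrightarrow> B \<subseteq> carrier R \<Longrightarrow> Idl A \<subseteq> Idl B"
  by (rule subset_Idl_subset)

lemma Idl_insert_ideal:
  assumes "ideal I R" "b \<in> carrier R"
  shows "Idl (insert b I) = {i \<oplus> r \<otimes> b | i r. i \<in> I \<and> r \<in> carrier R}"
  using Idl_insert[OF ideal_subset[OF assms(1)] assms(2)] Idl_of_ideal[OF assms(1)] by simp

lemma prime_ideal: "primeideal P R \<Longrightarrow> ideal P R"
  by (rule primeideal.axioms(1))

lemma primeD:
  "primeideal P R \<Longrightarrow> a \<in> carrier R \<Longrightarrow> b \<in> carrier R \<Longrightarrow> a \<otimes> b \<in> P \<Longrightarrow> a \<in> P \<or> b \<in> P"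
  by (rule primeideal.I_prime)

lemma prime_one: "primeideal P R \<Longrightarrow> \<one> \<notin> P"
  using ideal.one_imp_carrier primeideal.I_notcarr primeideal.axioms(1) by blast

lemma prime_pow:
  assumes "primeideal P R" "a \<in> carrier R" "a [^] (n::nat) \<in> P"
  shows "a \<in> P"
  using assms(3)
proof (induction n)
  case 0
  then show ?case using prime_one[OF assms(1)] by simp
next
  case (Suc n)
  then show ?case using primeD[OF assms(1), of "a [^] n" a] assms(2) by auto
qed

text \<open>
  The ascending chain condition in the form used for Noetherian induction: a set of ideals that
  collects the counterexamples to a claim has a maximal member.
\<close>

lemma noetherian_maximal:
  assumes "noetherian_ring R" "A \<noteq> {}" "\<And>I. I \<in> A \<Longrightarrow> ideal I R"
  obtains M where "M \<in> A" "\<forall>I\<in>A. M \<subseteq> I \<longrightarrow> I = M"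
proof -
  have "\<exists>M\<in>A. \<forall>K\<in>A. M \<subseteq> K \<longrightarrow> K = M"
  proof (rule subset_Zorn_nonempty[OF assms(2)])
    fix C assume C: "C \<noteq> {}" "subset.chain A C"
    have "C \<subseteq> {I. ideal I R}" using C(2) assms(3) by (auto simp: subset.chain_def)
    then have "subset.chain {I. ideal I R} C"
      using C(2) by (simp add: subset.chain_def)
    then have "\<Union>C \<in> C" by (rule noetherian_ring.ideal_chain_is_trivial[OF assms(1) C(1)])
    then show "\<Union>C \<in> A" using C(2) by (auto simp: subset.chain_def)
  qed
  then show ?thesis using that by blast
qed

section \<open>Saturation with respect to a prime ideal\<close>

text \<open>
  The contraction to \<open>R\<close> of the extension of \<open>I\<close> to the local ring \<open>R\<^sub>P\<close>. Ideals of \<open>R\<^sub>P\<close> are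
  represented by their contractions, the saturated ideals, so that arguments over \<open>R\<^sub>P\<close> take
  place in \<open>R\<close>.
\<close>

definition saturation :: "'a set \<Rightarrow> 'a set \<Rightarrow> 'a set"
  where "saturation P I = {a \<in> carrier R. \<exists>s\<in>carrier R - P. s \<otimes> a \<in> I}"

lemma saturationI: "a \<in> carrier R \<Longrightarrow> s \<in> carrier R \<Longrightarrow> s \<notin> P \<Longrightarrow> s \<otimes> a \<in> I \<Longrightarrow> a \<in> saturation P I"
  unfolding saturation_def by blast

lemma saturationE:
  assumes "a \<in> saturation P I"
  obtains s where "a \<in> carrier R" "s \<in> carrier R" "s \<notin> P" "s \<otimes> a \<in> I"
  using assms unfolding saturation_def by blast

lemma prime_mult_notin:
  "primeideal P R \<Longrightarrow> s \<in> carrier R \<Longrightarrow> t \<in> carrier R \<Longrightarrow> s \<notin> P \<Longrightarrow> t \<notin> P \<Longrightarrow> s \<otimes> t \<notin> P"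
  using primeD by blast

lemma saturation_ideal:
  assumes P: "primeideal P R" and I: "ideal I R"
  shows "ideal (saturation P I) R"
proof (rule ideal_closedI)
  show "saturation P I \<subseteq> carrier R" unfolding saturation_def by blast
  show "\<zero> \<in> saturation P I"
    using ideal_zero[OF I] prime_one[OF P] by (intro saturationI[of _ \<one>]) auto
next
  fix a b assume ab: "a \<in> saturation P I" "b \<in> saturation P I"
  obtain s where s: "a \<in> carrier R" "s \<in> carrier R" "s \<notin> P" "s \<otimes> a \<in> I"
    by (rule saturationE[OF ab(1)])
  obtain t where t: "b \<in> carrier R" "t \<in> carrier R" "t \<notin> P" "t \<otimes> b \<in> I"
    by (rule saturationE[OF ab(2)])
  note * = s t
  have "(s \<otimes> t) \<otimes> (a \<oplus> b) = t \<otimes> (s \<otimes> a) \<oplus> s \<otimes> (t \<otimes> b)"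
    using *(1,2,5,6) by algebra
  then have "(s \<otimes> t) \<otimes> (a \<oplus> b) \<in> I" using * by (simp add: ideal_add[OF I] ideal_mult[OF I])
  then show "a \<oplus> b \<in> saturation P I"
    using * prime_mult_notin[OF P] by (intro saturationI[of _ "s \<otimes> t"]) auto
next
  fix r a assume r: "r \<in> carrier R" and a: "a \<in> saturation P I"
  from a obtain s where *: "a \<in> carrier R" "s \<in> carrier R" "s \<notin> P" "s \<otimes> a \<in> I" by (rule saturationE)
  have "s \<otimes> (r \<otimes> a) = r \<otimes> (s \<otimes> a)" using *(1,2) r by algebra
  then show "r \<otimes> a \<in> saturation P I"
    using * r ideal_mult[OF I *(4) r] by (intro saturationI[of _ s]) auto
qed

lemma saturation_increasing:
  assumes "primeideal P R" "I \<subseteq> carrier R"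
  shows "I \<subseteq> saturation P I"
proof
  fix a assume "a \<in> I"
  then show "a \<in> saturation P I"
    using assms prime_one[OF assms(1)] by (intro saturationI[of _ \<one>]) auto
qed

lemma saturation_mono: "I \<subseteq> J \<Longrightarrow> saturation P I \<subseteq> saturation P J"
  unfolding saturation_def by blast

lemma saturation_idem:
  assumes P: "primeideal P R" and I: "I \<subseteq> carrier R"
  shows "saturation P (saturation P I) = saturation P I"
proof
  show "saturation P (saturation P I) \<subseteq> saturation P I"
  proof
    fix a assume "a \<in> saturation P (saturation P I)"
    then obtain s where s: "a \<in> carrier R" "s \<in> carrier R" "s \<notin> P" "s \<otimes> a \<in> saturation P I"
      by (rule saturationE)
    obtain t where t: "t \<in> carrier R" "t \<notin> P" "t \<otimes> (s \<otimes> a) \<in> I"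
      by (rule saturationE[OF s(4)])
    note * = s(1-3) t
    then show "a \<in> saturation P I"
      using prime_mult_notin[OF P] by (intro saturationI[of _ "t \<otimes> s"]) (auto simp: m_assoc)
  qed
  show "saturation P I \<subseteq> saturation P (saturation P I)"
    by (rule saturation_increasing[OF P]) (auto simp: saturation_def)
qed

lemma saturation_least:
  "I \<subseteq> J \<Longrightarrow> saturation P J = J \<Longrightarrow> saturation P I \<subseteq> J"
  using saturation_mono by blast

lemma saturatedD:
  "saturation P J = J \<Longrightarrow> a \<in> carrier R \<Longrightarrow> s \<in> carrier R \<Longrightarrow> s \<notin> P \<Longrightarrow> s \<otimes> a \<in> J \<Longrightarrow> a \<in> J"
  using saturationI by blast

lemma saturation_subset_carrier: "saturation P I \<subseteq> carrier R"
  unfolding saturation_def by blast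

text \<open>
  Nakayama's lemma over \<open>R\<^sub>P\<close>: if \<open>M = N + P M\<close> locally, then \<open>M = N\<close>. Instead of counting
  generators, take a saturated \<open>L\<close> maximal among those between \<open>N\<close> and \<open>M\<close> and different from
  \<open>M\<close>. For \<open>a\<close> in \<open>M\<close> outside \<open>L\<close> the ideal \<open>L + (a)\<close> is locally \<open>M\<close>, so \<open>M = N + P M\<close> gives \<open>t
  a \<in> L + P a\<close> with \<open>t \<notin> P\<close>, hence \<open>(t - q) a \<in> L\<close> with \<open>t - q \<notin> P\<close>, and \<open>a \<in> L\<close>.
\<close>

lemma local_nakayama:
  assumes noeth: "noetherian_ring R" and P: "primeideal P R"
    and M: "ideal M R" and N: "ideal N R" "saturation P N = N" "N \<subseteq> M"
    and Msat: "saturation P M = M"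
    and gen: "M \<subseteq> saturation P (Idl (N \<union> {q \<otimes> a | q a. q \<in> P \<and> a \<in> M}))"
  shows "M = N"
proof (rule ccontr)
  assume ne: "M \<noteq> N"
  let ?A = "{L. ideal L R \<and> saturation P L = L \<and> N \<subseteq> L \<and> L \<subset> M}"
  have NA: "N \<in> ?A" using N ne by simp
  have "?A \<noteq> {}" using NA by (metis empty_iff)
  moreover have "\<And>I. I \<in> ?A \<Longrightarrow> ideal I R" by simp
  ultimately obtain L where L: "L \<in> ?A" and Lmax: "\<forall>I\<in>?A. L \<subseteq> I \<longrightarrow> I = L"
    by (rule noetherian_maximal[OF noeth])
  have Li: "ideal L R" and Ls: "saturation P L = L" and NL: "N \<subseteq> L" and LM: "L \<subset> M"
    using L by auto
  obtain a where a: "a \<in> M" "a \<notin> L" using LM by blast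
  have ac: "a \<in> carrier R" using a ideal_subset[OF M] by blast
  have Pc: "P \<subseteq> carrier R" and Lc: "L \<subseteq> carrier R" and Mc: "M \<subseteq> carrier R"
    by (simp_all add: ideal_subset prime_ideal[OF P] Li M)
  have La: "insert a L \<subseteq> carrier R" using ac Lc by blast
  let ?L' = "saturation P (Idl (insert a L))"
  have L'i: "ideal ?L' R" by (rule saturation_ideal[OF P genideal_ideal[OF La]])
  have L'M: "?L' \<subseteq> M"
    by (rule saturation_least[OF genideal_minimal[OF M] Msat]) (use a LM in blast)
  have L'sat: "saturation P ?L' = ?L'"
    by (rule saturation_idem[OF P ideal_subset[OF genideal_ideal[OF La]]])
  have LL': "insert a L \<subseteq> ?L'"
    using genideal_self[OF La] saturation_increasing[OF P ideal_subset[OF genideal_ideal[OF La]]]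
    by blast
  have L'eq: "?L' = M"
  proof (rule ccontr)
    assume "?L' \<noteq> M"
    then have "?L' \<in> ?A" using L'i L'M L'sat LL' NL by auto
    then have "?L' = L" using Lmax LL' by (meson insert_subset)
    then show False using LL' a by blast
  qed
  \<comment> \<open>Locally this is \<open>L + P a\<close>, which contains \<open>N + P M\<close> because \<open>M\<close> is locally \<open>L + (a)\<close>.\<close>
  define D where "D = {b \<in> carrier R. \<exists>t\<in>carrier R - P. \<exists>q\<in>P. \<exists>l\<in>L. t \<otimes> b = l \<oplus> q \<otimes> a}"
  have DI: "b \<in> D" if "b \<in> carrier R" "t \<in> carrier R" "t \<notin> P" "q \<in> P" "l \<in> L" "t \<otimes> b = l \<oplus> q \<otimes> a" for b t q l
    using that unfolding D_def by blast
  have P': "ideal P R" by (rule prime_ideal[OF P])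
  have "ideal D R"
  proof (rule ideal_closedI)
    show "D \<subseteq> carrier R" unfolding D_def by blast
    show "\<zero> \<in> D"
      using prime_one[OF P] ideal_zero[OF P'] ideal_zero[OF Li] ac
      by (intro DI[of _ \<one> \<zero> \<zero>]) auto
  next
    fix b c assume "b \<in> D" "c \<in> D"
    then obtain t q l t' q' l' where *: "b \<in> carrier R" "t \<in> carrier R" "t \<notin> P" "q \<in> P" "l \<in> L"
      "t \<otimes> b = l \<oplus> q \<otimes> a" "c \<in> carrier R" "t' \<in> carrier R" "t' \<notin> P" "q' \<in> P" "l' \<in> L"
      "t' \<otimes> c = l' \<oplus> q' \<otimes> a" unfolding D_def by blast
    have c: "q \<in> carrier R" "q' \<in> carrier R" "l \<in> carrier R" "l' \<in> carrier R"
      using * Pc Lc by auto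
    have "(t \<otimes> t') \<otimes> (b \<oplus> c) = t' \<otimes> (t \<otimes> b) \<oplus> t \<otimes> (t' \<otimes> c)"
      using *(1,2,7,8) by algebra
    also have "\<dots> = (t' \<otimes> l \<oplus> t \<otimes> l') \<oplus> (t' \<otimes> q \<oplus> t \<otimes> q') \<otimes> a"
      unfolding *(6,12) using c *(2,8) ac by algebra
    finally show "b \<oplus> c \<in> D"
      by (rule DI[rotated -1])
        (use * prime_mult_notin[OF P] ideal_add ideal_mult P' Li in auto)
  next
    fix r b assume r: "r \<in> carrier R" and "b \<in> D"
    then obtain t q l where *: "b \<in> carrier R" "t \<in> carrier R" "t \<notin> P" "q \<in> P" "l \<in> L"
      "t \<otimes> b = l \<oplus> q \<otimes> a" unfolding D_def by blast
    have c: "q \<in> carrier R" "l \<in> carrier R" using * Pc Lc by auto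
    have "t \<otimes> (r \<otimes> b) = r \<otimes> (t \<otimes> b)" using *(1,2) r by algebra
    also have "\<dots> = (r \<otimes> l) \<oplus> (r \<otimes> q) \<otimes> a" unfolding *(6) using c r ac by algebra
    finally show "r \<otimes> b \<in> D"
      by (rule DI[rotated -1]) (use * r ideal_mult P' Li in auto)
  qed
  moreover have "N \<union> {q \<otimes> b | q b. q \<in> P \<and> b \<in> M} \<subseteq> D"
  proof
    fix u assume "u \<in> N \<union> {q \<otimes> b | q b. q \<in> P \<and> b \<in> M}"
    then consider "u \<in> L" | q b where "u = q \<otimes> b" "q \<in> P" "b \<in> M" using NL by blast
    then show "u \<in> D"
    proof cases
      case 1
      then show ?thesis
        using prime_one[OF P] ideal_zero[OF P'] ac Lc by (intro DI[of _ \<one> \<zero> u]) auto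
    next
      case 2
      have "b \<in> ?L'" using 2 L'eq by simp
      then obtain t where t: "b \<in> carrier R" "t \<in> carrier R" "t \<notin> P" "t \<otimes> b \<in> Idl (insert a L)"
        by (rule saturationE)
      then obtain l r where lr: "l \<in> L" "r \<in> carrier R" "t \<otimes> b = l \<oplus> r \<otimes> a"
        unfolding Idl_insert_ideal[OF Li ac] by blast
      have c: "q \<in> carrier R" "l \<in> carrier R" using 2 lr Pc Lc by auto
      have "t \<otimes> (q \<otimes> b) = q \<otimes> (t \<otimes> b)" using c t(1,2) by algebra
      also have "\<dots> = q \<otimes> l \<oplus> (r \<otimes> q) \<otimes> a" unfolding lr(3) using c lr(2) ac by algebra
      finally show ?thesis unfolding 2(1)
        by (rule DI[rotated -1]) (use t 2 lr c ideal_mult P' Li in auto)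
    qed
  qed
  ultimately have "Idl (N \<union> {q \<otimes> b | q b. q \<in> P \<and> b \<in> M}) \<subseteq> D" by (rule genideal_minimal)
  then have "a \<in> saturation P D" using gen a(1) saturation_mono by blast
  then obtain s t q l where *: "s \<in> carrier R" "s \<notin> P" "t \<in> carrier R" "t \<notin> P" "q \<in> P" "l \<in> L"
      "t \<otimes> (s \<otimes> a) = l \<oplus> q \<otimes> a" unfolding D_def by (elim saturationE) blast
  have c: "q \<in> carrier R" "l \<in> carrier R" using * Pc Lc by auto
  have "(t \<otimes> s \<ominus> q) \<otimes> a = t \<otimes> (s \<otimes> a) \<ominus> q \<otimes> a" using *(1,3) ac c by algebra
  also have "\<dots> = l" unfolding *(7) using c ac by algebra
  finally have "(t \<otimes> s \<ominus> q) \<otimes> a \<in> L" using * by simp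
  moreover have "t \<otimes> s \<ominus> q \<notin> P"
  proof
    assume "t \<otimes> s \<ominus> q \<in> P"
    then have "(t \<otimes> s \<ominus> q) \<oplus> q \<in> P" using ideal_add[OF P'] * by blast
    moreover have "(t \<otimes> s \<ominus> q) \<oplus> q = t \<otimes> s" using *(1,3) c by algebra
    ultimately show False using * prime_mult_notin[OF P] by auto
  qed
  ultimately have "a \<in> L"
    using saturatedD[OF Ls ac, of "t \<otimes> s \<ominus> q"] *(1,3) c by simp
  then show False using a by blast
qed


section \<open>Krull's principal ideal theorem\<close>

lemma ideal_colon_element:
  assumes "ideal I R" "b \<in> carrier R"
  shows "ideal {r \<in> carrier R. r \<otimes> b \<in> I} R"
proof (rule ideal_closedI)
  show "\<zero> \<in> {r \<in> carrier R. r \<otimes> b \<in> I}" using assms ideal_zero by simp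
next
  fix u v assume uv: "u \<in> {r \<in> carrier R. r \<otimes> b \<in> I}" "v \<in> {r \<in> carrier R. r \<otimes> b \<in> I}"
  then show "u \<oplus> v \<in> {r \<in> carrier R. r \<otimes> b \<in> I}"
    using assms ideal_add[OF assms(1)] by (simp add: l_distr)
next
  fix r u assume "r \<in> carrier R" "u \<in> {r \<in> carrier R. r \<otimes> b \<in> I}"
  then show "r \<otimes> u \<in> {r \<in> carrier R. r \<otimes> b \<in> I}"
    using assms ideal_mult[OF assms(1)] by (simp add: m_assoc)
qed auto

text \<open>
  An associated prime of \<open>R/I\<close>: a maximal colon ideal \<open>I : b\<close> with \<open>b \<notin> I\<close> is prime. Saturation
  of \<open>I\<close> places it below \<open>P\<close>, since a multiplier outside \<open>P\<close> would put \<open>b\<close> into \<open>I\<close>.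
\<close>

lemma prime_colon_exists:
  assumes noeth: "noetherian_ring R" and P: "primeideal P R"
    and I: "ideal I R" "saturation P I = I" "I \<noteq> carrier R"
  obtains b where "b \<in> carrier R" "b \<notin> I" "primeideal {r \<in> carrier R. r \<otimes> b \<in> I} R"
    "I \<subseteq> {r \<in> carrier R. r \<otimes> b \<in> I}" "{r \<in> carrier R. r \<otimes> b \<in> I} \<subseteq> P"
proof -
  let ?c = "\<lambda>b. {r \<in> carrier R. r \<otimes> b \<in> I}"
  have Ic: "I \<subseteq> carrier R" by (rule ideal_subset[OF I(1)])
  then obtain b0 where "b0 \<in> carrier R - I" using I(3) by blast
  then have "?c ` (carrier R - I) \<noteq> {}" by blast
  moreover have "\<And>K. K \<in> ?c ` (carrier R - I) \<Longrightarrow> ideal K R"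
    using ideal_colon_element[OF I(1)] by auto
  ultimately obtain Q where Q: "Q \<in> ?c ` (carrier R - I)"
    and max: "\<forall>K\<in>?c ` (carrier R - I). Q \<subseteq> K \<longrightarrow> K = Q"
    by (rule noetherian_maximal[OF noeth])
  then obtain b where b: "b \<in> carrier R" "b \<notin> I" "Q = ?c b" by auto
  have Qi: "ideal Q R" using ideal_colon_element[OF I(1) b(1)] b(3) by simp
  have "primeideal Q R"
  proof (rule primeidealI[OF Qi is_cring])
    show "carrier R \<noteq> Q"
    proof
      assume "carrier R = Q"
      then have "\<one> \<in> ?c b" using b(3) one_closed by blast
      then show False using b by simp
    qed
  next
    fix u v assume uv: "u \<in> carrier R" "v \<in> carrier R" "u \<otimes> v \<in> Q"
    show "u \<in> Q \<or> v \<in> Q"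
    proof (rule ccontr)
      assume n: "\<not> (u \<in> Q \<or> v \<in> Q)"
      then have "v \<otimes> b \<notin> I" using b uv by simp
      then have "?c (v \<otimes> b) \<in> ?c ` (carrier R - I)" using uv b by blast
      moreover have "Q \<subseteq> ?c (v \<otimes> b)"
      proof
        fix r assume r: "r \<in> Q"
        then have rc: "r \<in> carrier R" "r \<otimes> b \<in> I" using b(3) by auto
        have "r \<otimes> (v \<otimes> b) = v \<otimes> (r \<otimes> b)" using rc(1) uv(2) b(1) by algebra
        then show "r \<in> ?c (v \<otimes> b)" using rc ideal_mult[OF I(1) rc(2) uv(2)] by simp
      qed
      ultimately have "?c (v \<otimes> b) = Q" using max by blast
      moreover have "u \<in> ?c (v \<otimes> b)" using uv b by (simp add: m_assoc)
      ultimately show False using n by blast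
    qed
  qed
  moreover have "I \<subseteq> Q" using b(1,3) Ic ideal_mult_right[OF I(1)] by auto
  moreover have "Q \<subseteq> P"
  proof
    fix r assume r: "r \<in> Q"
    then have rc: "r \<in> carrier R" "r \<otimes> b \<in> I" using b(3) by auto
    show "r \<in> P" using saturatedD[OF I(2) b(1) rc(1) _ rc(2)] b(2) by blast
  qed
  ultimately show ?thesis using that b by blast
qed

text \<open>
  If \<open>P\<close> is minimal over \<open>J\<close>, then \<open>R\<^sub>P / J R\<^sub>P\<close> is Artinian. Noetherian induction on the lower
  bound \<open>I\<close> of the chain replaces the notion of length. A maximal bad \<open>I\<close> has an associated
  prime \<open>I : b\<close>, which is \<open>P\<close> by minimality, so \<open>I' = I + (b)\<close> is locally only one dimension
  larger. The sums of the chain with \<open>I'\<close> become stationary by maximality of \<open>I\<close>, the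
  intersections with \<open>I'\<close> because they are \<open>I\<close> or \<open>I'\<close>, and the modular law then makes the chain
  itself stationary.
\<close>

lemma saturated_dcc:
  assumes noeth: "noetherian_ring R" and P: "primeideal P R" and J: "ideal J R"
    and minimal: "\<And>Q. primeideal Q R \<Longrightarrow> J \<subseteq> Q \<Longrightarrow> Q \<subseteq> P \<Longrightarrow> Q = P"
    and C: "\<And>n::nat. ideal (C n) R" "\<And>n. saturation P (C n) = C n" "\<And>n. J \<subseteq> C n"
      "\<And>n. C (Suc n) \<subseteq> C n"
  shows "\<exists>n. \<forall>k\<ge>n. C k = C n"
proof (rule ccontr)
  assume bad: "\<not> ?thesis"
  define good where "good I \<longleftrightarrow> (\<forall>C::nat \<Rightarrow> 'a set. (\<forall>n. ideal (C n) R \<and> saturation P (C n) = C n \<and> I \<subseteq> C n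
    \<and> C (Suc n) \<subseteq> C n) \<longrightarrow> (\<exists>n. \<forall>k\<ge>n. C k = C n))" for I
  let ?A = "{I. ideal I R \<and> saturation P I = I \<and> J \<subseteq> I \<and> \<not> good I}"
  have "\<not> good (saturation P J)"
  proof -
    have "saturation P J \<subseteq> C n" for n by (rule saturation_least[OF C(3,2)])
    then show ?thesis unfolding good_def using bad C by blast
  qed
  then have "saturation P J \<in> ?A"
    using saturation_ideal[OF P J] saturation_idem[OF P ideal_subset[OF J]]
      saturation_increasing[OF P ideal_subset[OF J]] by simp
  then have "?A \<noteq> {}" by (metis empty_iff)
  moreover have "\<And>I. I \<in> ?A \<Longrightarrow> ideal I R" by simp
  ultimately obtain I where I: "I \<in> ?A" and Imax: "\<forall>K\<in>?A. I \<subseteq> K \<longrightarrow> K = I"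
    by (rule noetherian_maximal[OF noeth])
  have Ii: "ideal I R" and Is: "saturation P I = I" and JI: "J \<subseteq> I" and Ibad: "\<not> good I"
    using I by auto
  obtain D where D: "\<And>n::nat. ideal (D n) R" "\<And>n. saturation P (D n) = D n" "\<And>n. I \<subseteq> D n"
      "\<And>n. D (Suc n) \<subseteq> D n" and Dbad: "\<not> (\<exists>n. \<forall>k\<ge>n. D k = D n)"
    using Ibad unfolding good_def by blast
  have Dc: "D n \<subseteq> carrier R" for n by (rule ideal_subset[OF D(1)])
  have Ine: "I \<noteq> carrier R"
  proof
    assume "I = carrier R"
    then have "D n = carrier R" for n using D(3)[of n] Dc[of n] by blast
    then show False using Dbad by blast
  qed
  obtain b where b: "b \<in> carrier R" "b \<notin> I" "primeideal {r \<in> carrier R. r \<otimes> b \<in> I} R"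
    "I \<subseteq> {r \<in> carrier R. r \<otimes> b \<in> I}" "{r \<in> carrier R. r \<otimes> b \<in> I} \<subseteq> P"
    by (rule prime_colon_exists[OF noeth P Ii Is Ine])
  have Pcolon: "{r \<in> carrier R. r \<otimes> b \<in> I} = P"
    using minimal[OF b(3) _ b(5)] JI b(4) by (meson order_trans)
  have Ic: "I \<subseteq> carrier R" by (rule ideal_subset[OF Ii])
  have Ib: "insert b I \<subseteq> carrier R" using Ic b(1) by blast
  define I' where "I' = saturation P (Idl (insert b I))"
  have I'i: "ideal I' R" unfolding I'_def by (rule saturation_ideal[OF P genideal_ideal[OF Ib]])
  have I'c: "I' \<subseteq> carrier R" by (rule ideal_subset[OF I'i])
  have I's: "saturation P I' = I'"
    unfolding I'_def by (rule saturation_idem[OF P ideal_subset[OF genideal_ideal[OF Ib]]])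
  have II': "insert b I \<subseteq> I'"
    unfolding I'_def using genideal_self[OF Ib]
      saturation_increasing[OF P ideal_subset[OF genideal_ideal[OF Ib]]] by (rule order_trans)
  have I'good: "good I'"
  proof (rule ccontr)
    assume "\<not> good I'"
    then have "I' \<in> ?A" using I'i I's II' JI by auto
    then have "I' = I" using Imax II' by (meson insert_subset)
    then show False using II' b(2) by blast
  qed
  \<comment> \<open>The quotient \<open>I' / I\<close> is one-dimensional over the residue field at \<open>P\<close>.\<close>
  have onedim: "I' \<subseteq> D n" if a: "a \<in> I'" "a \<in> D n" "a \<notin> I" for a n
  proof -
    obtain s where s: "a \<in> carrier R" "s \<in> carrier R" "s \<notin> P" "s \<otimes> a \<in> Idl (insert b I)"
      using a(1) unfolding I'_def by (rule saturationE)
    then obtain i r where ir: "i \<in> I" "r \<in> carrier R" "s \<otimes> a = i \<oplus> r \<otimes> b"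
      unfolding Idl_insert_ideal[OF Ii b(1)] by blast
    have ic: "i \<in> carrier R" using ir Ic by blast
    have "r \<notin> P"
    proof
      assume "r \<in> P"
      then have "r \<otimes> b \<in> I" using Pcolon by blast
      then have "s \<otimes> a \<in> I" using ir ideal_add[OF Ii] by simp
      then show False using saturatedD[OF Is s(1-3)] a(3) by blast
    qed
    moreover have "r \<otimes> b \<in> D n"
    proof -
      have "s \<otimes> a \<in> D n" by (rule ideal_mult[OF D(1) a(2) s(2)])
      then have "r \<otimes> b \<oplus> i \<in> D n" using ir ic b(1) by (simp add: a_comm)
      then show ?thesis
        using ideal_add_cancel[OF D(1), of "r \<otimes> b" i n] D(3) ir(1,2) b(1) by auto
    qed
    ultimately have "b \<in> D n" using saturatedD[OF D(2) b(1) ir(2)] by blast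
    then have "insert b I \<subseteq> D n" using D(3) by simp
    then show ?thesis unfolding I'_def
      by (intro saturation_least[OF genideal_minimal[OF D(1)] D(2)])
  qed
  have "\<exists>n0. \<forall>k\<ge>n0. D k \<inter> I' = D n0 \<inter> I'"
  proof (cases "\<exists>n0. D n0 \<inter> I' \<subseteq> I")
    case True
    then obtain n0 where n0: "D n0 \<inter> I' \<subseteq> I" by blast
    have "D k \<inter> I' = D n0 \<inter> I'" if "k \<ge> n0" for k
    proof -
      have "D k \<subseteq> D n0" using lift_Suc_antimono_le[of D n0 k, OF D(4) that] .
      moreover have "I \<subseteq> D k \<inter> I'" using D(3) II' by blast
      ultimately show ?thesis using n0 by blast
    qed
    then show ?thesis by blast
  next
    case False
    then have "I' \<subseteq> D n" for n using onedim[of _ n] by blast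
    then have "D n \<inter> I' = I'" for n by blast
    then show ?thesis by simp
  qed
  then obtain n0 where n0: "\<And>k. k \<ge> n0 \<Longrightarrow> D k \<inter> I' = D n0 \<inter> I'" by blast
  define E where "E n = saturation P (D n <+> I')" for n
  have sum: "ideal (D n <+> I') R" for n by (rule add_ideals[OF D(1) I'i])
  have sumD: "D n <+> I' = {d \<oplus> i | d i. d \<in> D n \<and> i \<in> I'}" for n
    unfolding set_add_def set_mult_def by auto
  have sumI': "I' \<subseteq> D n <+> I'" and sumDn: "D n \<subseteq> D n <+> I'" for n
  proof -
    show "I' \<subseteq> D n <+> I'"
    proof
      fix i assume i: "i \<in> I'"
      then have "i = \<zero> \<oplus> i" using I'c by auto
      then show "i \<in> D n <+> I'" unfolding sumD using i ideal_zero[OF D(1)] by blast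
    qed
    show "D n \<subseteq> D n <+> I'"
    proof
      fix i assume i: "i \<in> D n"
      then have "i = i \<oplus> \<zero>" using Dc[of n] by auto
      then show "i \<in> D n <+> I'" unfolding sumD using i ideal_zero[OF I'i] by blast
    qed
  qed
  have Einc: "D n <+> I' \<subseteq> E n" for n
    unfolding E_def by (rule saturation_increasing[OF P ideal_subset[OF sum]])
  have "ideal (E n) R \<and> saturation P (E n) = E n \<and> I' \<subseteq> E n \<and> E (Suc n) \<subseteq> E n" for n
  proof (intro conjI)
    show "ideal (E n) R" unfolding E_def by (rule saturation_ideal[OF P sum])
    show "saturation P (E n) = E n" unfolding E_def
      by (rule saturation_idem[OF P ideal_subset[OF sum]])
    show "I' \<subseteq> E n" using Einc sumI' by blast
    show "E (Suc n) \<subseteq> E n" unfolding E_def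
      by (rule saturation_mono) (use D(4) in \<open>auto simp: sumD\<close>)
  qed
  then obtain n1 where n1: "\<And>k. k \<ge> n1 \<Longrightarrow> E k = E n1"
    using I'good unfolding good_def by blast
  have "D k = D (max n0 n1)" if k: "k \<ge> max n0 n1" for k
  proof
    let ?N = "max n0 n1"
    show DkN: "D k \<subseteq> D ?N" using lift_Suc_antimono_le[of D ?N k, OF D(4) k] .
    have same: "D k \<inter> I' = D ?N \<inter> I'" using n0[of k] n0[of ?N] k by simp
    have "E k = E ?N" using n1[of k] n1[of ?N] k by simp
    then have sub: "D ?N \<subseteq> E k" using sumDn[of ?N] Einc[of ?N] by blast
    show "D ?N \<subseteq> D k"
    proof
      fix a assume a: "a \<in> D ?N"
      then have "a \<in> E k" using sub by blast
      then obtain s where s: "a \<in> carrier R" "s \<in> carrier R" "s \<notin> P" "s \<otimes> a \<in> D k <+> I'"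
        unfolding E_def by (rule saturationE)
      then obtain d i where di: "d \<in> D k" "i \<in> I'" "s \<otimes> a = d \<oplus> i" unfolding sumD by blast
      have c: "d \<in> carrier R" "i \<in> carrier R" using di Dc I'c by blast+
      have "s \<otimes> a \<in> D ?N" by (rule ideal_mult[OF D(1) a s(2)])
      then have "i \<oplus> d \<in> D ?N" using di c by (simp add: a_comm)
      then have "i \<in> D ?N" using ideal_add_cancel[OF D(1) c(2), of d] di DkN by blast
      then have "i \<in> D k" using di same by blast
      then have "s \<otimes> a \<in> D k" using di ideal_add[OF D(1)] by simp
      then show "a \<in> D k" by (rule saturatedD[OF D(2) s(1-3)])
    qed
  qed
  then show False using Dbad by blast
qed


text \<open>
  A variant of the symbolic powers of the prime \<open>Q\<close> modulo \<open>Q0\<close>: the saturation at \<open>Q\<close> is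
  repeated in every step, which keeps each term saturated by construction.
\<close>

primrec symbolic_power :: "'a set \<Rightarrow> 'a set \<Rightarrow> nat \<Rightarrow> 'a set"
  where "symbolic_power Q0 Q 0 = carrier R"
  | "symbolic_power Q0 Q (Suc n) =
      saturation Q (Idl (Q0 \<union> {q \<otimes> a | q a. q \<in> Q \<and> a \<in> symbolic_power Q0 Q n}))"

text \<open>
  Krull's theorem says that \<open>P\<close> is not minimal over \<open>Q0 + (x)\<close>, as \<open>Q0 \<subset> Q \<subset> P\<close>. If it were, the
  symbolic powers \<open>S n\<close> of \<open>Q\<close> would become stationary modulo \<open>x\<close> by \<open>saturated_dcc\<close>. As \<open>x \<notin>
  Q\<close>, an element \<open>x r\<close> of \<open>S n\<close> has \<open>r \<in> S n\<close>, so \<open>S n = S (n + 1) + x (S n)\<close> locally at \<open>P\<close>.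
  Nakayama's lemma at \<open>P\<close> gives \<open>S n = S (n + 1)\<close>, and Nakayama's lemma at \<open>Q\<close> gives \<open>S n = Q0\<close>.
  Powers of elements of \<open>Q\<close> lie in \<open>S n\<close>, so \<open>Q \<subseteq> Q0\<close>, a contradiction.
\<close>

theorem principal_ideal_theorem:
  assumes noeth: "noetherian_ring R"
    and primes: "primeideal Q0 R" "primeideal Q R" "primeideal P R"
    and lt: "Q0 \<subset> Q" "Q \<subset> P" and x: "x \<in> P" "x \<notin> Q"
  obtains N where "primeideal N R" "insert x Q0 \<subseteq> N" "N \<subset> P"
proof (rule ccontr)
  assume "\<not> thesis"
  then have none: "\<And>N. primeideal N R \<Longrightarrow> insert x Q0 \<subseteq> N \<Longrightarrow> \<not> N \<subset> P"
    using that by blast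
  note ids = primes[THEN prime_ideal]
  note subs = ids[THEN ideal_subset]
  have xc: "x \<in> carrier R" using x(1) subs(3) by blast
  define S where "S n = symbolic_power Q0 Q n" for n
  have S0: "S 0 = carrier R" and SS: "S (Suc n) =
      saturation Q (Idl (Q0 \<union> {q \<otimes> a | q a. q \<in> Q \<and> a \<in> S n}))" for n
    unfolding S_def by simp_all
  have Ssub: "S n \<subseteq> carrier R" for n by (cases n) (simp_all add: S0 SS saturation_subset_carrier)
  have gsub: "Q0 \<union> {q \<otimes> a | q a. q \<in> Q \<and> a \<in> S n} \<subseteq> carrier R" for n
    using subs Ssub[of n] by auto
  have gid: "ideal (Idl (Q0 \<union> {q \<otimes> a | q a. q \<in> Q \<and> a \<in> S n})) R" for n
    by (rule genideal_ideal[OF gsub])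
  have Sid: "ideal (S n) R" for n
    by (cases n) (simp_all add: S0 SS oneideal saturation_ideal[OF primes(2) gid])
  have Ssat: "saturation Q (S n) = S n" for n
  proof (cases n)
    case 0
    have "carrier R \<subseteq> saturation Q (carrier R)" by (rule saturation_increasing[OF primes(2)]) simp
    then show ?thesis
      using subset_antisym[OF saturation_subset_carrier[of Q "carrier R"]] by (simp add: 0 S0)
  qed (simp add: SS saturation_idem[OF primes(2) ideal_subset[OF gid]])
  have inc: "Q0 \<union> {q \<otimes> a | q a. q \<in> Q \<and> a \<in> S n} \<subseteq> S (Suc n)" for n
    unfolding SS using genideal_self[OF gsub]
      saturation_increasing[OF primes(2) ideal_subset[OF gid]] by (rule order_trans)
  have Q0S: "Q0 \<subseteq> S n" for n using inc[of "n - 1"] subs by (cases n) (auto simp: S0)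
  have dec: "S (Suc n) \<subseteq> S n" for n
  proof -
    have "Q0 \<union> {q \<otimes> a | q a. q \<in> Q \<and> a \<in> S n} \<subseteq> S n"
      using Q0S[of n] ideal_mult[OF Sid[of n]] subs(2) by auto
    then show ?thesis unfolding SS by (rule saturation_least[OF genideal_minimal[OF Sid] Ssat])
  qed
  define J where "J = Idl (insert x Q0)"
  have xQ0: "insert x Q0 \<subseteq> carrier R" using xc subs by blast
  have Jid: "ideal J R" unfolding J_def by (rule genideal_ideal[OF xQ0])
  have xJ: "insert x Q0 \<subseteq> J" unfolding J_def by (rule genideal_self[OF xQ0])
  have minimal: "N = P" if "primeideal N R" "J \<subseteq> N" "N \<subseteq> P" for N
    using none[OF that(1)] that(2,3) xJ by blast
  have xS: "insert x (S n) \<subseteq> carrier R" for n using xc Ssub by blast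
  define C where "C n = saturation P (Idl (insert x (S n)))" for n
  have "\<exists>n. \<forall>k\<ge>n. C k = C n"
  proof (rule saturated_dcc[OF noeth primes(3) Jid minimal])
    fix n
    show "ideal (C n) R" unfolding C_def by (rule saturation_ideal[OF primes(3) genideal_ideal[OF xS]])
    show "saturation P (C n) = C n" unfolding C_def
      by (rule saturation_idem[OF primes(3) ideal_subset[OF genideal_ideal[OF xS]]])
    have "J \<subseteq> Idl (insert x (S n))" unfolding J_def
      by (rule Idl_mono[OF _ xS]) (use Q0S in blast)
    then show "J \<subseteq> C n" unfolding C_def
      using saturation_increasing[OF primes(3) ideal_subset[OF genideal_ideal[OF xS]]] by blast
    show "C (Suc n) \<subseteq> C n" unfolding C_def
      by (rule saturation_mono[OF Idl_mono[OF _ xS]]) (use dec in blast)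
  qed
  then obtain n where "C (Suc n) = C n" by (meson le_SucI order_refl)
  then have CC: "C n \<subseteq> C (Suc n)" by simp
  have SatP: "saturation P (S n) = S n" for n
  proof
    show "saturation P (S n) \<subseteq> S n"
      using Ssat[of n] lt(2) unfolding saturation_def by blast
    show "S n \<subseteq> saturation P (S n)" by (rule saturation_increasing[OF primes(3) Ssub])
  qed
  have PSc: "S (Suc n) \<union> {q \<otimes> a | q a. q \<in> P \<and> a \<in> S n} \<subseteq> carrier R"
    using Ssub[of n] Ssub[of "Suc n"] subs by auto
  have step: "S n \<subseteq> saturation P (Idl (S (Suc n) \<union> {q \<otimes> a | q a. q \<in> P \<and> a \<in> S n}))"
  proof
    fix a assume a: "a \<in> S n"
    have "a \<in> Idl (insert x (S n))" using genideal_self[OF xS, of n] a by blast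
    then have "a \<in> C n" unfolding C_def
      using saturation_increasing[OF primes(3) ideal_subset[OF genideal_ideal[OF xS]]] by blast
    then have "a \<in> C (Suc n)" using CC by blast
    then obtain s where s: "a \<in> carrier R" "s \<in> carrier R" "s \<notin> P" "s \<otimes> a \<in> Idl (insert x (S (Suc n)))"
      unfolding C_def by (rule saturationE)
    then obtain b r where br: "b \<in> S (Suc n)" "r \<in> carrier R" "s \<otimes> a = b \<oplus> r \<otimes> x"
      unfolding Idl_insert_ideal[OF Sid xc] by blast
    have bc: "b \<in> carrier R" using br(1) Ssub by blast
    have "s \<otimes> a \<in> S n" by (rule ideal_mult[OF Sid a s(2)])
    then have "x \<otimes> r \<oplus> b \<in> S n" using br bc xc by (simp add: a_comm m_comm)
    then have "x \<otimes> r \<in> S n"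
      using ideal_add_cancel[OF Sid, of "x \<otimes> r" b n] br(1,2) dec xc by auto
    then have rS: "r \<in> S n" using saturatedD[OF Ssat br(2) xc x(2)] by blast
    then have "x \<otimes> r \<in> {q \<otimes> a | q a. q \<in> P \<and> a \<in> S n}" using x(1) by blast
    then have "x \<otimes> r \<in> Idl (S (Suc n) \<union> {q \<otimes> a | q a. q \<in> P \<and> a \<in> S n})"
      "b \<in> Idl (S (Suc n) \<union> {q \<otimes> a | q a. q \<in> P \<and> a \<in> S n})"
      using genideal_self[OF PSc] br(1) by blast+
    then have "s \<otimes> a \<in> Idl (S (Suc n) \<union> {q \<otimes> a | q a. q \<in> P \<and> a \<in> S n})"
      unfolding br(3) using ideal_add[OF genideal_ideal[OF PSc]] br(2) xc by (simp add: m_comm)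
    then show "a \<in> saturation P (Idl (S (Suc n) \<union> {q \<otimes> a | q a. q \<in> P \<and> a \<in> S n}))"
      by (rule saturationI[OF s(1-3)])
  qed
  have eq1: "S n = S (Suc n)"
    by (rule local_nakayama[OF noeth primes(3) Sid Sid SatP dec SatP step])
  have Q0sat: "saturation Q Q0 = Q0"
  proof
    show "saturation Q Q0 \<subseteq> Q0"
    proof
      fix a assume "a \<in> saturation Q Q0"
      then obtain s where s: "a \<in> carrier R" "s \<in> carrier R" "s \<notin> Q" "s \<otimes> a \<in> Q0"
        by (rule saturationE)
      then show "a \<in> Q0" using primeD[OF primes(1) s(2,1,4)] lt(1) by blast
    qed
    show "Q0 \<subseteq> saturation Q Q0" by (rule saturation_increasing[OF primes(2) subs(1)])
  qed
  have "S n \<subseteq> saturation Q (Idl (Q0 \<union> {q \<otimes> a | q a. q \<in> Q \<and> a \<in> S n}))"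
    using eq1 SS by simp
  then have eq2: "S n = Q0"
    by (rule local_nakayama[OF noeth primes(2) Sid ids(1) Q0sat Q0S Ssat])
  have "q [^] k \<in> S k" if "q \<in> Q" for q and k :: nat
  proof (induction k)
    case 0
    then show ?case by (simp add: S0)
  next
    case (Suc k)
    have "q \<otimes> q [^] k \<in> S (Suc k)" using inc[of k] that Suc by blast
    moreover have "q \<in> carrier R" using that subs by blast
    ultimately show ?case by (simp add: m_comm)
  qed
  then have "Q \<subseteq> Q0" using eq2 prime_pow[OF primes(1)] subs(2) by blast
  then show False using lt(1) by blast
qed

section \<open>Dimension and systems of parameters\<close>

definition prime_chain :: "nat \<Rightarrow> (nat \<Rightarrow> 'a set) \<Rightarrow> bool"
  where "prime_chain n P \<longleftrightarrow> (\<forall>i\<le>n. primeideal (P i) R) \<and> (\<forall>i<n. P i \<subset> P (Suc i))"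

lemma prime_chain_extend:
  assumes "prime_chain n P" "primeideal Q R" "P n \<subset> Q"
  shows "prime_chain (Suc n) (P(Suc n := Q))"
  using assms unfolding prime_chain_def by (auto simp: le_Suc_eq less_Suc_eq)

text \<open>
  Going down from the top of the chain, the principal ideal theorem replaces the last inner
  prime by one that contains \<open>x\<close>. In the end all primes above the lowest one contain \<open>x\<close>, and
  the lowest one is dropped.
\<close>

lemma prime_chain_through_element:
  assumes noeth: "noetherian_ring R"
  shows "prime_chain (Suc n) P \<Longrightarrow> x \<in> P (Suc n) \<Longrightarrow>
    \<exists>P'. prime_chain n P' \<and> insert x (P 0) \<subseteq> P' 0 \<and> P' n = P (Suc n)"
proof (induction n arbitrary: P)
  case 0
  have "primeideal (P (Suc 0)) R" "P 0 \<subset> P (Suc 0)"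
    using 0 unfolding prime_chain_def by auto
  then show ?case using 0 by (intro exI[of _ "\<lambda>_. P (Suc 0)"]) (auto simp: prime_chain_def)
next
  case (Suc n)
  have pr: "primeideal (P i) R" if "i \<le> Suc (Suc n)" for i
    using Suc.prems(1) that unfolding prime_chain_def by blast
  have lt: "P i \<subset> P (Suc i)" if "i < Suc (Suc n)" for i
    using Suc.prems(1) that unfolding prime_chain_def by blast
  have "\<exists>N. primeideal N R \<and> insert x (P n) \<subseteq> N \<and> P n \<subset> N \<and> N \<subset> P (Suc (Suc n))"
  proof (cases "x \<in> P (Suc n)")
    case True
    then show ?thesis using pr[of "Suc n"] lt[of n] lt[of "Suc n"] by auto
  next
    case False
    obtain N where N: "primeideal N R" "insert x (P n) \<subseteq> N" "N \<subset> P (Suc (Suc n))"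
      by (rule principal_ideal_theorem[OF noeth pr[of n] pr[of "Suc n"] pr[of "Suc (Suc n)"]
            lt[of n] lt[of "Suc n"] Suc.prems(2) False]) auto
    moreover have "x \<notin> P n" using False lt[of n] by auto
    ultimately show ?thesis by blast
  qed
  then obtain N where N: "primeideal N R" "insert x (P n) \<subseteq> N" "P n \<subset> N" "N \<subset> P (Suc (Suc n))"
    by blast
  have "prime_chain n P" using Suc.prems(1) unfolding prime_chain_def by auto
  then have ch: "prime_chain (Suc n) (P(Suc n := N))" using N by (intro prime_chain_extend)
  have "x \<in> (P(Suc n := N)) (Suc n)" using N(2) by simp
  from Suc.IH[OF ch this] obtain P' where P': "prime_chain n P'"
    "insert x ((P(Suc n := N)) 0) \<subseteq> P' 0" "P' n = (P(Suc n := N)) (Suc n)"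
    by blast
  have "prime_chain (Suc n) (P'(Suc n := P (Suc (Suc n))))"
    using P'(1,3) N(4) pr[of "Suc (Suc n)"] by (intro prime_chain_extend) auto
  moreover have "insert x (P 0) \<subseteq> (P'(Suc n := P (Suc (Suc n)))) 0" using P'(2) by simp
  moreover have "(P'(Suc n := P (Suc (Suc n)))) (Suc n) = P (Suc (Suc n))" by simp
  ultimately show ?case by blast
qed

lemma proper_ideal_in_maximal:
  assumes noeth: "noetherian_ring R" and I: "ideal I R" "I \<noteq> carrier R"
  obtains M where "maximalideal M R" "I \<subseteq> M"
proof -
  let ?A = "{J. ideal J R \<and> J \<noteq> carrier R \<and> I \<subseteq> J}"
  have "I \<in> ?A" using I by simp
  then have "?A \<noteq> {}" by (metis empty_iff)
  moreover have "\<And>J. J \<in> ?A \<Longrightarrow> ideal J R" by simp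
  ultimately obtain M where M: "M \<in> ?A" and max: "\<forall>J\<in>?A. M \<subseteq> J \<longrightarrow> J = M"
    by (rule noetherian_maximal[OF noeth])
  have "J = M \<or> J = carrier R" if "ideal J R" "M \<subseteq> J" for J
    using max M that by (cases "J = carrier R") auto
  then have "maximalideal M R"
    by (intro maximalidealI) (use M in auto)
  then show ?thesis using that M by blast
qed

text \<open>
  The radical is the intersection of the primes above the ideal: an ideal maximal among those
  above \<open>I\<close> without powers of \<open>a\<close> is prime.
\<close>

lemma radical_mem:
  assumes noeth: "noetherian_ring R" and I: "ideal I R" and a: "a \<in> carrier R"
    and all: "\<And>P. primeideal P R \<Longrightarrow> I \<subseteq> P \<Longrightarrow> a \<in> P"
  shows "\<exists>n::nat. a [^] n \<in> I"
proof (rule ccontr)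
  assume no: "\<not> ?thesis"
  let ?A = "{J. ideal J R \<and> I \<subseteq> J \<and> (\<forall>n::nat. a [^] n \<notin> J)}"
  have "I \<in> ?A" using I no by simp
  then have "?A \<noteq> {}" by (metis empty_iff)
  moreover have "\<And>J. J \<in> ?A \<Longrightarrow> ideal J R" by simp
  ultimately obtain M where M: "M \<in> ?A" and max: "\<forall>J\<in>?A. M \<subseteq> J \<longrightarrow> J = M"
    by (rule noetherian_maximal[OF noeth])
  have Mi: "ideal M R" and IM: "I \<subseteq> M" and nM: "\<And>n::nat. a [^] n \<notin> M" using M by auto
  have Mc: "M \<subseteq> carrier R" by (rule ideal_subset[OF Mi])
  have pow: "\<exists>n::nat. a [^] n \<in> Idl (insert u M)" if u: "u \<in> carrier R" "u \<notin> M" for u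
  proof (rule ccontr)
    assume no: "\<not> ?thesis"
    have uM: "insert u M \<subseteq> carrier R" using u Mc by blast
    have "insert u M \<subseteq> Idl (insert u M)" by (rule genideal_self[OF uM])
    then have "Idl (insert u M) \<in> ?A" using genideal_ideal[OF uM] IM no by auto
    then have "Idl (insert u M) = M" using max genideal_self[OF uM] by (meson insert_subset)
    then show False using genideal_self[OF uM] u by blast
  qed
  have "primeideal M R"
  proof (rule primeidealI[OF Mi is_cring])
    show "carrier R \<noteq> M" using nM[of 0] by auto
    fix u v assume uv: "u \<in> carrier R" "v \<in> carrier R" "u \<otimes> v \<in> M"
    show "u \<in> M \<or> v \<in> M"
    proof (rule ccontr)
      assume n: "\<not> (u \<in> M \<or> v \<in> M)"
      obtain k l :: nat where kl: "a [^] k \<in> Idl (insert u M)" "a [^] l \<in> Idl (insert v M)"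
        using pow uv n by blast
      then obtain i r j s where *: "i \<in> M" "r \<in> carrier R" "a [^] k = i \<oplus> r \<otimes> u"
        "j \<in> M" "s \<in> carrier R" "a [^] l = j \<oplus> s \<otimes> v"
        unfolding Idl_insert_ideal[OF Mi uv(1)] Idl_insert_ideal[OF Mi uv(2)] by blast
      have c: "i \<in> carrier R" "j \<in> carrier R" using * Mc by auto
      have "a [^] (k + l) = (i \<oplus> r \<otimes> u) \<otimes> (j \<oplus> s \<otimes> v)"
        using a by (simp add: nat_pow_mult[symmetric] *(3,6))
      also have "\<dots> = ((j \<oplus> s \<otimes> v) \<otimes> i \<oplus> (r \<otimes> u) \<otimes> j) \<oplus> (r \<otimes> s) \<otimes> (u \<otimes> v)"
        using c uv(1,2) *(2,5) by algebra
      also have "\<dots> \<in> M" using c uv *(1,2,4,5) by (simp add: ideal_add[OF Mi] ideal_mult[OF Mi])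
      finally show False using nM by blast
    qed
  qed
  then have "a \<in> M" using all IM by blast
  then show False using nM[of 1] a by simp
qed


text \<open>
  Finiteness of the set of minimal primes over \<open>I\<close>, without speaking of minimality. A maximal
  counterexample \<open>M\<close> is not prime; if \<open>u v \<in> M\<close> with \<open>u, v \<notin> M\<close>, then every prime above \<open>M\<close> lies
  above \<open>M + (u)\<close> or \<open>M + (v)\<close>, and the two finite sets can be united.
\<close>

lemma finite_primes_below:
  assumes noeth: "noetherian_ring R" and I: "ideal I R"
  shows "\<exists>F. finite F \<and> (\<forall>P\<in>F. primeideal P R) \<and>
    (\<forall>Q. primeideal Q R \<longrightarrow> I \<subseteq> Q \<longrightarrow> (\<exists>P\<in>F. I \<subseteq> P \<and> P \<subseteq> Q))"
    (is "?good I")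
proof (rule ccontr)
  assume bad: "\<not> ?good I"
  let ?A = "{J. ideal J R \<and> \<not> ?good J}"
  have "I \<in> ?A" using I bad by simp
  then have "?A \<noteq> {}" by (metis empty_iff)
  moreover have "\<And>J. J \<in> ?A \<Longrightarrow> ideal J R" by simp
  ultimately obtain M where M: "M \<in> ?A" and max: "\<forall>J\<in>?A. M \<subseteq> J \<longrightarrow> J = M"
    by (rule noetherian_maximal[OF noeth])
  have Mi: "ideal M R" and Mbad: "\<not> ?good M" using M by auto
  have Mc: "M \<subseteq> carrier R" by (rule ideal_subset[OF Mi])
  have good: "?good (Idl (insert u M))" if u: "u \<in> carrier R" "u \<notin> M" for u
  proof (rule ccontr)
    assume no: "\<not> ?thesis"
    have uM: "insert u M \<subseteq> carrier R" using u Mc by blast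
    have self: "insert u M \<subseteq> Idl (insert u M)" by (rule genideal_self[OF uM])
    have "Idl (insert u M) \<in> ?A" using genideal_ideal[OF uM] no by simp
    then have "Idl (insert u M) = M" using max self by (meson insert_subset)
    then show False using self u by blast
  qed
  have "M \<noteq> carrier R"
  proof
    assume "M = carrier R"
    then have "\<not> M \<subseteq> Q" if "primeideal Q R" for Q
      using prime_one[OF that] by auto
    then have "?good M" by (intro exI[of _ "{}"]) auto
    then show False using Mbad by blast
  qed
  moreover have "\<not> primeideal M R"
  proof
    assume "primeideal M R"
    then have "?good M" by (intro exI[of _ "{M}"]) auto
    then show False using Mbad by blast
  qed
  ultimately obtain u v where uv: "u \<in> carrier R" "v \<in> carrier R" "u \<otimes> v \<in> M" "u \<notin> M" "v \<notin> M"
    using primeidealI[OF Mi is_cring] by metis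
  obtain F where F: "finite F" "\<forall>P\<in>F. primeideal P R"
    "\<forall>Q. primeideal Q R \<longrightarrow> Idl (insert u M) \<subseteq> Q \<longrightarrow> (\<exists>P\<in>F. Idl (insert u M) \<subseteq> P \<and> P \<subseteq> Q)"
    using good[OF uv(1,4)] by blast
  obtain G where G: "finite G" "\<forall>P\<in>G. primeideal P R"
    "\<forall>Q. primeideal Q R \<longrightarrow> Idl (insert v M) \<subseteq> Q \<longrightarrow> (\<exists>P\<in>G. Idl (insert v M) \<subseteq> P \<and> P \<subseteq> Q)"
    using good[OF uv(2,5)] by blast
  have sub: "insert u M \<subseteq> carrier R" "insert v M \<subseteq> carrier R" using uv Mc by blast+
  have MI: "M \<subseteq> Idl (insert u M)" "M \<subseteq> Idl (insert v M)"
    using genideal_self[OF sub(1)] genideal_self[OF sub(2)] by simp_all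
  have "\<exists>P\<in>F \<union> G. M \<subseteq> P \<and> P \<subseteq> Q" if Q: "primeideal Q R" "M \<subseteq> Q" for Q
  proof -
    have "u \<in> Q \<or> v \<in> Q" using primeD[OF Q(1) uv(1,2)] uv(3) Q(2) by blast
    then show ?thesis
    proof
      assume "u \<in> Q"
      then have "Idl (insert u M) \<subseteq> Q"
        by (intro genideal_minimal prime_ideal) (use Q in auto)
      then obtain P where "P \<in> F" "Idl (insert u M) \<subseteq> P" "P \<subseteq> Q" using F(3) Q(1) by blast
      then show ?thesis using MI(1) by (meson UnI1 order_trans)
    next
      assume "v \<in> Q"
      then have "Idl (insert v M) \<subseteq> Q"
        by (intro genideal_minimal prime_ideal) (use Q in auto)
      then obtain P where "P \<in> G" "Idl (insert v M) \<subseteq> P" "P \<subseteq> Q" using G(3) Q(1) by blast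
      then show ?thesis using MI(2) by (meson UnI2 order_trans)
    qed
  qed
  then have "?good M" using F(1,2) G(1,2) by (intro exI[of _ "F \<union> G"]) auto
  then show False using Mbad by blast
qed

lemma element_in_all_but_one:
  assumes P: "primeideal P R" and m: "ideal m R" "\<not> m \<subseteq> P"
    and F: "finite F" "\<And>Q. Q \<in> F \<Longrightarrow> primeideal Q R \<and> \<not> Q \<subseteq> P"
  shows "\<exists>y\<in>m. y \<notin> P \<and> (\<forall>Q\<in>F. y \<in> Q)"
  using F
proof (induction F)
  case empty
  then show ?case using m by blast
next
  case (insert Q F)
  then obtain y where y: "y \<in> m" "y \<notin> P" "\<forall>Q\<in>F. y \<in> Q" by blast
  have Qi: "ideal Q R" using insert.prems prime_ideal by blast
  obtain z where z: "z \<in> Q" "z \<notin> P" using insert.prems by blast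
  have c: "y \<in> carrier R" "z \<in> carrier R" using y(1) z(1) ideal_subset[OF m(1)] ideal_subset[OF Qi] by auto
  have "z \<otimes> y \<in> m" using ideal_mult[OF m(1) y(1) c(2)] .
  moreover have "z \<otimes> y \<notin> P" using prime_mult_notin[OF P c(2,1) z(2) y(2)] .
  moreover have "z \<otimes> y \<in> Q" using ideal_mult_right[OF Qi z(1) c(1)] .
  moreover have "z \<otimes> y \<in> Q'" if "Q' \<in> F" for Q'
    using ideal_mult[of Q' y z] prime_ideal insert.prems y(3) c(2) that by blast
  ultimately show ?case by blast
qed

text \<open>
  Induction on the number of primes. A prime contained in another one can be dropped, so the
  primes may be taken incomparable; then \<open>element_in_all_but_one\<close> corrects an element that
  avoids all but one of them.
\<close>

lemma prime_avoidance:
  assumes m: "ideal m R" and F: "finite F" "\<And>P. P \<in> F \<Longrightarrow> primeideal P R \<and> \<not> m \<subseteq> P"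
  shows "\<exists>x\<in>m. \<forall>P\<in>F. x \<notin> P"
  using F
proof (induction "card F" arbitrary: F rule: less_induct)
  case less
  note fin = less.prems(1) and pr = less.prems(2)
  show ?case
  proof (cases "\<exists>P\<in>F. \<exists>Q\<in>F. P \<noteq> Q \<and> P \<subseteq> Q")
    case True
    then obtain P Q where PQ: "P \<in> F" "Q \<in> F" "P \<noteq> Q" "P \<subseteq> Q" by blast
    have "\<exists>x\<in>m. \<forall>P\<in>F - {P}. x \<notin> P"
      by (rule less.hyps) (use PQ(1) fin pr card_Diff1_less[OF fin] in auto)
    then show ?thesis using PQ by blast
  next
    case antichain: False
    show ?thesis
    proof (cases "F = {}")
      case True
      then show ?thesis using ideal_zero[OF m] by blast
    next
      case False
      then obtain P where P: "P \<in> F" by blast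
      have "\<exists>x\<in>m. \<forall>P\<in>F - {P}. x \<notin> P"
        by (rule less.hyps) (use P fin pr card_Diff1_less[OF fin] in auto)
      then obtain x where x: "x \<in> m" "\<forall>Q\<in>F - {P}. x \<notin> Q" by blast
      have Pp: "primeideal P R" using pr P by blast
      have "\<exists>y\<in>m. y \<notin> P \<and> (\<forall>Q\<in>F - {P}. y \<in> Q)"
        by (rule element_in_all_but_one[OF Pp m]) (use P pr fin antichain in auto)
      then obtain y where y: "y \<in> m" "y \<notin> P" "\<forall>Q\<in>F - {P}. y \<in> Q" by blast
      have c: "x \<in> carrier R" "y \<in> carrier R" using x y ideal_subset[OF m] by auto
      show ?thesis
      proof (cases "x \<in> P")
        case True
        have "x \<oplus> y \<notin> Q" if Q: "Q \<in> F" for Q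
        proof
          assume xy: "x \<oplus> y \<in> Q"
          have Qi: "ideal Q R" using pr Q prime_ideal by blast
          show False
          proof (cases "Q = P")
            case True
            have "y \<oplus> x \<in> Q" using xy c by (simp add: a_comm)
            then have "y \<in> Q"
              using ideal_add_cancel[OF Qi c(2)] True \<open>x \<in> P\<close> by blast
            then show False using y True by blast
          next
            case False
            then have "x \<in> Q" using ideal_add_cancel[OF Qi c(1) _ xy] y(3) Q by blast
            then show False using x False Q by blast
          qed
        qed
        then show ?thesis using ideal_add[OF m x(1) y(1)] by blast
      next
        case False
        then show ?thesis using x by blast
      qed
    qed
  qed
qed

end

locale noetherian_local = cring +
  fixes m
  assumes noeth: "noetherian_ring R" and maximal: "maximalideal m R"
    and local: "\<And>m'. maximalideal m' R \<Longrightarrow> m' = m"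
begin

lemma m_prime: "primeideal m R"
  by (rule maximalideal_prime[OF maximal])

lemma m_ideal: "ideal m R"
  by (rule prime_ideal[OF m_prime])

lemma prime_below_m: "primeideal P R \<Longrightarrow> P \<subseteq> m"
  using proper_ideal_in_maximal[OF noeth, of P] prime_ideal[of P] primeideal.I_notcarr[of P R] local
  by metis

text \<open>
  The height theorem for the maximal ideal: if \<open>m\<close> is the only prime above \<open>I + (xs)\<close>, a chain
  of primes above \<open>I\<close> has at most as many steps as \<open>xs\<close> has entries. Each entry is moved into
  \<open>I\<close> at the cost of one step of the chain.
\<close>

lemma chain_length_le_generators:
  assumes "prime_chain n P" "I \<subseteq> P 0" "set xs \<subseteq> m" "I \<subseteq> carrier R"
    and "\<And>Q. primeideal Q R \<Longrightarrow> I \<union> set xs \<subseteq> Q \<Longrightarrow> Q = m"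
  shows "n \<le> length xs"
  using assms
proof (induction xs arbitrary: n P I)
  case Nil
  show ?case
  proof (rule ccontr)
    assume "\<not> ?thesis"
    then have "primeideal (P 0) R" "primeideal (P (Suc 0)) R" "P 0 \<subset> P (Suc 0)"
      using Nil.prems(1) unfolding prime_chain_def by auto
    moreover have "P 0 = m" using Nil.prems(5)[of "P 0"] Nil.prems(2) calculation(1) by simp
    ultimately show False using prime_below_m[of "P (Suc 0)"] by blast
  qed
next
  case (Cons x xs)
  show ?case
  proof (cases n)
    case (Suc k)
    have chk: "prime_chain k P" and Pn: "primeideal (P n) R" "P k \<subset> P n"
      using Cons.prems(1) Suc unfolding prime_chain_def by auto
    have "P k \<subset> m" using Pn prime_below_m[OF Pn(1)] by blast
    then have "prime_chain (Suc k) (P(Suc k := m))"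
      by (rule prime_chain_extend[OF chk m_prime])
    moreover have "x \<in> (P(Suc k := m)) (Suc k)" using Cons.prems(3) by simp
    ultimately obtain P' where P': "prime_chain k P'" "insert x ((P(Suc k := m)) 0) \<subseteq> P' 0"
      using prime_chain_through_element[OF noeth] by blast
    have "k \<le> length xs"
    proof (rule Cons.IH[OF P'(1)])
      show "insert x I \<subseteq> P' 0" using P'(2) Cons.prems(2) by auto
      show "set xs \<subseteq> m" using Cons.prems(3) by simp
      show "insert x I \<subseteq> carrier R" using Cons.prems(3,4) ideal_subset[OF m_ideal] by auto
      show "Q = m" if "primeideal Q R" "insert x I \<union> set xs \<subseteq> Q" for Q
        using Cons.prems(5)[OF that(1)] that(2) by simp
    qed
    then show ?thesis using Suc by simp
  qed simp
qed

text \<open>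
  Choose \<open>x\<close> in \<open>m\<close> outside the finitely many primes that \<open>finite_primes_below\<close> provides for
  \<open>I\<close>, except \<open>m\<close> itself. A chain above \<open>I + (x)\<close> then consists of \<open>m\<close> alone or extends
  downwards by one of these primes, so the bound on the length of chains drops by one.
\<close>

lemma parameters_exist:
  assumes "ideal I R" and "\<And>n P. prime_chain n P \<Longrightarrow> I \<subseteq> P 0 \<Longrightarrow> n \<le> d"
  shows "\<exists>xs. length xs = d \<and> set xs \<subseteq> m \<and>
    (\<forall>Q. primeideal Q R \<longrightarrow> I \<union> set xs \<subseteq> Q \<longrightarrow> Q = m)"
  using assms
proof (induction d arbitrary: I)
  case 0
  have "Q = m" if Q: "primeideal Q R" "I \<subseteq> Q" for Q
  proof (rule ccontr)
    assume "Q \<noteq> m"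
    then have "Q \<subset> m" using prime_below_m[OF Q(1)] by blast
    then have "prime_chain (Suc 0) ((\<lambda>_. Q)(Suc 0 := m))"
      using Q(1) m_prime by (intro prime_chain_extend) (auto simp: prime_chain_def)
    then show False using 0(2)[of "Suc 0"] Q(2) by fastforce
  qed
  then show ?case by simp
next
  case (Suc d)
  obtain F where F: "finite F" "\<forall>P\<in>F. primeideal P R"
    "\<forall>Q. primeideal Q R \<longrightarrow> I \<subseteq> Q \<longrightarrow> (\<exists>P\<in>F. I \<subseteq> P \<and> P \<subseteq> Q)"
    using finite_primes_below[OF noeth Suc.prems(1)] by blast
  have "primeideal P R \<and> \<not> m \<subseteq> P" if "P \<in> F - {m}" for P
    using that F(2) prime_below_m[of P] by blast
  then have "\<exists>x\<in>m. \<forall>P\<in>F - {m}. x \<notin> P"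
    by (intro prime_avoidance[OF m_ideal]) (use F(1) in auto)
  then obtain x where x: "x \<in> m" "\<forall>P\<in>F - {m}. x \<notin> P" by blast
  have xI: "insert x I \<subseteq> carrier R"
    using x(1) ideal_subset[OF m_ideal] ideal_subset[OF Suc.prems(1)] by auto
  have self: "insert x I \<subseteq> Idl (insert x I)" by (rule genideal_self[OF xI])
  have le: "n \<le> d" if ch: "prime_chain n P" and sub: "Idl (insert x I) \<subseteq> P 0" for n P
  proof -
    have P0: "primeideal (P 0) R" using ch unfolding prime_chain_def by simp
    have I0: "I \<subseteq> P 0" and x0: "x \<in> P 0" using sub self by auto
    obtain P' where P': "P' \<in> F" "I \<subseteq> P'" "P' \<subseteq> P 0" using F(3) P0 I0 by blast
    have pP': "primeideal P' R" using F(2) P'(1) by blast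
    show ?thesis
    proof (cases "P' = m")
      case True
      then have P0m: "P 0 = m" using P'(3) prime_below_m[OF P0] by simp
      have "n = 0"
      proof (rule ccontr)
        assume "n \<noteq> 0"
        then have "primeideal (P (Suc 0)) R" "P 0 \<subset> P (Suc 0)"
          using ch unfolding prime_chain_def by auto
        then show False using prime_below_m[of "P (Suc 0)"] P0m by blast
      qed
      then show ?thesis by simp
    next
      case False
      then have "x \<notin> P'" using x(2) P'(1) by blast
      then have lt: "P' \<subset> P 0" using x0 P'(3) by blast
      have "prime_chain (Suc n) (case_nat P' P)"
        using ch pP' lt unfolding prime_chain_def
        by (auto split: nat.splits simp: less_Suc_eq_0_disj)
      then have "Suc n \<le> Suc d" using Suc.prems(2)[of "Suc n" "case_nat P' P"] P'(2) by simp
      then show ?thesis by simp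
    qed
  qed
  have "\<exists>xs. length xs = d \<and> set xs \<subseteq> m \<and>
    (\<forall>Q. primeideal Q R \<longrightarrow> Idl (insert x I) \<union> set xs \<subseteq> Q \<longrightarrow> Q = m)"
    by (rule Suc.IH[OF genideal_ideal[OF xI]]) (rule le)
  then obtain xs where xs: "length xs = d" "set xs \<subseteq> m"
    "\<forall>Q. primeideal Q R \<longrightarrow> Idl (insert x I) \<union> set xs \<subseteq> Q \<longrightarrow> Q = m"
    by blast
  have "Q = m" if Q: "primeideal Q R" "I \<union> set (x # xs) \<subseteq> Q" for Q
  proof -
    have "Idl (insert x I) \<subseteq> Q"
      by (rule genideal_minimal[OF prime_ideal[OF Q(1)]]) (use Q(2) in auto)
    then show ?thesis using xs(3) Q by simp
  qed
  then show ?case using xs(1,2) x(1) by (intro exI[of _ "x # xs"]) auto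
qed

text \<open>
  The dimension theorem: chains of primes are bounded by the number of generators of \<open>m\<close>, so
  that the Krull dimension is a number \<open>d\<close>, and the preceding construction produces \<open>d\<close>
  elements.
\<close>

theorem system_of_parameters_exists:
  obtains xs where "system_of_parameters R m xs"
proof -
  obtain A where A: "A \<subseteq> carrier R" "finite A" "m = Idl A"
    using noetherian_ring.finetely_gen[OF noeth m_ideal] by blast
  obtain ys where ys: "set ys = A" using finite_list[OF A(2)] by blast
  have ym: "set ys \<subseteq> m" using genideal_self[OF A(1)] A(3) ys by simp
  have only: "Q = m" if "primeideal Q R" "{} \<union> set ys \<subseteq> Q" for Q
  proof -
    have "m \<subseteq> Q" unfolding A(3)
      by (rule genideal_minimal[OF prime_ideal[OF that(1)]]) (use that(2) ys in simp)
    then show ?thesis using prime_below_m[OF that(1)] by blast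
  qed
  define L where "L = {n. \<exists>P. prime_chain n P}"
  have bound: "n \<le> length ys" if "n \<in> L" for n
    using that chain_length_le_generators[OF _ _ ym _ only] unfolding L_def by blast
  have finL: "finite L" using bound by (meson finite_nat_set_iff_bounded_le)
  have "prime_chain 0 (\<lambda>_. m)" unfolding prime_chain_def using m_prime by simp
  then have neL: "L \<noteq> {}" unfolding L_def by blast
  define d where "d = Max L"
  have dL: "d \<in> L" and dmax: "\<And>n. n \<in> L \<Longrightarrow> n \<le> d"
    unfolding d_def using finL neL by auto
  have "krull_dim R = Sup (enat ` L)"
    unfolding krull_dim_def L_def prime_chain_def by (intro arg_cong[of _ _ Sup]) auto
  also have "\<dots> = enat d"
    by (rule Sup_eqI) (use dL dmax in auto)
  finally have dim: "krull_dim R = enat d" .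
  obtain xs where xs: "length xs = d" "set xs \<subseteq> m"
    "\<forall>Q. primeideal Q R \<longrightarrow> {\<zero>} \<union> set xs \<subseteq> Q \<longrightarrow> Q = m"
    using parameters_exist[OF zeroideal, of d] dmax unfolding L_def by blast
  have xc: "set xs \<subseteq> carrier R" using xs(2) ideal_subset[OF m_ideal] by blast
  have "\<exists>k::nat. a [^] k \<in> Idl (set xs)" if a: "a \<in> m" for a
  proof (rule radical_mem[OF noeth genideal_ideal[OF xc]])
    show "a \<in> carrier R" using a ideal_subset[OF m_ideal] by blast
    show "a \<in> Q" if Q: "primeideal Q R" "Idl (set xs) \<subseteq> Q" for Q
    proof -
      have "{\<zero>} \<union> set xs \<subseteq> Q" using Q genideal_self[OF xc] ideal_zero[OF prime_ideal[OF Q(1)]] by auto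
      then show ?thesis using xs(3) Q(1) a by blast
    qed
  qed
  then have "system_of_parameters R m xs"
    unfolding system_of_parameters_def using xs dim by simp
  then show ?thesis by (rule that)
qed

end

context cring
begin

section \<open>The Koszul complex\<close>

text \<open>
  The Koszul complex of \<open>ys\<close> as an iterated mapping cone. A chain assigns a coefficient to every
  boolean list of the length of \<open>ys\<close>, which stands for the wedge of the basis vectors at the
  positions marked \<open>True\<close>. Splitting off the first position presents a chain as a pair \<open>(a, b)\<close>,
  and the differential is \<open>(a, b) \<mapsto> (d a + y b, - d b)\<close>; no other signs occur.
\<close>

primrec koszul_d :: "'a list \<Rightarrow> (bool list \<Rightarrow> 'a) \<Rightarrow> bool list \<Rightarrow> 'a"
  where "koszul_d [] f = (\<lambda>l. \<zero>)"
  | "koszul_d (y # ys) f = (\<lambda>l. case l of [] \<Rightarrow> \<zero> | b # l' \<Rightarrow>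
      if b then \<ominus> koszul_d ys (\<lambda>l. f (True # l)) l'
      else koszul_d ys (\<lambda>l. f (False # l)) l' \<oplus> y \<otimes> f (True # l'))"

text \<open>
  The contracting homotopy for multiplication by the \<open>k\<close>-th entry: exterior multiplication by
  the corresponding basis vector.
\<close>

primrec koszul_h :: "nat \<Rightarrow> (bool list \<Rightarrow> 'a) \<Rightarrow> bool list \<Rightarrow> 'a"
  where "koszul_h 0 f = (\<lambda>l. case l of [] \<Rightarrow> \<zero> | b # l' \<Rightarrow> if b then f (False # l') else \<zero>)"
  | "koszul_h (Suc k) f = (\<lambda>l. case l of [] \<Rightarrow> \<zero> | b # l' \<Rightarrow>
      if b then \<ominus> koszul_h k (\<lambda>l. f (True # l)) l' else koszul_h k (\<lambda>l. f (False # l)) l')"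

text \<open>
  The homogeneous chains of degree \<open>i\<close> in the Koszul complex of \<open>n\<close> elements.
\<close>

definition supported :: "nat \<Rightarrow> nat \<Rightarrow> (bool list \<Rightarrow> 'a) \<Rightarrow> bool"
  where "supported n i f \<longleftrightarrow> (\<forall>l. f l \<noteq> \<zero> \<longrightarrow> length l = n \<and> count_list l True = i)"

lemma koszul_d_closed:
  "set ys \<subseteq> carrier R \<Longrightarrow> (\<And>l. f l \<in> carrier R) \<Longrightarrow> koszul_d ys f l \<in> carrier R"
  by (induction ys arbitrary: f l) (auto split: list.split)

lemma koszul_h_closed: "(\<And>l. f l \<in> carrier R) \<Longrightarrow> koszul_h k f l \<in> carrier R"
  by (induction k arbitrary: f l) (auto split: list.split)

lemma koszul_d_add:
  "set ys \<subseteq> carrier R \<Longrightarrow> (\<And>l. f l \<in> carrier R) \<Longrightarrow> (\<And>l. g l \<in> carrier R) \<Longrightarrow>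
    koszul_d ys (\<lambda>l. f l \<oplus> g l) l = koszul_d ys f l \<oplus> koszul_d ys g l"
proof (induction ys arbitrary: f g l)
  case (Cons y ys)
  have c: "koszul_d ys (\<lambda>l. f (b # l)) l \<in> carrier R" "koszul_d ys (\<lambda>l. g (b # l)) l \<in> carrier R"
    "y \<in> carrier R" "f l \<in> carrier R" "g l \<in> carrier R" for b l
    using Cons.prems by (auto intro!: koszul_d_closed)
  have IH: "koszul_d ys (\<lambda>l. f (b # l) \<oplus> g (b # l)) l
    = koszul_d ys (\<lambda>l. f (b # l)) l \<oplus> koszul_d ys (\<lambda>l. g (b # l)) l" for b l
    using Cons.prems by (intro Cons.IH) auto
  show ?case using c by (auto split: list.split simp: IH minus_add r_distr a_ac)
qed simp

lemma koszul_d_smult: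
  "set ys \<subseteq> carrier R \<Longrightarrow> (\<And>l. f l \<in> carrier R) \<Longrightarrow> a \<in> carrier R \<Longrightarrow>
    koszul_d ys (\<lambda>l. a \<otimes> f l) l = a \<otimes> koszul_d ys f l"
proof (induction ys arbitrary: f l)
  case (Cons y ys)
  have c: "koszul_d ys (\<lambda>l. f (b # l)) l \<in> carrier R" "y \<in> carrier R" "f l \<in> carrier R" for b l
    using Cons.prems by (auto intro!: koszul_d_closed)
  have IH: "koszul_d ys (\<lambda>l. a \<otimes> f (b # l)) l = a \<otimes> koszul_d ys (\<lambda>l. f (b # l)) l" for b l
    using Cons.prems by (intro Cons.IH) auto
  show ?case using c Cons.prems(3)
    by (auto split: list.split simp: IH r_distr r_minus m_lcomm)
qed simp

lemma koszul_d_diff: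
  assumes "set ys \<subseteq> carrier R" "\<And>l. f l \<in> carrier R" "\<And>l. g l \<in> carrier R"
  shows "koszul_d ys (\<lambda>l. f l \<ominus> g l) l = koszul_d ys f l \<ominus> koszul_d ys g l"
proof -
  have neg: "koszul_d ys (\<lambda>l. (\<ominus> \<one>) \<otimes> g l) l = (\<ominus> \<one>) \<otimes> koszul_d ys g l"
    using assms by (intro koszul_d_smult) auto
  have "koszul_d ys (\<lambda>l. f l \<ominus> g l) l = koszul_d ys (\<lambda>l. f l \<oplus> (\<ominus> \<one>) \<otimes> g l) l"
    using assms by (simp add: minus_eq l_minus)
  also have "\<dots> = koszul_d ys f l \<oplus> koszul_d ys (\<lambda>l. (\<ominus> \<one>) \<otimes> g l) l"
    using assms by (intro koszul_d_add) auto
  also have "\<dots> = koszul_d ys f l \<ominus> koszul_d ys g l"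
    using koszul_d_closed[OF assms(1,3)] by (simp only: neg) (simp add: l_minus minus_eq)
  finally show ?thesis .
qed

lemma koszul_h_add:
  "(\<And>l. f l \<in> carrier R) \<Longrightarrow> (\<And>l. g l \<in> carrier R) \<Longrightarrow>
    koszul_h k (\<lambda>l. f l \<oplus> g l) l = koszul_h k f l \<oplus> koszul_h k g l"
proof (induction k arbitrary: f g l)
  case (Suc k)
  have c: "koszul_h k (\<lambda>l. f (b # l)) l \<in> carrier R" "koszul_h k (\<lambda>l. g (b # l)) l \<in> carrier R" for b l
    using Suc.prems by (auto intro!: koszul_h_closed)
  show ?case using c Suc.prems by (auto split: list.split simp: Suc.IH minus_add)
qed (auto split: list.split)

lemma koszul_h_smult:
  "(\<And>l. f l \<in> carrier R) \<Longrightarrow> a \<in> carrier R \<Longrightarrow>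
    koszul_h k (\<lambda>l. a \<otimes> f l) l = a \<otimes> koszul_h k f l"
proof (induction k arbitrary: f l)
  case (Suc k)
  have c: "koszul_h k (\<lambda>l. f (b # l)) l \<in> carrier R" for b l
    using Suc.prems by (auto intro!: koszul_h_closed)
  show ?case using c Suc.prems by (auto split: list.split simp: Suc.IH r_minus)
qed (auto split: list.split)

lemma koszul_d_in_ideal:
  assumes "ideal J R" "set ys \<subseteq> carrier R" "\<And>l. f l \<in> J"
  shows "koszul_d ys f l \<in> J"
  using assms(2,3)
  by (induction ys arbitrary: f l)
    (auto split: list.split intro!: ideal_add[OF assms(1)] ideal_mult[OF assms(1)]
      ideal_neg[OF assms(1)] ideal_zero[OF assms(1)])

lemma koszul_h_in_ideal:
  assumes "ideal J R" "\<And>l. f l \<in> J"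
  shows "koszul_h k f l \<in> J"
  using assms(2)
  by (induction k arbitrary: f l)
    (auto split: list.split intro!: ideal_neg[OF assms(1)] ideal_zero[OF assms(1)])

lemma koszul_d_in_Idl:
  "set ys \<subseteq> carrier R \<Longrightarrow> (\<And>l. f l \<in> carrier R) \<Longrightarrow> koszul_d ys f l \<in> Idl (set ys)"
proof (induction ys arbitrary: f l)
  case Nil
  then show ?case using ideal_zero[OF genideal_ideal, of "{}"] by simp
next
  case (Cons y ys)
  have I: "ideal (Idl (set (y # ys))) R" by (rule genideal_ideal[OF Cons.prems(1)])
  have "koszul_d ys (\<lambda>l. f (b # l)) l \<in> Idl (set (y # ys))" for b l
    using Cons.IH[of "\<lambda>l. f (b # l)" l] Cons.prems Idl_mono[of "set ys" "set (y # ys)"] by auto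
  moreover have "y \<in> Idl (set (y # ys))" using genideal_self[OF Cons.prems(1)] by simp
  ultimately show ?case
    using Cons.prems(2) ideal_add[OF I] ideal_neg[OF I] ideal_zero[OF I] ideal_mult_right[OF I]
    by (auto split: list.split)
qed

lemma koszul_d_d:
  "set ys \<subseteq> carrier R \<Longrightarrow> (\<And>l. f l \<in> carrier R) \<Longrightarrow> koszul_d ys (koszul_d ys f) l = \<zero>"
proof (induction ys arbitrary: f l)
  case (Cons y ys)
  note sub = Cons.prems(2)
  have ys: "set ys \<subseteq> carrier R" and y: "y \<in> carrier R" using Cons.prems(1) by auto
  define F where "F b = (\<lambda>l. f (b # l))" for b
  have Fc: "F b l \<in> carrier R" for b l unfolding F_def by (rule sub)
  have dc: "koszul_d ys (F b) l \<in> carrier R" for b l by (rule koszul_d_closed[OF ys Fc])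
  have dd: "koszul_d ys (koszul_d ys (F b)) l = \<zero>" for b l by (rule Cons.IH[OF ys Fc])
  have T: "(\<lambda>l. koszul_d (y # ys) f (True # l)) = (\<lambda>l. (\<ominus> \<one>) \<otimes> koszul_d ys (F True) l)"
    using dc by (auto simp: F_def l_minus)
  have F: "(\<lambda>l. koszul_d (y # ys) f (False # l)) = (\<lambda>l. koszul_d ys (F False) l \<oplus> y \<otimes> F True l)"
    by (auto simp: F_def)
  have "koszul_d ys (\<lambda>l. koszul_d (y # ys) f (True # l)) l = \<zero>" for l
    unfolding T using dc dd by (subst koszul_d_smult[OF ys]) auto
  moreover have "koszul_d ys (\<lambda>l. koszul_d (y # ys) f (False # l)) l
     = y \<otimes> koszul_d ys (F True) l" for l
    unfolding F using Fc y dc dd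
    by (subst koszul_d_add[OF ys]) (auto simp: koszul_d_smult[OF ys])
  moreover have "koszul_d (y # ys) f (True # l) = \<ominus> koszul_d ys (F True) l" for l
    by (simp add: F_def)
  ultimately show ?case
    using y dc by (simp split: list.split add: r_minus r_neg del: koszul_d.simps(2) add: koszul_d.simps(2)[of y ys "koszul_d (y # ys) f"])
qed simp

lemma koszul_homotopy:
  "set ys \<subseteq> carrier R \<Longrightarrow> (\<And>l. f l \<in> carrier R) \<Longrightarrow> k < length ys \<Longrightarrow> length l = length ys \<Longrightarrow>
    (ys ! k) \<otimes> f l = koszul_d ys (koszul_h k f) l \<oplus> koszul_h k (koszul_d ys f) l"
proof (induction k arbitrary: ys f l)
  case 0
  then obtain y ys' where ysd: "ys = y # ys'" by (cases ys) auto
  obtain b l' where l: "l = b # l'" using 0(4) ysd by (cases l) auto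
  have c: "koszul_d ys' (\<lambda>l. f (False # l)) l' \<in> carrier R" "f u \<in> carrier R" "y \<in> carrier R" for u
    using 0 ysd by (auto intro!: koszul_d_closed)
  have z: "koszul_d ys' (\<lambda>l. \<zero>) l' = \<zero>"
    using koszul_d_in_ideal[OF zeroideal, of ys' "\<lambda>l. \<zero>"] 0(1) ysd by simp
  have "\<ominus> u \<oplus> (u \<oplus> v) = v" if "u \<in> carrier R" "v \<in> carrier R" for u v
    using that by algebra
  then show ?case using c z by (cases b) (auto simp: ysd l)
next
  case (Suc k)
  then obtain y ys' where ysd: "ys = y # ys'" by (cases ys) auto
  obtain b l' where l: "l = b # l'" using Suc(5) ysd by (cases l) auto
  have ys: "set ys' \<subseteq> carrier R" and y: "y \<in> carrier R" using Suc.prems(1) ysd by auto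
  define F where "F b = (\<lambda>l. f (b # l))" for b
  have Fc: "F b l \<in> carrier R" for b l unfolding F_def by (rule Suc.prems(2))
  have c: "koszul_d ys' (F b) l \<in> carrier R" "koszul_h k (F b) l \<in> carrier R"
    "koszul_h k (koszul_d ys' (F b)) l \<in> carrier R"
    "koszul_d ys' (koszul_h k (F b)) l \<in> carrier R" for b l
    by (auto intro!: koszul_d_closed koszul_h_closed ys Fc)
  have IH: "(ys' ! k) \<otimes> F b l' = koszul_d ys' (koszul_h k (F b)) l' \<oplus> koszul_h k (koszul_d ys' (F b)) l'" for b
    using Suc.prems ysd l by (intro Suc.IH[OF ys Fc]) auto
  show ?case
  proof (cases b)
    case True
    have "koszul_d ys (koszul_h (Suc k) f) (True # l') = \<ominus> koszul_d ys' (\<lambda>l. (\<ominus> \<one>) \<otimes> koszul_h k (F True) l) l'"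
      using c by (simp add: ysd F_def l_minus)
    also have "\<dots> = koszul_d ys' (koszul_h k (F True)) l'"
      using c by (subst koszul_d_smult[OF ys]) (auto simp: l_minus)
    finally have 1: "koszul_d ys (koszul_h (Suc k) f) (True # l') = koszul_d ys' (koszul_h k (F True)) l'" .
    have "koszul_h (Suc k) (koszul_d ys f) (True # l') = \<ominus> koszul_h k (\<lambda>l. (\<ominus> \<one>) \<otimes> koszul_d ys' (F True) l) l'"
      using c by (simp add: ysd F_def l_minus)
    also have "\<dots> = koszul_h k (koszul_d ys' (F True)) l'"
      using c by (subst koszul_h_smult) (auto simp: l_minus)
    finally show ?thesis using IH[of True] 1 True by (simp add: ysd l F_def)
  next
    case False
    have 1: "koszul_d ys (koszul_h (Suc k) f) (False # l')
        = koszul_d ys' (koszul_h k (F False)) l' \<oplus> y \<otimes> (\<ominus> koszul_h k (F True) l')"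
      by (simp add: ysd F_def)
    have "koszul_h (Suc k) (koszul_d ys f) (False # l')
        = koszul_h k (\<lambda>l. koszul_d ys' (F False) l \<oplus> y \<otimes> F True l) l'"
      by (simp add: ysd F_def)
    also have "\<dots> = koszul_h k (koszul_d ys' (F False)) l' \<oplus> y \<otimes> koszul_h k (F True) l'"
      using c Fc y by (subst koszul_h_add) (auto simp: koszul_h_smult)
    finally have 2: "koszul_h (Suc k) (koszul_d ys f) (False # l')
        = koszul_h k (koszul_d ys' (F False)) l' \<oplus> y \<otimes> koszul_h k (F True) l'" .
    have "(u \<oplus> y \<otimes> (\<ominus> v)) \<oplus> (w \<oplus> y \<otimes> v) = u \<oplus> w"
      if "u \<in> carrier R" "v \<in> carrier R" "w \<in> carrier R" for u v w using that y by algebra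
    then show ?thesis using IH[of False] 1 2 False c by (simp add: ysd l F_def)
  qed
qed

lemma supported_koszul_d:
  "set ys \<subseteq> carrier R \<Longrightarrow> (\<And>l. f l \<in> carrier R) \<Longrightarrow> supported n i f \<Longrightarrow> koszul_d ys f l \<noteq> \<zero> \<Longrightarrow>
    length l = n \<and> Suc (count_list l True) = i"
proof (induction ys arbitrary: n i f l)
  case (Cons y ys)
  obtain b l' where l: "l = b # l'" using Cons.prems(4) by (cases l) auto
  have ys: "set ys \<subseteq> carrier R" and y: "y \<in> carrier R" using Cons.prems(1) by auto
  have F: "supported (n - 1) i (\<lambda>l. f (False # l))" and T: "supported (n - 1) (i - 1) (\<lambda>l. f (True # l))"
    using Cons.prems(3) unfolding supported_def by fastforce+
  have zero: "(\<exists>l. f (b # l) \<noteq> \<zero>)" if "koszul_d ys (\<lambda>l. f (b # l)) k \<noteq> \<zero>" for b k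
  proof (rule ccontr)
    assume "\<not> ?thesis"
    then have "koszul_d ys (\<lambda>l. f (b # l)) k \<in> {\<zero>}"
      by (intro koszul_d_in_ideal[OF zeroideal ys]) auto
    then show False using that by simp
  qed
  have n: "n \<noteq> 0" if "f (b # l) \<noteq> \<zero>" for b l using Cons.prems(3) that unfolding supported_def by fastforce
  have i: "i \<noteq> 0" if "f (True # l) \<noteq> \<zero>" for l using Cons.prems(3) that unfolding supported_def by fastforce
  show ?case
  proof (cases b)
    case True
    then have nz: "koszul_d ys (\<lambda>l. f (True # l)) l' \<noteq> \<zero>" using Cons.prems(4) l by auto
    have "length l' = n - 1 \<and> Suc (count_list l' True) = i - 1"
      by (rule Cons.IH[OF ys _ T nz]) (rule Cons.prems(2))
    moreover obtain k where "f (True # k) \<noteq> \<zero>" using zero[OF nz] by blast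
    ultimately show ?thesis using True l n i by simp
  next
    case False
    then have "koszul_d ys (\<lambda>l. f (False # l)) l' \<oplus> y \<otimes> f (True # l') \<noteq> \<zero>" using Cons.prems(4) l by auto
    then consider "koszul_d ys (\<lambda>l. f (False # l)) l' \<noteq> \<zero>" | "f (True # l') \<noteq> \<zero>" using y by fastforce
    then show ?thesis
    proof cases
      case 1
      have "length l' = n - 1 \<and> Suc (count_list l' True) = i"
        by (rule Cons.IH[OF ys _ F 1]) (rule Cons.prems(2))
      moreover obtain k where "f (False # k) \<noteq> \<zero>" using zero[OF 1] by blast
      ultimately show ?thesis using False l n by simp
    next
      case 2
      then have "length (True # l') = n \<and> count_list (True # l') True = i"
        using Cons.prems(3) unfolding supported_def by blast
      then show ?thesis using False l by simp
    qed
  qed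
qed simp

lemma supported_koszul_h:
  "supported n i f \<Longrightarrow> koszul_h k f l \<noteq> \<zero> \<Longrightarrow> length l = n \<and> count_list l True = Suc i"
proof (induction k arbitrary: n i f l)
  case 0
  obtain b l' where l: "l = b # l'" using 0 by (cases l) auto
  then have "b" "f (False # l') \<noteq> \<zero>" using 0(2) by (auto split: if_splits)
  then show ?case using 0(1) l unfolding supported_def by fastforce
next
  case (Suc k)
  obtain b l' where l: "l = b # l'" using Suc by (cases l) auto
  have nz: "koszul_h k (\<lambda>l. f (b # l)) l' \<noteq> \<zero>" using Suc.prems(2) l by (auto split: if_splits)
  obtain u where u: "f (b # u) \<noteq> \<zero>"
  proof (rule ccontr)
    assume "\<not> thesis"
    then have "koszul_h k (\<lambda>l. f (b # l)) l' \<in> {\<zero>}" using that by (intro koszul_h_in_ideal[OF zeroideal]) auto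
    then show False using nz by simp
  qed
  have "supported (n - 1) (if b then i - 1 else i) (\<lambda>l. f (b # l))"
    using Suc.prems(1) unfolding supported_def by fastforce
  from Suc.IH[OF this nz] show ?case
    using u Suc.prems(1) l unfolding supported_def by (fastforce split: if_splits)
qed


text \<open>
  Vanishing of the \<open>i\<close>-th Koszul homology with coefficients in \<open>R/J\<close>, written with
  representatives in \<open>R\<close>.
\<close>

definition koszul_exact :: "'a list \<Rightarrow> nat \<Rightarrow> 'a set \<Rightarrow> bool"
  where "koszul_exact ys i J \<longleftrightarrow>
    (\<forall>f. (\<forall>l. f l \<in> carrier R) \<longrightarrow> supported (length ys) i f \<longrightarrow> (\<forall>l. koszul_d ys f l \<in> J) \<longrightarrow>
      (\<exists>g. (\<forall>l. g l \<in> carrier R) \<and> supported (length ys) (Suc i) g \<and>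
        (\<forall>l. f l \<ominus> koszul_d ys g l \<in> J)))"

lemma supported_add:
  "supported n i f \<Longrightarrow> supported n i g \<Longrightarrow> supported n i (\<lambda>l. f l \<oplus> g l)"
  unfolding supported_def by (metis l_zero zero_closed)

lemma supported_smult:
  "supported n i f \<Longrightarrow> a \<in> carrier R \<Longrightarrow> supported n i (\<lambda>l. a \<otimes> f l)"
  unfolding supported_def by (metis r_null)

lemma koszul_d_zero: "set ys \<subseteq> carrier R \<Longrightarrow> koszul_d ys (\<lambda>l. \<zero>) l = \<zero>"
  using koszul_d_in_ideal[OF zeroideal, of ys "\<lambda>l. \<zero>" l] by simp

lemma minus_split: "a \<in> carrier R \<Longrightarrow> b \<in> carrier R \<Longrightarrow> c \<in> carrier R \<Longrightarrow> d \<in> carrier R \<Longrightarrow>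
   (a \<oplus> b) \<ominus> (c \<oplus> d) = (a \<ominus> c) \<oplus> (b \<ominus> d)" by algebra

text \<open>
  The ideal \<open>(ys) + J\<close> annihilates the homology of \<open>R/J\<close>: the elements that multiply a given
  cycle into a boundary form an ideal, which contains \<open>ys\<close> by the homotopy and \<open>J\<close> trivially.
\<close>

lemma koszul_homology_killed:
  assumes J: "ideal J R" and ys: "set ys \<subseteq> carrier R"
    and f: "\<And>l. f l \<in> carrier R" "supported (length ys) i f" "\<And>l. koszul_d ys f l \<in> J"
    and a: "a \<in> Idl (set ys \<union> J)"
  shows "\<exists>g. (\<forall>l. g l \<in> carrier R) \<and> supported (length ys) (Suc i) g \<and>
        (\<forall>l. a \<otimes> f l \<ominus> koszul_d ys g l \<in> J)"
proof -
  have Jc: "J \<subseteq> carrier R" by (rule ideal_subset[OF J])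
  define bdry where "bdry a g \<longleftrightarrow> (\<forall>l. g l \<in> carrier R) \<and> supported (length ys) (Suc i) g \<and>
        (\<forall>l. a \<otimes> f l \<ominus> koszul_d ys g l \<in> J)" for a g
  let ?D = "{a \<in> carrier R. \<exists>g. bdry a g}"
  have zs: "supported (length ys) (Suc i) (\<lambda>l. \<zero>)" unfolding supported_def by simp
  have D_J: "J \<subseteq> ?D"
  proof
    fix a assume a: "a \<in> J"
    have "bdry a (\<lambda>l. \<zero>)"
      unfolding bdry_def using zs a f(1) Jc ideal_mult_right[OF J a] koszul_d_zero[OF ys]
      by (auto simp: minus_eq)
    then show "a \<in> ?D" using a Jc by blast
  qed
  have "ideal ?D R"
  proof (rule ideal_closedI)
    show "\<zero> \<in> ?D" using D_J ideal_zero[OF J] by blast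
  next
    fix a b assume "a \<in> ?D" "b \<in> ?D"
    then obtain g g' where ab: "a \<in> carrier R" "b \<in> carrier R" "bdry a g" "bdry b g'" by blast
    have g: "g l \<in> carrier R" "g' l \<in> carrier R" "a \<otimes> f l \<ominus> koszul_d ys g l \<in> J"
      "b \<otimes> f l \<ominus> koszul_d ys g' l \<in> J" for l using ab unfolding bdry_def by auto
    have dc: "koszul_d ys g l \<in> carrier R" "koszul_d ys g' l \<in> carrier R" for l
      using g ys by (auto intro: koszul_d_closed)
    have "(a \<oplus> b) \<otimes> f l \<ominus> koszul_d ys (\<lambda>l. g l \<oplus> g' l) l \<in> J" for l
      using ideal_add[OF J g(3)[of l] g(4)[of l]] ab(1,2) f(1)[of l] g(1,2) dc[of l]
      by (simp add: koszul_d_add[OF ys] l_distr minus_split)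
    then have "bdry (a \<oplus> b) (\<lambda>l. g l \<oplus> g' l)"
      unfolding bdry_def using ab(3,4) g(1,2) by (auto simp: bdry_def intro: supported_add)
    then show "a \<oplus> b \<in> ?D" using ab(1,2) by blast
  next
    fix r a assume r: "r \<in> carrier R" and "a \<in> ?D"
    then obtain g where a: "a \<in> carrier R" "bdry a g" by blast
    have g: "g l \<in> carrier R" "a \<otimes> f l \<ominus> koszul_d ys g l \<in> J" for l
      using a unfolding bdry_def by auto
    have dc: "koszul_d ys g l \<in> carrier R" for l using g ys by (auto intro: koszul_d_closed)
    have "(r \<otimes> a) \<otimes> f l \<ominus> koszul_d ys (\<lambda>l. r \<otimes> g l) l \<in> J" for l
    proof -
      have "(r \<otimes> a) \<otimes> f l \<ominus> r \<otimes> koszul_d ys g l = r \<otimes> (a \<otimes> f l \<ominus> koszul_d ys g l)"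
        using r a(1) f(1)[of l] dc[of l] by algebra
      then show ?thesis using ideal_mult[OF J g(2) r, of l] r g(1) by (simp add: koszul_d_smult[OF ys])
    qed
    then have "bdry (r \<otimes> a) (\<lambda>l. r \<otimes> g l)"
      unfolding bdry_def using a(2) g(1) r by (auto simp: bdry_def intro: supported_smult)
    then show "r \<otimes> a \<in> ?D" using r a(1) by blast
  qed auto
  moreover have "set ys \<subseteq> ?D"
  proof
    fix y assume "y \<in> set ys"
    then obtain k where k: "k < length ys" "y = ys ! k" by (metis in_set_conv_nth)
    have yc: "y \<in> carrier R" using \<open>y \<in> set ys\<close> ys by blast
    have hs: "supported (length ys) (Suc i) (koszul_h k f)"
      unfolding supported_def using supported_koszul_h[OF f(2)] by blast
    have hc: "koszul_h k f l \<in> carrier R" for l by (rule koszul_h_closed[OF f(1)])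
    have "y \<otimes> f l \<ominus> koszul_d ys (koszul_h k f) l \<in> J" for l
    proof (cases "length l = length ys")
      case True
      have c: "koszul_d ys (koszul_h k f) l \<in> carrier R" "koszul_h k (koszul_d ys f) l \<in> carrier R"
        by (auto intro!: koszul_d_closed koszul_h_closed ys f(1))
      have "(u \<oplus> v) \<ominus> u = v" if "u \<in> carrier R" "v \<in> carrier R" for u v using that by algebra
      then have "y \<otimes> f l \<ominus> koszul_d ys (koszul_h k f) l = koszul_h k (koszul_d ys f) l"
        using koszul_homotopy[of ys f k l, OF ys f(1) k(1) True] c k(2) by simp
      then show ?thesis using koszul_h_in_ideal[OF J f(3)] by simp
    next
      case False
      then have "f l = \<zero>" using f(2) unfolding supported_def by blast
      moreover have "koszul_d ys (koszul_h k f) l = \<zero>"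
        using supported_koszul_d[OF ys hc hs, of l] False by blast
      ultimately show ?thesis using yc ideal_zero[OF J] by (simp add: minus_eq)
    qed
    then have "bdry y (koszul_h k f)" unfolding bdry_def using hs hc by blast
    then show "y \<in> ?D" using yc by blast
  qed
  ultimately have "Idl (set ys \<union> J) \<subseteq> ?D" using D_J by (intro genideal_minimal) auto
  then show ?thesis using a unfolding bdry_def by blast
qed

text \<open>
  The part of the long exact sequence of \<open>0 \<rightarrow> R/J \<rightarrow> R/J \<rightarrow> R/(J + (x)) \<rightarrow> 0\<close> that is needed. When
  the homology of the quotient vanishes in degree \<open>i + 1\<close>, multiplication by \<open>x\<close> is injective on
  the homology of \<open>R/J\<close> in degree \<open>i\<close>. A power of \<open>x\<close> annihilates the latter, so it vanishes.
\<close>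

lemma koszul_exact_lift:
  assumes J: "ideal J R" and ys: "set ys \<subseteq> carrier R" and x: "x \<in> carrier R"
    and nzd: "\<And>u. u \<in> carrier R \<Longrightarrow> x \<otimes> u \<in> J \<Longrightarrow> u \<in> J"
    and exact: "koszul_exact ys (Suc i) (Idl (insert x J))"
    and nilp: "x [^] (K::nat) \<in> Idl (set ys \<union> J)"
  shows "koszul_exact ys i J"
proof -
  let ?n = "length ys"
  have Jc: "J \<subseteq> carrier R" by (rule ideal_subset[OF J])
  have xJ: "insert x J \<subseteq> carrier R" using x Jc by blast
  have J'self: "insert x J \<subseteq> Idl (insert x J)" by (rule genideal_self[OF xJ])
  have J'i: "ideal (Idl (insert x J)) R" by (rule genideal_ideal[OF xJ])
  define bdry where "bdry f g \<longleftrightarrow> (\<forall>l. g l \<in> carrier R) \<and> supported ?n (Suc i) g \<and>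
        (\<forall>l. f l \<ominus> koszul_d ys g l \<in> J)" for f g
  \<comment> \<open>Injectivity: if \<open>x z\<close> is the boundary of \<open>w\<close> modulo \<open>J\<close>, then \<open>w\<close> is a cycle modulo \<open>J + (x)\<close>, hence
    \<open>w = d v + x c\<close>, and \<open>x z = x (d c)\<close> modulo \<open>J\<close>.\<close>
  have single: "\<exists>v. bdry z v"
    if z: "\<And>l. z l \<in> carrier R" and w: "bdry (\<lambda>l. x \<otimes> z l) w" for z w
  proof -
    have wc: "w l \<in> carrier R" and ws: "supported ?n (Suc i) w"
      and wJ: "x \<otimes> z l \<ominus> koszul_d ys w l \<in> J" for l
      using w unfolding bdry_def by auto
    have dwc: "koszul_d ys w l \<in> carrier R" for l by (rule koszul_d_closed[OF ys wc])
    have "koszul_d ys w l \<in> Idl (insert x J)" for l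
    proof -
      have "x \<otimes> z l \<in> Idl (insert x J)" using J'self z ideal_mult_right[OF J'i] by blast
      moreover have "x \<otimes> z l \<ominus> koszul_d ys w l \<in> Idl (insert x J)" using wJ J'self by blast
      ultimately have "x \<otimes> z l \<ominus> (x \<otimes> z l \<ominus> koszul_d ys w l) \<in> Idl (insert x J)"
        by (rule ideal_diff[OF J'i])
      moreover have "a \<ominus> (a \<ominus> b) = b" if "a \<in> carrier R" "b \<in> carrier R" for a b using that by algebra
      ultimately show ?thesis using dwc x z by simp
    qed
    then obtain v where v: "\<And>l. v l \<in> carrier R" "supported ?n (Suc (Suc i)) v"
      "\<And>l. w l \<ominus> koszul_d ys v l \<in> Idl (insert x J)"
      using exact wc ws unfolding koszul_exact_def by blast
    have dvc: "koszul_d ys v l \<in> carrier R" for l by (rule koszul_d_closed[OF ys v(1)])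
    have "\<exists>c\<in>carrier R. (w l \<ominus> koszul_d ys v l) \<ominus> x \<otimes> c \<in> J \<and>
      (c \<noteq> \<zero> \<longrightarrow> length l = ?n \<and> count_list l True = Suc i)" for l
    proof (cases "length l = ?n \<and> count_list l True = Suc i")
      case True
      obtain j r where jr: "j \<in> J" "r \<in> carrier R" "w l \<ominus> koszul_d ys v l = j \<oplus> r \<otimes> x"
        using v(3)[of l] unfolding Idl_insert_ideal[OF J x] by blast
      have jc: "j \<in> carrier R" using jr Jc by blast
      have "(j \<oplus> r \<otimes> x) \<ominus> x \<otimes> r = j" using jc jr(2) x by algebra
      then show ?thesis using jr True by (intro bexI[of _ r]) auto
    next
      case False
      then have "w l = \<zero>" using ws unfolding supported_def by blast
      moreover have "koszul_d ys v l = \<zero>"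
        using supported_koszul_d[OF ys v(1,2), of l] False by auto
      ultimately have "(w l \<ominus> koszul_d ys v l) \<ominus> x \<otimes> \<zero> \<in> J"
        using x ideal_zero[OF J] by (simp add: minus_eq)
      then show ?thesis by blast
    qed
    then have "\<forall>l. \<exists>c. c \<in> carrier R \<and> (w l \<ominus> koszul_d ys v l) \<ominus> x \<otimes> c \<in> J \<and>
      (c \<noteq> \<zero> \<longrightarrow> length l = ?n \<and> count_list l True = Suc i)" by blast
    from choice[OF this] obtain c where c: "\<And>l. c l \<in> carrier R"
      "\<And>l. (w l \<ominus> koszul_d ys v l) \<ominus> x \<otimes> c l \<in> J" "supported ?n (Suc i) c"
      unfolding supported_def by blast
    have dcc: "koszul_d ys c l \<in> carrier R" for l by (rule koszul_d_closed[OF ys c(1)])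
    have "x \<otimes> (z l \<ominus> koszul_d ys c l) \<in> J" for l
    proof -
      have "koszul_d ys (\<lambda>l. (w l \<ominus> koszul_d ys v l) \<ominus> x \<otimes> c l) l \<in> J"
        by (rule koszul_d_in_ideal[OF J ys c(2)])
      also have "koszul_d ys (\<lambda>l. (w l \<ominus> koszul_d ys v l) \<ominus> x \<otimes> c l) l
        = (koszul_d ys w l \<ominus> koszul_d ys (koszul_d ys v) l) \<ominus> koszul_d ys (\<lambda>l. x \<otimes> c l) l"
        using wc dvc c(1) x by (simp add: koszul_d_diff[OF ys])
      also have "\<dots> = koszul_d ys w l \<ominus> x \<otimes> koszul_d ys c l"
        using dwc c(1) x by (simp add: koszul_d_d[OF ys v(1)] koszul_d_smult[OF ys] minus_eq)
      finally have "(x \<otimes> z l \<ominus> koszul_d ys w l) \<oplus> (koszul_d ys w l \<ominus> x \<otimes> koszul_d ys c l) \<in> J"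
        by (rule ideal_add[OF J wJ])
      moreover have "(x \<otimes> z l \<ominus> koszul_d ys w l) \<oplus> (koszul_d ys w l \<ominus> x \<otimes> koszul_d ys c l)
        = x \<otimes> (z l \<ominus> koszul_d ys c l)" using x z[of l] dwc[of l] dcc[of l] by algebra
      ultimately show ?thesis by simp
    qed
    then have "bdry z c" unfolding bdry_def using nzd z dcc c by simp
    then show ?thesis by blast
  qed
  have many: "\<exists>v. bdry z v"
    if "\<And>l. z l \<in> carrier R" "bdry (\<lambda>l. x [^] (K::nat) \<otimes> z l) w" for z w K
    using that
  proof (induction K arbitrary: z w)
    case 0
    then show ?case by (auto simp: bdry_def)
  next
    case (Suc K)
    have "(\<lambda>l. x [^] Suc K \<otimes> z l) = (\<lambda>l. x [^] K \<otimes> (x \<otimes> z l))"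
      using x Suc.prems(1) by (auto simp: m_assoc)
    then obtain v where "bdry (\<lambda>l. x \<otimes> z l) v" using Suc.IH[of "\<lambda>l. x \<otimes> z l" w] Suc.prems x by auto
    then show ?case by (rule single[OF Suc.prems(1)])
  qed
  show ?thesis
    unfolding koszul_exact_def
  proof (intro allI impI)
    fix f assume f: "\<forall>l. f l \<in> carrier R" "supported ?n i f" "\<forall>l. koszul_d ys f l \<in> J"
    then obtain w where "bdry (\<lambda>l. x [^] K \<otimes> f l) w"
      using koszul_homology_killed[OF J ys _ f(2) _ nilp] unfolding bdry_def by blast
    then show "\<exists>g. (\<forall>l. g l \<in> carrier R) \<and> supported ?n (Suc i) g \<and> (\<forall>l. f l \<ominus> koszul_d ys g l \<in> J)"
      using many[of f K w] f(1) unfolding bdry_def by blast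
  qed
qed

definition weakly_regular :: "'a list \<Rightarrow> bool"
  where "weakly_regular xs \<longleftrightarrow> set xs \<subseteq> carrier R \<and>
    (\<forall>k<length xs. \<forall>u\<in>carrier R. (xs ! k) \<otimes> u \<in> Idl (set (take k xs)) \<longrightarrow> u \<in> Idl (set (take k xs)))"

text \<open>
  Descending induction on \<open>k\<close>. The start is in degree \<open>length ys + 1\<close>, where there are no
  nonzero chains; this is where the equality of the two lengths enters.
\<close>

lemma koszul_exact_of_regular:
  assumes xs: "weakly_regular xs" and ys: "set ys \<subseteq> carrier R" and len: "length ys = length xs"
    and nilp: "\<And>x. x \<in> set xs \<Longrightarrow> \<exists>K::nat. x [^] K \<in> Idl (set ys)"
    and k: "k \<le> length xs"
  shows "koszul_exact ys (Suc k) (Idl (set (take k xs)))"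
  using k
proof (induction "length xs - k" arbitrary: k)
  case 0
  then have k: "k = length ys" using len by simp
  have I: "ideal (Idl (set (take k xs))) R" using xs set_take_subset[of k xs]
    by (intro genideal_ideal) (auto simp: weakly_regular_def)
  show ?case unfolding koszul_exact_def
  proof (intro allI impI)
    fix f assume "\<forall>l. f l \<in> carrier R" "supported (length ys) (Suc k) f"
    then have "f l = \<zero>" for l using k count_le_length[of l True] unfolding supported_def by fastforce
    then show "\<exists>g. (\<forall>l. g l \<in> carrier R) \<and> supported (length ys) (Suc (Suc k)) g \<and>
        (\<forall>l. f l \<ominus> koszul_d ys g l \<in> Idl (set (take k xs)))"
      using koszul_d_zero[OF ys] ideal_zero[OF I]
      by (intro exI[of _ "\<lambda>l. \<zero>"]) (auto simp: supported_def minus_eq)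
  qed
next
  case (Suc d)
  then have k: "k < length xs" by simp
  have xc: "set xs \<subseteq> carrier R" using xs unfolding weakly_regular_def by blast
  then have A: "set (take k xs) \<subseteq> carrier R" using set_take_subset[of k xs] by blast
  have x: "xs ! k \<in> carrier R" using xc k by auto
  have J: "ideal (Idl (set (take k xs))) R" by (rule genideal_ideal[OF A])
  have "set (take (Suc k) xs) = insert (xs ! k) (set (take k xs))"
    using k by (simp add: take_Suc_conv_app_nth)
  then have eq: "Idl (set (take (Suc k) xs)) = Idl (insert (xs ! k) (Idl (set (take k xs))))"
    using Idl_insert[OF A x] Idl_insert_ideal[OF J x] by simp
  obtain K :: nat where K: "(xs ! k) [^] K \<in> Idl (set ys)" using nilp[of "xs ! k"] k by auto
  have "Idl (set ys) \<subseteq> Idl (set ys \<union> Idl (set (take k xs)))"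
    using ys ideal_subset[OF J] by (intro Idl_mono) auto
  then have K': "(xs ! k) [^] K \<in> Idl (set ys \<union> Idl (set (take k xs)))" using K by blast
  show ?case
  proof (rule koszul_exact_lift[OF J ys x _ _ K'])
    show "\<And>u. u \<in> carrier R \<Longrightarrow> xs ! k \<otimes> u \<in> Idl (set (take k xs)) \<Longrightarrow> u \<in> Idl (set (take k xs))"
      using xs k unfolding weakly_regular_def by blast
    show "koszul_exact ys (Suc (Suc k)) (Idl (insert (xs ! k) (Idl (set (take k xs)))))"
      unfolding eq[symmetric] using Suc by (intro Suc.hyps) auto
  qed
qed

lemma Idl_empty: "Idl {} = {\<zero>}"
proof
  show "Idl {} \<subseteq> {\<zero>}" by (rule genideal_minimal[OF zeroideal]) simp
  show "{\<zero>} \<subseteq> Idl {}" using ideal_zero[OF genideal_ideal[of "{}"]] by simp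
qed

text \<open>
  The image of the last differential of the Koszul complex is the ideal generated by \<open>zs\<close>: apply
  \<open>koszul_homology_killed\<close> to the unit in degree zero.
\<close>

lemma Idl_as_koszul_boundary:
  assumes zs: "set zs \<subseteq> carrier R" and a: "a \<in> Idl (set zs)"
  shows "\<exists>g. (\<forall>l. g l \<in> carrier R) \<and> supported (length zs) 1 g \<and>
    koszul_d zs g (replicate (length zs) False) = a"
proof -
  let ?n = "length zs"
  let ?o = "replicate (length zs) False"
  define unit where "unit l = (if l = ?o then \<one> else \<zero>)" for l
  have cnt: "count_list ?o True = 0" by (simp add: count_list_0_iff)
  have us: "supported ?n 0 unit" unfolding supported_def unit_def using cnt by auto
  have uc: "unit l \<in> carrier R" for l unfolding unit_def by simp
  have du: "koszul_d zs unit l \<in> {\<zero>}" for l using supported_koszul_d[OF zs uc us, of l] by blast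
  have "Idl (set zs \<union> {\<zero>}) = Idl (set zs)"
    using zs ideal_zero[OF genideal_ideal[OF zs]] genideal_self[OF zs]
    by (intro subset_antisym genideal_minimal genideal_ideal Idl_mono) auto
  then have "a \<in> Idl (set zs \<union> {\<zero>})" using a by simp
  from koszul_homology_killed[OF zeroideal zs uc us du this] obtain g where
    g: "\<And>l. g l \<in> carrier R" "supported ?n (Suc 0) g" "\<And>l. a \<otimes> unit l \<ominus> koszul_d zs g l \<in> {\<zero>}"
    by blast
  have ac: "a \<in> carrier R" using a ideal_subset[OF genideal_ideal[OF zs]] by blast
  have "a \<ominus> koszul_d zs g ?o = \<zero>" using g(3)[of ?o] ac by (simp add: unit_def)
  then have "koszul_d zs g ?o = a" using ac koszul_d_closed[of zs g ?o, OF zs g(1)] by (simp add: r_right_minus_eq)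
  then show ?thesis using g by auto
qed

text \<open>
  The relation \<open>z u = g\<^sub>1 z\<^sub>1 + \<dots>\<close> is a cycle of degree one in the Koszul complex of \<open>z # zs\<close>.
  Being a boundary, its coefficient at \<open>z\<close>, which is \<open>u\<close> up to sign, is in the ideal of the
  remaining elements. The conditions on \<open>z # zs\<close> do not depend on the order, so any entry of a
  given sequence can play the role of \<open>z\<close>.
\<close>

theorem colon_trivial_of_regular:
  assumes xs: "weakly_regular xs" and zs: "z \<in> carrier R" "set zs \<subseteq> carrier R"
    and len: "length xs = Suc (length zs)"
    and nilp: "\<And>x. x \<in> set xs \<Longrightarrow> \<exists>K::nat. x [^] K \<in> Idl (insert z (set zs))"
    and u: "u \<in> carrier R" "z \<otimes> u \<in> Idl (set zs)"
  shows "u \<in> Idl (set zs)"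
proof -
  let ?n = "length zs"
  let ?o = "replicate (length zs) False"
  have cnt: "count_list ?o True = 0" by (simp add: count_list_0_iff)
  have zz: "set (z # zs) \<subseteq> carrier R" using zs by simp
  have "koszul_exact (z # zs) (Suc 0) (Idl (set (take 0 xs)))"
    using len nilp by (intro koszul_exact_of_regular[OF xs zz]) auto
  then have exact: "koszul_exact (z # zs) 1 {\<zero>}" by (simp add: Idl_empty)
  obtain g where g: "\<And>l. g l \<in> carrier R" "supported ?n 1 g" "koszul_d zs g ?o = z \<otimes> u"
    using Idl_as_koszul_boundary[OF zs(2) u(2)] by blast
  define t where "t l = (if l = ?o then \<ominus> u else \<zero>)" for l
  have tc: "t l \<in> carrier R" for l unfolding t_def using u by simp
  have ts: "supported ?n 0 t" unfolding supported_def t_def using cnt by auto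
  have dt: "koszul_d zs t l = \<zero>" for l using supported_koszul_d[OF zs(2) tc ts, of l] by blast
  \<comment> \<open>The chain with coefficient \<open>- u\<close> at \<open>z\<close> and the coefficients of \<open>g\<close> at \<open>zs\<close>.\<close>
  define f where "f l = (case l of [] \<Rightarrow> \<zero> | b # l' \<Rightarrow> if b then t l' else g l')" for l
  have fc: "f l \<in> carrier R" for l unfolding f_def using tc g(1) by (auto split: list.split)
  have fs: "supported (length (z # zs)) 1 f"
    unfolding supported_def
  proof (intro allI impI)
    fix l assume nz: "f l \<noteq> \<zero>"
    then obtain b l' where l: "l = b # l'" unfolding f_def by (cases l) auto
    show "length l = length (z # zs) \<and> count_list l True = 1"
    proof (cases b)
      case True
      then have "t l' \<noteq> \<zero>" using nz l by (simp add: f_def)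
      then show ?thesis using ts l True unfolding supported_def by simp
    next
      case False
      then have "g l' \<noteq> \<zero>" using nz l by (simp add: f_def)
      then show ?thesis using g(2) l False unfolding supported_def by simp
    qed
  qed
  have fT: "(\<lambda>l. f (True # l)) = t" and fF: "(\<lambda>l. f (False # l)) = g" unfolding f_def by auto
  have df: "koszul_d (z # zs) f l \<in> {\<zero>}" for l
  proof (cases l)
    case (Cons b l')
    show ?thesis
    proof (cases b)
      case True
      then show ?thesis using Cons dt by (simp add: fT)
    next
      case False
      have "koszul_d zs g l' \<oplus> z \<otimes> t l' = \<zero>"
      proof (cases "l' = ?o")
        case True
        then show ?thesis using g(3) u zs by (simp add: t_def r_minus r_neg)
      next
        case False
        have "koszul_d zs g l' = \<zero>"
        proof (rule ccontr)
          assume "koszul_d zs g l' \<noteq> \<zero>"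
          then have *: "length l' = ?n \<and> Suc (count_list l' True) = 1"
            by (rule supported_koszul_d[OF zs(2) g(1,2)])
          then have "\<forall>b\<in>set l'. b = False" using count_list_0_iff[of l' True] by auto
          then have "l' = ?o" using * by (metis replicate_eqI)
          then show False using False by blast
        qed
        then show ?thesis using False zs by (simp add: t_def)
      qed
      then show ?thesis using Cons False fun_cong[OF fT, of l'] by (simp add: fF)
    qed
  qed simp
  obtain G where G: "\<And>l. G l \<in> carrier R" "\<And>l. f l \<ominus> koszul_d (z # zs) G l \<in> {\<zero>}"
    using exact fc fs df unfolding koszul_exact_def by blast
  have dGc: "koszul_d zs (\<lambda>l. G (True # l)) ?o \<in> carrier R" by (rule koszul_d_closed[OF zs(2) G(1)])
  have "f (True # ?o) \<ominus> koszul_d (z # zs) G (True # ?o) = \<zero>" using G(2)[of "True # ?o"] by simp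
  then have "f (True # ?o) = \<ominus> koszul_d zs (\<lambda>l. G (True # l)) ?o"
    using fc dGc by (simp add: r_right_minus_eq)
  then have "u = koszul_d zs (\<lambda>l. G (True # l)) ?o"
    using fun_cong[OF fT, of ?o] u(1) dGc by (metis local.t_def minus_minus)
  then show ?thesis using koszul_d_in_Idl[of zs "\<lambda>l. G (True # l)" ?o, OF zs(2) G(1)] by simp
qed


section \<open>Frobenius\<close>

lemma binomial_theorem:
  assumes "a \<in> carrier R" "b \<in> carrier R"
  shows "(a \<oplus> b) [^] n = (\<Oplus>k\<in>{..n}. [(n choose k)] \<cdot> (a [^] k \<otimes> b [^] (n - k)))"
proof (induction n)
  case 0
  then show ?case using assms by simp
next
  case (Suc n)
  let ?f = "\<lambda>k. [(n choose k)] \<cdot> (a [^] k \<otimes> b [^] (n - k))"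
  let ?g = "\<lambda>k. [(n choose k)] \<cdot> (a [^] k \<otimes> b [^] (Suc n - k))"
  have "b \<otimes> ?f k = ?g k" if "k \<le> n" for k
    using assms that by (simp add: add_pow_rdistr m_lcomm Suc_diff_le m_comm)
  then have "b \<otimes> (\<Oplus>k\<in>{..n}. ?f k) = (\<Oplus>k\<in>{..n}. ?g k)"
    using assms by (subst finsum_rdistr) (auto intro!: finsum_cong')
  also have "\<dots> = (\<Oplus>k\<in>{..Suc n}. ?g k)"
    using assms by (subst finsum_Suc) (auto simp: binomial_eq_0)
  also have "\<dots> = (\<Oplus>k\<in>{..n}. ?g (Suc k)) \<oplus> ?g 0"
    using assms by (subst finsum_Suc2) auto
  finally have 1: "b \<otimes> (\<Oplus>k\<in>{..n}. ?f k) = (\<Oplus>k\<in>{..n}. ?g (Suc k)) \<oplus> ?g 0" .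
  let ?h = "\<lambda>k. [(n choose k)] \<cdot> (a [^] Suc k \<otimes> b [^] (n - k))"
  have 2: "a \<otimes> (\<Oplus>k\<in>{..n}. ?f k) = (\<Oplus>k\<in>{..n}. ?h k)"
    using assms by (subst finsum_rdistr) (auto intro!: finsum_cong' simp: add_pow_rdistr m_ac)
  have "(\<Oplus>k\<in>{..Suc n}. [(Suc n choose k)] \<cdot> (a [^] k \<otimes> b [^] (Suc n - k)))
    = (\<Oplus>k\<in>{..n}. [(Suc n choose Suc k)] \<cdot> (a [^] Suc k \<otimes> b [^] (n - k))) \<oplus> ?g 0"
    using assms by (subst finsum_Suc2) auto
  also have "(\<Oplus>k\<in>{..n}. [(Suc n choose Suc k)] \<cdot> (a [^] Suc k \<otimes> b [^] (n - k)))
    = (\<Oplus>k\<in>{..n}. ?h k \<oplus> ?g (Suc k))"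
    using assms by (intro finsum_cong') (auto simp: add.nat_pow_mult)
  also have "\<dots> = (\<Oplus>k\<in>{..n}. ?h k) \<oplus> (\<Oplus>k\<in>{..n}. ?g (Suc k))"
    using assms by (intro finsum_addf) auto
  finally have "(\<Oplus>k\<in>{..Suc n}. [(Suc n choose k)] \<cdot> (a [^] k \<otimes> b [^] (Suc n - k)))
    = a \<otimes> (\<Oplus>k\<in>{..n}. ?f k) \<oplus> b \<otimes> (\<Oplus>k\<in>{..n}. ?f k)"
    using assms 1 2 by (simp add: a_assoc)
  then show ?case using assms Suc by (simp add: l_distr[symmetric] m_comm)
qed

text \<open>
  Stated as an identity in \<open>R\<close> so that it passes along ring homomorphisms, also to the zero
  ring.
\<close>

definition char_dvd :: "nat \<Rightarrow> bool"
  where "char_dvd p \<longleftrightarrow> [p] \<cdot> \<one> = \<zero>"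

lemma char_dvd_mult:
  assumes "char_dvd p" "p dvd n" "x \<in> carrier R"
  shows "[n] \<cdot> x = \<zero>"
proof -
  obtain k where n: "n = p * k" using assms(2) by blast
  have "[p] \<cdot> x = [p] \<cdot> (\<one> \<otimes> x)" using assms(3) by simp
  also have "\<dots> = ([p] \<cdot> \<one>) \<otimes> x" using assms(3) by (simp add: add_pow_ldistr)
  also have "\<dots> = \<zero>" using assms(1,3) unfolding char_dvd_def by simp
  finally have "[p] \<cdot> x = \<zero>" .
  then show ?thesis unfolding n using assms(3) by (simp add: add.nat_pow_pow[symmetric])
qed

lemma freshmans_dream:
  assumes p: "Factorial_Ring.prime p" "char_dvd p" and ab: "a \<in> carrier R" "b \<in> carrier R"
  shows "(a \<oplus> b) [^] p = a [^] p \<oplus> b [^] p"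
proof -
  let ?f = "\<lambda>k. [(p choose k)] \<cdot> (a [^] k \<otimes> b [^] (p - k))"
  have fc: "?f \<in> A \<rightarrow> carrier R" for A using ab by auto
  have p0: "0 < p" using p(1) prime_gt_0_nat by blast
  have mid: "?f k = \<zero>" if "0 < k" "k < p" for k
    using that ab by (intro char_dvd_mult[OF p(2)] dvd_choose_prime p(1)) auto
  have "(\<Oplus>k\<in>{..p}. ?f k) = (\<Oplus>k\<in>{0, p}. ?f k)"
    by (rule add.finprod_mono_neutral_cong_left[symmetric]) (use ab mid in \<open>auto simp: fc\<close>)
  also have "\<dots> = ?f 0 \<oplus> ?f p" using p0 ab by simp
  finally show ?thesis using binomial_theorem[OF ab, of p] ab by (simp add: a_comm)
qed

lemma frobenius_add:
  assumes p: "Factorial_Ring.prime p" "char_dvd p" and ab: "a \<in> carrier R" "b \<in> carrier R"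
  shows "(a \<oplus> b) [^] (p ^ e) = a [^] (p ^ e) \<oplus> b [^] (p ^ e)"
proof (induction e)
  case (Suc e)
  have "(a \<oplus> b) [^] (p ^ Suc e) = ((a \<oplus> b) [^] (p ^ e)) [^] p"
    using ab by (simp add: nat_pow_pow mult.commute)
  also have "\<dots> = (a [^] (p ^ e)) [^] p \<oplus> (b [^] (p ^ e)) [^] p"
    using ab Suc by (simp add: freshmans_dream[OF p])
  finally show ?case using ab by (simp add: nat_pow_pow mult.commute)
qed (use ab in simp)

lemma frobenius_preimage_ideal:
  assumes p: "Factorial_Ring.prime p" "char_dvd p" and I: "ideal I R"
  shows "ideal {a \<in> carrier R. a [^] (p ^ e) \<in> I} R"
proof (rule ideal_closedI)
  have "p ^ e \<noteq> 0" using p(1) by auto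
  then show "\<zero> \<in> {a \<in> carrier R. a [^] (p ^ e) \<in> I}"
    using ideal_zero[OF I] by (simp add: nat_pow_zero)
next
  fix a b assume "a \<in> {a \<in> carrier R. a [^] (p ^ e) \<in> I}" "b \<in> {a \<in> carrier R. a [^] (p ^ e) \<in> I}"
  then show "a \<oplus> b \<in> {a \<in> carrier R. a [^] (p ^ e) \<in> I}"
    using ideal_add[OF I] by (simp add: frobenius_add[OF p])
next
  fix r a assume "r \<in> carrier R" "a \<in> {a \<in> carrier R. a [^] (p ^ e) \<in> I}"
  then show "r \<otimes> a \<in> {a \<in> carrier R. a [^] (p ^ e) \<in> I}"
    using ideal_mult[OF I] by (simp add: nat_pow_distrib)
qed auto

lemma ideal_pow_mono:
  assumes I: "ideal I R" and a: "a \<in> carrier R" "a [^] (k::nat) \<in> I" and le: "k \<le> n"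
  shows "a [^] n \<in> I"
proof -
  have "a [^] (n - k) \<otimes> a [^] k \<in> I" using ideal_mult[OF I a(2)] a(1) by simp
  then show ?thesis using a(1) le by (simp add: nat_pow_mult)
qed

lemma frobenius_Idl:
  assumes p: "Factorial_Ring.prime p" "char_dvd p" and A: "A \<subseteq> carrier R" and a: "a \<in> Idl A"
  shows "a [^] (p ^ e) \<in> Idl ((\<lambda>x. x [^] (p ^ e)) ` A)"
proof -
  have B: "(\<lambda>x. x [^] (p ^ e)) ` A \<subseteq> carrier R" using A by auto
  have "Idl A \<subseteq> {a \<in> carrier R. a [^] (p ^ e) \<in> Idl ((\<lambda>x. x [^] (p ^ e)) ` A)}"
    by (rule genideal_minimal[OF frobenius_preimage_ideal[OF p genideal_ideal[OF B]]])
      (use genideal_self[OF B] A in auto)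
  then show ?thesis using a by blast
qed

text \<open>
  If every element of \<open>A\<close> has a power in \<open>I\<close>, then \<open>A\<close> generates a proper ideal as soon as \<open>I\<close>
  is proper. In characteristic \<open>p\<close> the elements with some \<open>p^e\<close>-th power in \<open>I\<close> form an ideal.
\<close>

lemma eventual_frobenius_proper:
  assumes p: "Factorial_Ring.prime p" "char_dvd p" and I: "ideal I R" "\<one> \<notin> I"
    and A: "\<And>a. a \<in> A \<Longrightarrow> a \<in> carrier R \<and> (\<exists>k::nat. a [^] k \<in> I)"
  shows "\<one> \<notin> Idl A"
proof
  assume one: "\<one> \<in> Idl A"
  let ?D = "{a \<in> carrier R. \<exists>e. a [^] (p ^ e) \<in> I}"
  have mono: "a [^] (p ^ f) \<in> I" if "a \<in> carrier R" "a [^] (p ^ e) \<in> I" "e \<le> f" for a e f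
    by (rule ideal_pow_mono[OF I(1) that(1,2)])
      (rule power_increasing[OF that(3) prime_ge_1_nat[OF p(1)]])
  have "ideal ?D R"
  proof (rule ideal_closedI)
    have "\<zero> [^] (p ^ 0) \<in> I" using ideal_zero[OF I(1)] by simp
    then show "\<zero> \<in> ?D" by blast
  next
    fix a b assume "a \<in> ?D" "b \<in> ?D"
    then obtain e f where ab: "a \<in> carrier R" "b \<in> carrier R" "a [^] (p ^ e) \<in> I" "b [^] (p ^ f) \<in> I"
      by blast
    have "(a \<oplus> b) [^] (p ^ max e f) \<in> I"
      using mono[OF ab(1,3), of "max e f"] mono[OF ab(2,4), of "max e f"] ab(1,2) ideal_add[OF I(1)]
      by (simp add: frobenius_add[OF p])
    then show "a \<oplus> b \<in> ?D" using ab(1,2) by blast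
  next
    fix r a assume r: "r \<in> carrier R" and "a \<in> ?D"
    then obtain e where a: "a \<in> carrier R" "a [^] (p ^ e) \<in> I" by blast
    then have "(r \<otimes> a) [^] (p ^ e) \<in> I"
      using ideal_mult[OF I(1) a(2), of "r [^] (p ^ e)"] r by (simp add: nat_pow_distrib)
    then show "r \<otimes> a \<in> ?D" using r a(1) by blast
  qed auto
  moreover have "A \<subseteq> ?D"
  proof
    fix a assume "a \<in> A"
    then obtain k :: nat where k: "a \<in> carrier R" "a [^] k \<in> I" using A by blast
    have "k \<le> p ^ k" using p(1) prime_gt_1_nat by (simp add: less_imp_le power_gt_expt)
    then show "a \<in> ?D" using ideal_pow_mono[OF I(1) k] k(1) by blast
  qed
  ultimately have "Idl A \<subseteq> ?D" by (rule genideal_minimal)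
  then show False using one I(2) by auto
qed

end

section \<open>Homomorphisms\<close>

lemma hom_Idl:
  assumes A: "cring A" and B: "cring B" and h: "h \<in> ring_hom A B" and Y: "Y \<subseteq> carrier A"
    and u: "u \<in> Idl\<^bsub>A\<^esub> Y"
  shows "h u \<in> Idl\<^bsub>B\<^esub> (h ` Y)"
proof -
  interpret A: cring A by fact
  interpret B: cring B by fact
  have hY: "h ` Y \<subseteq> carrier B" using Y ring_hom_closed[OF h] by blast
  have I: "ideal (Idl\<^bsub>B\<^esub> (h ` Y)) B" by (rule B.genideal_ideal[OF hY])
  have "ideal {a \<in> carrier A. h a \<in> Idl\<^bsub>B\<^esub> (h ` Y)} A"
  proof (rule A.ideal_closedI)
    show "\<zero>\<^bsub>A\<^esub> \<in> {a \<in> carrier A. h a \<in> Idl\<^bsub>B\<^esub> (h ` Y)}"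
      using ring_hom_zero[OF h A.ring_axioms B.ring_axioms] B.ideal_zero[OF I] by simp
  next
    fix a b assume "a \<in> {a \<in> carrier A. h a \<in> Idl\<^bsub>B\<^esub> (h ` Y)}" "b \<in> {a \<in> carrier A. h a \<in> Idl\<^bsub>B\<^esub> (h ` Y)}"
    then show "a \<oplus>\<^bsub>A\<^esub> b \<in> {a \<in> carrier A. h a \<in> Idl\<^bsub>B\<^esub> (h ` Y)}"
      using B.ideal_add[OF I] by (simp add: ring_hom_add[OF h])
  next
    fix a b assume "a \<in> carrier A" "b \<in> {a \<in> carrier A. h a \<in> Idl\<^bsub>B\<^esub> (h ` Y)}"
    then show "a \<otimes>\<^bsub>A\<^esub> b \<in> {a \<in> carrier A. h a \<in> Idl\<^bsub>B\<^esub> (h ` Y)}"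
      using B.ideal_mult[OF I] ring_hom_closed[OF h] by (simp add: ring_hom_mult[OF h])
  qed auto
  then have "Idl\<^bsub>A\<^esub> Y \<subseteq> {a \<in> carrier A. h a \<in> Idl\<^bsub>B\<^esub> (h ` Y)}"
    by (rule A.genideal_minimal) (use Y B.genideal_self[OF hY] in auto)
  then show ?thesis using u by blast
qed

lemma hom_pow:
  assumes "cring A" "cring B" "h \<in> ring_hom A B" "a \<in> carrier A"
  shows "h (a [^]\<^bsub>A\<^esub> (n::nat)) = h a [^]\<^bsub>B\<^esub> n"
proof -
  interpret A: cring A by fact
  interpret B: cring B by fact
  show ?thesis
    using assms(3,4) by (induction n) (simp_all add: ring_hom_mult ring_hom_one)
qed

text \<open>
  Used to read off, in a quotient ring, which elements belong to the ideal generated by given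
  classes.
\<close>

lemma surj_hom_Idl:
  assumes A: "cring A" and B: "cring B" and h: "h \<in> ring_hom A B" "carrier B = h ` carrier A"
    and Y: "Y \<subseteq> carrier A"
  shows "Idl\<^bsub>B\<^esub> (h ` Y) = h ` (Idl\<^bsub>A\<^esub> Y)"
proof
  interpret A: cring A by fact
  interpret B: cring B by fact
  have I: "ideal (Idl\<^bsub>A\<^esub> Y) A" by (rule A.genideal_ideal[OF Y])
  have Ic: "Idl\<^bsub>A\<^esub> Y \<subseteq> carrier A" by (rule A.ideal_subset[OF I])
  have "ideal (h ` (Idl\<^bsub>A\<^esub> Y)) B"
  proof (rule B.ideal_closedI)
    show "h ` (Idl\<^bsub>A\<^esub> Y) \<subseteq> carrier B" using Ic h(2) by blast
    have "h \<zero>\<^bsub>A\<^esub> = \<zero>\<^bsub>B\<^esub>" by (rule ring_hom_zero[OF h(1) A.ring_axioms B.ring_axioms])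
    then show "\<zero>\<^bsub>B\<^esub> \<in> h ` (Idl\<^bsub>A\<^esub> Y)" using A.ideal_zero[OF I] by (metis imageI)
  next
    fix a b assume "a \<in> h ` (Idl\<^bsub>A\<^esub> Y)" "b \<in> h ` (Idl\<^bsub>A\<^esub> Y)"
    then obtain u v where uv: "u \<in> Idl\<^bsub>A\<^esub> Y" "v \<in> Idl\<^bsub>A\<^esub> Y" "a = h u" "b = h v" by blast
    have "h (u \<oplus>\<^bsub>A\<^esub> v) = a \<oplus>\<^bsub>B\<^esub> b" using uv Ic by (simp add: ring_hom_add[OF h(1)] subsetD)
    then show "a \<oplus>\<^bsub>B\<^esub> b \<in> h ` (Idl\<^bsub>A\<^esub> Y)" using A.ideal_add[OF I uv(1,2)] by (metis imageI)
  next
    fix r a assume "r \<in> carrier B" "a \<in> h ` (Idl\<^bsub>A\<^esub> Y)"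
    then obtain s u where uv: "s \<in> carrier A" "u \<in> Idl\<^bsub>A\<^esub> Y" "r = h s" "a = h u" using h(2) by blast
    have "h (s \<otimes>\<^bsub>A\<^esub> u) = r \<otimes>\<^bsub>B\<^esub> a" using uv Ic by (simp add: ring_hom_mult[OF h(1)] subsetD)
    then show "r \<otimes>\<^bsub>B\<^esub> a \<in> h ` (Idl\<^bsub>A\<^esub> Y)" using A.ideal_mult[OF I uv(2,1)] by (metis imageI)
  qed
  then show "Idl\<^bsub>B\<^esub> (h ` Y) \<subseteq> h ` (Idl\<^bsub>A\<^esub> Y)"
    by (rule B.genideal_minimal) (use A.genideal_self[OF Y] in blast)
  show "h ` (Idl\<^bsub>A\<^esub> Y) \<subseteq> Idl\<^bsub>B\<^esub> (h ` Y)" using hom_Idl[OF A B h(1) Y] by blast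
qed

section \<open>Sequence rings\<close>

definition seq_ring :: "('b, 'l) ring_scheme \<Rightarrow> (nat \<Rightarrow> 'b) ring"
  where "seq_ring A = \<lparr>carrier = {f. \<forall>e. f e \<in> carrier A}, monoid.mult = (\<lambda>f g e. f e \<otimes>\<^bsub>A\<^esub> g e),
    monoid.one = (\<lambda>e. \<one>\<^bsub>A\<^esub>), ring.zero = (\<lambda>e. \<zero>\<^bsub>A\<^esub>), ring.add = (\<lambda>f g e. f e \<oplus>\<^bsub>A\<^esub> g e)\<rparr>"

lemma seq_ring_simps:
  "f \<in> carrier (seq_ring A) \<longleftrightarrow> (\<forall>e. f e \<in> carrier A)"
  "(f \<otimes>\<^bsub>seq_ring A\<^esub> g) e = f e \<otimes>\<^bsub>A\<^esub> g e"
  "(f \<oplus>\<^bsub>seq_ring A\<^esub> g) e = f e \<oplus>\<^bsub>A\<^esub> g e"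
  "\<one>\<^bsub>seq_ring A\<^esub> e = \<one>\<^bsub>A\<^esub>"
  "\<zero>\<^bsub>seq_ring A\<^esub> e = \<zero>\<^bsub>A\<^esub>"
  unfolding seq_ring_def by simp_all

lemma seq_ring_cring:
  assumes "cring A"
  shows "cring (seq_ring A)"
proof -
  interpret cring A by fact
  show ?thesis
  proof (rule cringI)
    show "abelian_group (seq_ring A)"
    proof (rule abelian_groupI)
      fix f assume f: "f \<in> carrier (seq_ring A)"
      have "(\<lambda>e. \<ominus>\<^bsub>A\<^esub> f e) \<oplus>\<^bsub>seq_ring A\<^esub> f = \<zero>\<^bsub>seq_ring A\<^esub>" "(\<lambda>e. \<ominus>\<^bsub>A\<^esub> f e) \<in> carrier (seq_ring A)"
        using f by (auto simp: seq_ring_simps l_neg)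
      then show "\<exists>g\<in>carrier (seq_ring A). g \<oplus>\<^bsub>seq_ring A\<^esub> f = \<zero>\<^bsub>seq_ring A\<^esub>" by blast
    qed (auto simp: seq_ring_simps a_ac)
    show "comm_monoid (seq_ring A)"
      by (rule comm_monoidI) (auto simp: seq_ring_simps m_ac)
  qed (auto simp: seq_ring_simps l_distr)
qed

lemma seq_ring_minus:
  assumes "cring A" "f \<in> carrier (seq_ring A)" "g \<in> carrier (seq_ring A)"
  shows "(f \<ominus>\<^bsub>seq_ring A\<^esub> g) e = f e \<ominus>\<^bsub>A\<^esub> g e"
proof -
  interpret A: cring A by fact
  interpret S: cring "seq_ring A" by (rule seq_ring_cring[OF assms(1)])
  have c: "f e \<in> carrier A" "g e \<in> carrier A" "(f \<ominus>\<^bsub>seq_ring A\<^esub> g) e \<in> carrier A"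
    using assms(2,3) S.minus_closed[OF assms(2,3)] by (auto simp: seq_ring_simps(1))
  have "(f \<ominus>\<^bsub>seq_ring A\<^esub> g) \<oplus>\<^bsub>seq_ring A\<^esub> g = f" using assms(2,3) by (simp add: S.minus_eq S.a_assoc S.l_neg)
  then have "(f \<ominus>\<^bsub>seq_ring A\<^esub> g) e \<oplus>\<^bsub>A\<^esub> g e = f e" by (metis seq_ring_simps(3))
  then show ?thesis using c by (metis A.add.inv_solve_right A.minus_eq)
qed

lemma seq_ring_pow: "(f [^]\<^bsub>seq_ring A\<^esub> (n::nat)) e = f e [^]\<^bsub>A\<^esub> n"
  by (induction n) (simp_all add: seq_ring_def nat_pow_def)

lemma seq_ring_eval_hom: "(\<lambda>f. f e) \<in> ring_hom (seq_ring A) A"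
  by (rule ring_hom_memI) (auto simp: seq_ring_simps)

text \<open>
  Finiteness of \<open>F\<close> matters: only finitely many coefficients have to be chosen in each
  component, and their number does not depend on the component.
\<close>

lemma seq_ring_Idl:
  assumes A: "cring A" and F: "finite F" "F \<subseteq> carrier (seq_ring A)" and u: "u \<in> carrier (seq_ring A)"
  shows "u \<in> Idl\<^bsub>seq_ring A\<^esub> F \<longleftrightarrow> (\<forall>e. u e \<in> Idl\<^bsub>A\<^esub> ((\<lambda>f. f e) ` F))"
proof
  assume "u \<in> Idl\<^bsub>seq_ring A\<^esub> F"
  then show "\<forall>e. u e \<in> Idl\<^bsub>A\<^esub> ((\<lambda>f. f e) ` F)"
    using hom_Idl[OF seq_ring_cring[OF A] A seq_ring_eval_hom F(2)] by blast
next
  interpret A: cring A by fact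
  interpret S: cring "seq_ring A" by (rule seq_ring_cring[OF A])
  assume mem: "\<forall>e. u e \<in> Idl\<^bsub>A\<^esub> ((\<lambda>f. f e) ` F)"
  show "u \<in> Idl\<^bsub>seq_ring A\<^esub> F"
    using F(1) mem F(2) u
  proof (induction F arbitrary: u rule: finite_induct)
    case empty
    then have "u e = \<zero>\<^bsub>A\<^esub>" for e using A.Idl_empty by auto
    then have "u = \<zero>\<^bsub>seq_ring A\<^esub>" by (auto simp: seq_ring_simps)
    then show ?case by (simp add: S.Idl_empty)
  next
    case (insert b F)
    have b: "b \<in> carrier (seq_ring A)" and F: "F \<subseteq> carrier (seq_ring A)" using insert.prems by auto
    have bc: "b e \<in> carrier A" and Fc: "(\<lambda>f. f e) ` F \<subseteq> carrier A" for e
      using b F by (auto simp: seq_ring_simps)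
    have "\<forall>e. \<exists>w. fst w \<in> Idl\<^bsub>A\<^esub> ((\<lambda>f. f e) ` F) \<and> snd w \<in> carrier A \<and> u e = fst w \<oplus>\<^bsub>A\<^esub> snd w \<otimes>\<^bsub>A\<^esub> b e"
      using insert.prems(1) by (auto simp: A.Idl_insert[OF Fc bc])
    from choice[OF this] obtain w where w: "\<And>e. fst (w e) \<in> Idl\<^bsub>A\<^esub> ((\<lambda>f. f e) ` F)"
      "\<And>e. snd (w e) \<in> carrier A" "\<And>e. u e = fst (w e) \<oplus>\<^bsub>A\<^esub> snd (w e) \<otimes>\<^bsub>A\<^esub> b e" by blast
    have "fst (w e) \<in> carrier A" for e using w(1)[of e] A.ideal_subset[OF A.genideal_ideal[OF Fc]] by blast
    then have "(\<lambda>e. fst (w e)) \<in> Idl\<^bsub>seq_ring A\<^esub> F"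
      using w(1) F by (intro insert.IH) (auto simp: seq_ring_simps)
    moreover have "(\<lambda>e. snd (w e)) \<in> carrier (seq_ring A)" using w(2) by (simp add: seq_ring_simps)
    moreover have "u = (\<lambda>e. fst (w e)) \<oplus>\<^bsub>seq_ring A\<^esub> (\<lambda>e. snd (w e)) \<otimes>\<^bsub>seq_ring A\<^esub> b"
      using w(3) by (auto simp: seq_ring_simps)
    ultimately show ?case unfolding S.Idl_insert[OF F b] by blast
  qed
qed

section \<open>Localisation at the powers of an element\<close>

context cring
begin

text \<open>
  The pair \<open>(u, N)\<close> stands for the fraction \<open>u / g^N\<close>.
\<close>

definition frac_eq :: "'a \<Rightarrow> 'a \<times> nat \<Rightarrow> 'a \<times> nat \<Rightarrow> bool"
  where "frac_eq g p q \<longleftrightarrow> (\<exists>K::nat. g [^] (K + snd q) \<otimes> fst p = g [^] (K + snd p) \<otimes> fst q)"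

definition frac :: "'a \<Rightarrow> 'a \<Rightarrow> nat \<Rightarrow> ('a \<times> nat) set"
  where "frac g u N = {q. fst q \<in> carrier R \<and> frac_eq g (u, N) q}"

lemma pow_pow_mult:
  "g \<in> carrier R \<Longrightarrow> u \<in> carrier R \<Longrightarrow> g [^] (A::nat) \<otimes> (g [^] (B::nat) \<otimes> u) = g [^] (A + B) \<otimes> u"
  by (simp add: m_assoc[symmetric] nat_pow_mult)

lemma frac_eq_sym: "frac_eq g p q \<Longrightarrow> frac_eq g q p"
  unfolding frac_eq_def by metis

lemma frac_eq_trans:
  assumes g: "g \<in> carrier R" and c: "fst p \<in> carrier R" "fst q \<in> carrier R" "fst r \<in> carrier R"
    and pq: "frac_eq g p q" and qr: "frac_eq g q r"
  shows "frac_eq g p r"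
proof -
  obtain K where K: "g [^] (K + snd q) \<otimes> fst p = g [^] (K + snd p) \<otimes> fst q"
    using pq unfolding frac_eq_def by blast
  obtain L where L: "g [^] (L + snd r) \<otimes> fst q = g [^] (L + snd q) \<otimes> fst r"
    using qr unfolding frac_eq_def by blast
  have "g [^] (L + snd r) \<otimes> (g [^] (K + snd q) \<otimes> fst p) = g [^] (K + snd p) \<otimes> (g [^] (L + snd r) \<otimes> fst q)"
    unfolding K using g c by (simp add: pow_pow_mult add_ac)
  then have "g [^] (L + snd r + (K + snd q)) \<otimes> fst p = g [^] (K + snd p + (L + snd q)) \<otimes> fst r"
    unfolding L using g c by (simp add: pow_pow_mult)
  moreover have "L + snd r + (K + snd q) = (L + K + snd q) + snd r"
    "K + snd p + (L + snd q) = (L + K + snd q) + snd p" by simp_all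
  ultimately have "g [^] ((L + K + snd q) + snd r) \<otimes> fst p = g [^] ((L + K + snd q) + snd p) \<otimes> fst r"
    by simp
  then show ?thesis unfolding frac_eq_def by blast
qed

lemma frac_eq_iff:
  assumes "g \<in> carrier R" "u \<in> carrier R" "v \<in> carrier R"
  shows "frac g u N = frac g v M \<longleftrightarrow> frac_eq g (u, N) (v, M)"
proof
  assume "frac g u N = frac g v M"
  moreover have "(v, M) \<in> frac g v M" unfolding frac_def frac_eq_def using assms by simp
  ultimately have "(v, M) \<in> frac g u N" by simp
  then show "frac_eq g (u, N) (v, M)" unfolding frac_def by simp
next
  assume eq: "frac_eq g (u, N) (v, M)"
  have "frac_eq g (u, N) q \<longleftrightarrow> frac_eq g (v, M) q" if "fst q \<in> carrier R" for q
  proof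
    show "frac_eq g (v, M) q" if "frac_eq g (u, N) q"
      by (rule frac_eq_trans[OF assms(1) _ _ _ frac_eq_sym[OF eq] that]) (use assms \<open>fst q \<in> carrier R\<close> in simp_all)
    show "frac_eq g (u, N) q" if "frac_eq g (v, M) q"
      by (rule frac_eq_trans[OF assms(1) _ _ _ eq that]) (use assms \<open>fst q \<in> carrier R\<close> in simp_all)
  qed
  then show "frac g u N = frac g v M" unfolding frac_def by blast
qed

lemma frac_eqI:
  assumes "g \<in> carrier R" "u \<in> carrier R" "v \<in> carrier R" "g [^] (M::nat) \<otimes> u = g [^] (N::nat) \<otimes> v"
  shows "frac g u N = frac g v M"
proof -
  have "g [^] (0 + snd (v, M)) \<otimes> fst (u, N) = g [^] (0 + snd (u, N)) \<otimes> fst (v, M)"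
    using assms(4) by simp
  then show ?thesis unfolding frac_eq_iff[OF assms(1-3)] frac_eq_def by blast
qed

definition frac_rep :: "'a \<Rightarrow> ('a \<times> nat) set \<Rightarrow> 'a \<times> nat"
  where "frac_rep g Y = (SOME p. fst p \<in> carrier R \<and> Y = frac g (fst p) (snd p))"

lemma frac_rep:
  assumes "u \<in> carrier R"
  obtains v M where "v \<in> carrier R" "frac g u N = frac g v M" "frac_rep g (frac g u N) = (v, M)"
proof -
  let ?P = "\<lambda>p. fst p \<in> carrier R \<and> frac g u N = frac g (fst p) (snd p)"
  have "?P (u, N)" using assms by simp
  then have "?P (frac_rep g (frac g u N))" unfolding frac_rep_def by (rule someI[of ?P])
  then show ?thesis using that by (metis prod.collapse)
qed

text \<open>
  Sums and products are formed with chosen representatives; the lemmas \<open>localisation_mult\<close> and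
  \<open>localisation_add\<close> show that the choice is immaterial.
\<close>

definition localisation :: "'a \<Rightarrow> ('a \<times> nat) set ring"
  where "localisation g = \<lparr>carrier = {frac g u N | u N. u \<in> carrier R},
    monoid.mult = (\<lambda>Y Z. case (frac_rep g Y, frac_rep g Z) of ((u, N), (v, M)) \<Rightarrow> frac g (u \<otimes> v) (N + M)),
    monoid.one = frac g \<one> 0, ring.zero = frac g \<zero> 0,
    ring.add = (\<lambda>Y Z. case (frac_rep g Y, frac_rep g Z) of ((u, N), (v, M)) \<Rightarrow>
      frac g (g [^] M \<otimes> u \<oplus> g [^] N \<otimes> v) (N + M))\<rparr>"

lemma localisation_carrierE:
  assumes "Y \<in> carrier (localisation g)"
  obtains u N where "u \<in> carrier R" "Y = frac g u N"
  using assms unfolding localisation_def by auto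

lemma localisation_carrier: "u \<in> carrier R \<Longrightarrow> frac g u N \<in> carrier (localisation g)"
  unfolding localisation_def by auto

lemma localisation_one: "\<one>\<^bsub>localisation g\<^esub> = frac g \<one> 0"
  and localisation_zero: "\<zero>\<^bsub>localisation g\<^esub> = frac g \<zero> 0"
  unfolding localisation_def by simp_all

lemma localisation_mult:
  assumes g: "g \<in> carrier R" and u: "u \<in> carrier R" and v: "v \<in> carrier R"
  shows "frac g u N \<otimes>\<^bsub>localisation g\<^esub> frac g v M = frac g (u \<otimes> v) (N + M)"
proof -
  obtain u' N' where u': "u' \<in> carrier R" "frac g u N = frac g u' N'" "frac_rep g (frac g u N) = (u', N')"
    by (rule frac_rep[OF u])
  obtain v' M' where v': "v' \<in> carrier R" "frac g v M = frac g v' M'" "frac_rep g (frac g v M) = (v', M')"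
    by (rule frac_rep[OF v])
  obtain K :: nat where K: "g [^] (K + N') \<otimes> u = g [^] (K + N) \<otimes> u'"
    using u'(2) unfolding frac_eq_iff[OF g u u'(1)] frac_eq_def by auto
  obtain L :: nat where L: "g [^] (L + M') \<otimes> v = g [^] (L + M) \<otimes> v'"
    using v'(2) unfolding frac_eq_iff[OF g v v'(1)] frac_eq_def by auto
  have sw: "(g [^] (A::nat) \<otimes> a) \<otimes> (g [^] (B::nat) \<otimes> b) = g [^] (A + B) \<otimes> (a \<otimes> b)"
    if "a \<in> carrier R" "b \<in> carrier R" for a b A B
    using that g by (simp add: nat_pow_mult[symmetric] m_ac)
  have "g [^] (K + N' + (L + M')) \<otimes> (u \<otimes> v) = (g [^] (K + N') \<otimes> u) \<otimes> (g [^] (L + M') \<otimes> v)"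
    using sw[OF u v] by simp
  also have "\<dots> = g [^] (K + N + (L + M)) \<otimes> (u' \<otimes> v')"
    unfolding K L by (rule sw[OF u'(1) v'(1)])
  finally have "g [^] (K + L + (N' + M')) \<otimes> (u \<otimes> v) = g [^] (K + L + (N + M)) \<otimes> (u' \<otimes> v')"
    by (simp add: add_ac)
  then have "frac g (u \<otimes> v) (N + M) = frac g (u' \<otimes> v') (N' + M')"
    using frac_eq_iff[of g "u \<otimes> v" "u' \<otimes> v'"] g u v u'(1) v'(1) unfolding frac_eq_def by auto
  then show ?thesis unfolding localisation_def by (simp add: u'(3) v'(3))
qed

lemma localisation_add:
  assumes g: "g \<in> carrier R" and u: "u \<in> carrier R" and v: "v \<in> carrier R"
  shows "frac g u N \<oplus>\<^bsub>localisation g\<^esub> frac g v M = frac g (g [^] M \<otimes> u \<oplus> g [^] N \<otimes> v) (N + M)"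
proof -
  obtain u' N' where u': "u' \<in> carrier R" "frac g u N = frac g u' N'" "frac_rep g (frac g u N) = (u', N')"
    by (rule frac_rep[OF u])
  obtain v' M' where v': "v' \<in> carrier R" "frac g v M = frac g v' M'" "frac_rep g (frac g v M) = (v', M')"
    by (rule frac_rep[OF v])
  obtain K :: nat where K: "g [^] (K + N') \<otimes> u = g [^] (K + N) \<otimes> u'"
    using u'(2) unfolding frac_eq_iff[OF g u u'(1)] frac_eq_def by auto
  obtain L :: nat where L: "g [^] (L + M') \<otimes> v = g [^] (L + M) \<otimes> v'"
    using v'(2) unfolding frac_eq_iff[OF g v v'(1)] frac_eq_def by auto
  have "g [^] (K + L + (N' + M')) \<otimes> (g [^] M \<otimes> u) = g [^] (L + M' + M) \<otimes> (g [^] (K + N') \<otimes> u)"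
    using g u by (simp add: pow_pow_mult add_ac)
  also have "\<dots> = g [^] (K + L + (N + M)) \<otimes> (g [^] M' \<otimes> u')"
    unfolding K using g u'(1) by (simp add: pow_pow_mult add_ac)
  finally have 1: "g [^] (K + L + (N' + M')) \<otimes> (g [^] M \<otimes> u) = g [^] (K + L + (N + M)) \<otimes> (g [^] M' \<otimes> u')" .
  have "g [^] (K + L + (N' + M')) \<otimes> (g [^] N \<otimes> v) = g [^] (K + N' + N) \<otimes> (g [^] (L + M') \<otimes> v)"
    using g v by (simp add: pow_pow_mult add_ac)
  also have "\<dots> = g [^] (K + L + (N + M)) \<otimes> (g [^] N' \<otimes> v')"
    unfolding L using g v'(1) by (simp add: pow_pow_mult add_ac)
  finally have 2: "g [^] (K + L + (N' + M')) \<otimes> (g [^] N \<otimes> v) = g [^] (K + L + (N + M)) \<otimes> (g [^] N' \<otimes> v')" .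
  have "g [^] (K + L + (N' + M')) \<otimes> (g [^] M \<otimes> u \<oplus> g [^] N \<otimes> v)
     = g [^] (K + L + (N + M)) \<otimes> (g [^] M' \<otimes> u' \<oplus> g [^] N' \<otimes> v')"
    using g u v u'(1) v'(1) by (simp add: r_distr 1 2)
  then have "frac g (g [^] M \<otimes> u \<oplus> g [^] N \<otimes> v) (N + M) = frac g (g [^] M' \<otimes> u' \<oplus> g [^] N' \<otimes> v') (N' + M')"
    using frac_eq_iff[of g "g [^] M \<otimes> u \<oplus> g [^] N \<otimes> v" "g [^] M' \<otimes> u' \<oplus> g [^] N' \<otimes> v'"] g u v u'(1) v'(1)
    unfolding frac_eq_def by auto
  then show ?thesis unfolding localisation_def by (simp add: u'(3) v'(3))
qed

lemma localisation_cring: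
  assumes g: "g \<in> carrier R"
  shows "cring (localisation g)"
proof -
  let ?L = "localisation g"
  note [simp] = localisation_mult[OF g] localisation_add[OF g] localisation_one localisation_zero
    localisation_carrier
  note pw = nat_pow_mult[OF g, symmetric]
  show ?thesis
  proof (rule cringI)
    show "abelian_group ?L"
    proof (rule abelian_groupI)
      fix Y Z assume "Y \<in> carrier ?L" "Z \<in> carrier ?L"
      then obtain u N v M where *: "u \<in> carrier R" "Y = frac g u N" "v \<in> carrier R" "Z = frac g v M"
        by (elim localisation_carrierE)
      show "Y \<oplus>\<^bsub>?L\<^esub> Z \<in> carrier ?L" using * g by simp
      show "Y \<oplus>\<^bsub>?L\<^esub> Z = Z \<oplus>\<^bsub>?L\<^esub> Y" using * g by (simp add: a_comm add.commute)
      fix W assume "W \<in> carrier ?L"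
      then obtain w L where w: "w \<in> carrier R" "W = frac g w L" by (rule localisation_carrierE)
      have c: "g [^] N \<in> carrier R" "g [^] M \<in> carrier R" "g [^] L \<in> carrier R" using g by auto
      have "(g [^] L \<otimes> (g [^] M \<otimes> u \<oplus> g [^] N \<otimes> v)) \<oplus> (g [^] N \<otimes> g [^] M) \<otimes> w
         = (g [^] M \<otimes> g [^] L) \<otimes> u \<oplus> g [^] N \<otimes> (g [^] L \<otimes> v \<oplus> g [^] M \<otimes> w)"
        using c *(1,3) w(1) by algebra
      then show "Y \<oplus>\<^bsub>?L\<^esub> Z \<oplus>\<^bsub>?L\<^esub> W = Y \<oplus>\<^bsub>?L\<^esub> (Z \<oplus>\<^bsub>?L\<^esub> W)" using * w g by (simp add: pw add.assoc)
    next
      fix Y assume "Y \<in> carrier ?L"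
      then obtain u N where *: "u \<in> carrier R" "Y = frac g u N" by (rule localisation_carrierE)
      show "\<zero>\<^bsub>?L\<^esub> \<oplus>\<^bsub>?L\<^esub> Y = Y" using * g by simp
      have "g [^] N \<otimes> (\<ominus> u) \<oplus> g [^] N \<otimes> u = \<zero>" using *(1) g by (simp add: r_minus l_neg)
      then have "frac g (g [^] N \<otimes> (\<ominus> u) \<oplus> g [^] N \<otimes> u) (N + N) = frac g \<zero> 0"
        using g by (intro frac_eqI) auto
      then have "frac g (\<ominus> u) N \<oplus>\<^bsub>?L\<^esub> Y = \<zero>\<^bsub>?L\<^esub>" using * g by simp
      then show "\<exists>Z\<in>carrier ?L. Z \<oplus>\<^bsub>?L\<^esub> Y = \<zero>\<^bsub>?L\<^esub>" using * by (intro bexI[of _ "frac g (\<ominus> u) N"]) auto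
    qed simp
    show "comm_monoid ?L"
    proof (rule comm_monoidI)
      fix Y Z W assume "Y \<in> carrier ?L" "Z \<in> carrier ?L" "W \<in> carrier ?L"
      then show "Y \<otimes>\<^bsub>?L\<^esub> Z \<otimes>\<^bsub>?L\<^esub> W = Y \<otimes>\<^bsub>?L\<^esub> (Z \<otimes>\<^bsub>?L\<^esub> W)"
        by (elim localisation_carrierE) (simp add: m_assoc add.assoc)
    next
      fix Y Z assume "Y \<in> carrier ?L" "Z \<in> carrier ?L"
      then show "Y \<otimes>\<^bsub>?L\<^esub> Z = Z \<otimes>\<^bsub>?L\<^esub> Y" "Y \<otimes>\<^bsub>?L\<^esub> Z \<in> carrier ?L"
        by (elim localisation_carrierE, simp add: m_comm add.commute)+
    next
      fix Y assume "Y \<in> carrier ?L"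
      then show "\<one>\<^bsub>?L\<^esub> \<otimes>\<^bsub>?L\<^esub> Y = Y" by (elim localisation_carrierE) simp
    qed simp
    fix Y Z W assume "Y \<in> carrier ?L" "Z \<in> carrier ?L" "W \<in> carrier ?L"
    then obtain u N v M w L where *: "u \<in> carrier R" "v \<in> carrier R" "w \<in> carrier R"
      "Y = frac g u N" "Z = frac g v M" "W = frac g w L" by (elim localisation_carrierE)
    have c: "g [^] N \<in> carrier R" "g [^] M \<in> carrier R" "g [^] L \<in> carrier R" using g by auto
    have "((g [^] N \<otimes> g [^] L) \<otimes> (g [^] M \<otimes> g [^] L)) \<otimes> ((g [^] M \<otimes> u \<oplus> g [^] N \<otimes> v) \<otimes> w)
       = ((g [^] N \<otimes> g [^] M) \<otimes> g [^] L) \<otimes> ((g [^] M \<otimes> g [^] L) \<otimes> (u \<otimes> w) \<oplus> (g [^] N \<otimes> g [^] L) \<otimes> (v \<otimes> w))"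
      using c *(1-3) by algebra
    then have "frac g ((g [^] M \<otimes> u \<oplus> g [^] N \<otimes> v) \<otimes> w) (N + M + L)
      = frac g (g [^] (M + L) \<otimes> (u \<otimes> w) \<oplus> g [^] (N + L) \<otimes> (v \<otimes> w)) (N + L + (M + L))"
      using g *(1-3) by (intro frac_eqI) (auto simp: pw)
    then show "(Y \<oplus>\<^bsub>?L\<^esub> Z) \<otimes>\<^bsub>?L\<^esub> W = Y \<otimes>\<^bsub>?L\<^esub> W \<oplus>\<^bsub>?L\<^esub> Z \<otimes>\<^bsub>?L\<^esub> W"
      using * g by simp
  qed
qed

lemma localisation_hom:
  assumes "g \<in> carrier R"
  shows "(\<lambda>u. frac g u 0) \<in> ring_hom R (localisation g)"
  by (rule ring_hom_memI)
    (simp_all add: localisation_mult[OF assms] localisation_add[OF assms] localisation_one localisation_carrier)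

text \<open>
  Membership in an extended ideal of \<open>R\<^sub>g\<close> is membership in \<open>R\<close> up to a power of \<open>g\<close>: the
  fractions with numerator in \<open>Idl Y\<close> form an ideal.
\<close>

lemma localisation_Idl:
  assumes g: "g \<in> carrier R" and Y: "Y \<subseteq> carrier R" and u: "u \<in> carrier R"
  shows "frac g u N \<in> Idl\<^bsub>localisation g\<^esub> ((\<lambda>u. frac g u 0) ` Y) \<longleftrightarrow> (\<exists>K::nat. g [^] K \<otimes> u \<in> Idl Y)"
proof
  let ?L = "localisation g"
  let ?i = "\<lambda>u. frac g u 0"
  interpret L: cring ?L by (rule localisation_cring[OF g])
  note [simp] = localisation_mult[OF g] localisation_add[OF g] localisation_carrier
  have I: "ideal (Idl Y) R" by (rule genideal_ideal[OF Y])
  have Ic: "Idl Y \<subseteq> carrier R" by (rule ideal_subset[OF I])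
  have iY: "?i ` Y \<subseteq> carrier ?L" using Y by auto
  {
    let ?D = "{frac g u N | u N. u \<in> Idl Y}"
    have "ideal ?D ?L"
    proof (rule L.ideal_closedI)
      show "?D \<subseteq> carrier ?L" using Ic by auto
      show "\<zero>\<^bsub>?L\<^esub> \<in> ?D" using ideal_zero[OF I] unfolding localisation_zero by blast
    next
      fix W Z assume "W \<in> ?D" "Z \<in> ?D"
      then obtain u N v M where *: "u \<in> Idl Y" "v \<in> Idl Y" "W = frac g u N" "Z = frac g v M" by blast
      have "W \<oplus>\<^bsub>?L\<^esub> Z = frac g (g [^] M \<otimes> u \<oplus> g [^] N \<otimes> v) (N + M)"
        unfolding *(3,4) by (rule localisation_add[OF g]) (use *(1,2) Ic in auto)
      moreover have "g [^] M \<otimes> u \<oplus> g [^] N \<otimes> v \<in> Idl Y"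
        using *(1,2) g by (intro ideal_add[OF I] ideal_mult[OF I]) auto
      ultimately show "W \<oplus>\<^bsub>?L\<^esub> Z \<in> ?D" by blast
    next
      fix W Z assume "W \<in> carrier ?L" "Z \<in> ?D"
      then obtain u N v M where *: "u \<in> carrier R" "v \<in> Idl Y" "W = frac g u N" "Z = frac g v M"
        by (auto elim: localisation_carrierE)
      have "W \<otimes>\<^bsub>?L\<^esub> Z = frac g (u \<otimes> v) (N + M)"
        unfolding *(3,4) by (rule localisation_mult[OF g]) (use *(1,2) Ic in auto)
      moreover have "u \<otimes> v \<in> Idl Y" using * ideal_mult[OF I] by simp
      ultimately show "W \<otimes>\<^bsub>?L\<^esub> Z \<in> ?D" by blast
    qed
    then have "Idl\<^bsub>?L\<^esub> (?i ` Y) \<subseteq> ?D"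
      by (rule L.genideal_minimal) (use genideal_self[OF Y] in blast)
    moreover assume "frac g u N \<in> Idl\<^bsub>?L\<^esub> (?i ` Y)"
    ultimately obtain v M where v: "v \<in> Idl Y" "frac g u N = frac g v M" by blast
    have vc: "v \<in> carrier R" using v(1) Ic by blast
    obtain K :: nat where "g [^] (K + M) \<otimes> u = g [^] (K + N) \<otimes> v"
      using v(2) unfolding frac_eq_iff[OF g u vc] frac_eq_def by auto
    then have "g [^] (K + M) \<otimes> u \<in> Idl Y" using ideal_mult[OF I v(1)] g by simp
    then show "\<exists>K::nat. g [^] K \<otimes> u \<in> Idl Y" by blast
  }
  assume "\<exists>K::nat. g [^] K \<otimes> u \<in> Idl Y"
  then obtain K :: nat where K: "g [^] K \<otimes> u \<in> Idl Y" by blast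
  have "?i (g [^] K \<otimes> u) \<in> Idl\<^bsub>?L\<^esub> (?i ` Y)"
    by (rule hom_Idl[OF is_cring L.is_cring localisation_hom[OF g] Y K])
  then have "frac g \<one> (K + N) \<otimes>\<^bsub>?L\<^esub> ?i (g [^] K \<otimes> u) \<in> Idl\<^bsub>?L\<^esub> (?i ` Y)"
    by (rule L.ideal_mult[OF L.genideal_ideal[OF iY]]) simp
  moreover have "frac g \<one> (K + N) \<otimes>\<^bsub>?L\<^esub> ?i (g [^] K \<otimes> u) = frac g (g [^] K \<otimes> u) (K + N)"
    using g u by simp
  moreover have "\<dots> = frac g u N"
    using g u by (intro frac_eqI) (auto simp: pow_pow_mult add.commute)
  ultimately show "frac g u N \<in> Idl\<^bsub>?L\<^esub> (?i ` Y)" by simp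
qed

end

section \<open>Small subalgebras\<close>

text \<open>
  Closing a set under countably many finitary operations does not enlarge its cardinality beyond
  that of an infinite type: the closure is a countable union of stages, each the image of a set
  of finite lists.
\<close>

lemma closure_lepoll:
  fixes F :: "nat \<Rightarrow> 'c list \<Rightarrow> 'c"
  assumes inf: "infinite (UNIV :: 'v set)" and A0: "A0 \<lesssim> (UNIV :: 'v set)"
  obtains A where "A0 \<subseteq> A" "\<And>n l. set l \<subseteq> A \<Longrightarrow> F n l \<in> A" "A \<lesssim> (UNIV :: 'v set)"
proof -
  define C where "C = rec_nat A0 (\<lambda>_ A. A \<union> (\<lambda>p. F (fst p) (snd p)) ` (UNIV \<times> lists A))"
  have C0: "C 0 = A0" and CS: "\<And>n. C (Suc n) = C n \<union> (\<lambda>p. F (fst p) (snd p)) ` (UNIV \<times> lists (C n))"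
    unfolding C_def by simp_all
  let ?V = "card_of (UNIV :: 'v set)"
  have nat: "ordLeq3 (card_of (UNIV :: nat set)) ?V" using inf by (simp add: infinite_iff_card_of_nat)
  have card: "ordLeq3 (card_of (C n)) ?V" for n
  proof (induction n)
    case 0
    then show ?case using A0 unfolding C0 lepoll_def card_of_ordLeq[symmetric] by blast
  next
    case (Suc n)
    have "ordLeq3 (card_of (lists (C n))) (card_of (lists (UNIV :: 'v set)))"
      by (rule card_of_lists_mono[OF Suc])
    then have "ordLeq3 (card_of (lists (C n))) ?V"
      using card_of_lists_infinite[OF inf] ordLeq_ordIso_trans by blast
    then have "ordLeq3 (card_of ((UNIV :: nat set) \<times> lists (C n))) ?V"
      by (rule card_of_Times_ordLeq_infinite[OF inf nat])
    then have "ordLeq3 (card_of ((\<lambda>p. F (fst p) (snd p)) ` (UNIV \<times> lists (C n)))) ?V"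
      using card_of_image ordLeq_transitive by blast
    then show ?case unfolding CS by (rule card_of_Un_ordLeq_infinite[OF inf Suc])
  qed
  have "ordLeq3 (card_of (\<Union>n. C n)) ?V"
    by (rule card_of_UNION_ordLeq_infinite[OF inf nat]) (use card in blast)
  then have "(\<Union>n. C n) \<lesssim> (UNIV :: 'v set)" unfolding lepoll_def card_of_ordLeq[symmetric] by blast
  moreover have "A0 \<subseteq> (\<Union>n. C n)" using C0 by blast
  moreover have "F n l \<in> (\<Union>n. C n)" if l: "set l \<subseteq> (\<Union>n. C n)" for n l
  proof -
    have mono: "C i \<subseteq> C j" if "i \<le> j" for i j
      by (rule lift_Suc_mono_le[OF _ that]) (simp add: CS)
    have "\<exists>k. set l \<subseteq> C k" using l
    proof (induction l)
      case (Cons a l)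
      then obtain i k where "a \<in> C i" "set l \<subseteq> C k" by auto
      then have "set (a # l) \<subseteq> C (max i k)" using mono[of i "max i k"] mono[of k "max i k"] by auto
      then show ?case by blast
    qed simp
    then obtain k where "set l \<subseteq> C k" by blast
    then have "(n, l) \<in> UNIV \<times> lists (C k)" by (simp add: in_lists_conv_set subset_iff)
    then have "F (fst (n, l)) (snd (n, l)) \<in> (\<lambda>p. F (fst p) (snd p)) ` (UNIV \<times> lists (C k))"
      by (rule imageI)
    then have "F n l \<in> C (Suc k)" unfolding CS by simp
    then show ?thesis by blast
  qed
  ultimately show ?thesis using that[of "\<Union>n. C n"] by simp
qed

context cring
begin

fun lincomb :: "'a list \<Rightarrow> 'a list \<Rightarrow> 'a"
  where "lincomb (w # ws) (c # cs) = lincomb ws cs \<oplus> c \<otimes> w"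
  | "lincomb _ _ = \<zero>"

lemma Idl_list:
  "set ws \<subseteq> carrier R \<Longrightarrow>
    Idl (set ws) = {lincomb ws cs | cs. length cs = length ws \<and> set cs \<subseteq> carrier R}"
proof (induction ws)
  case Nil
  then show ?case by (simp add: Idl_empty)
next
  case (Cons w ws)
  have c: "set ws \<subseteq> carrier R" "w \<in> carrier R" using Cons.prems by auto
  have "Idl (set (w # ws)) = {i \<oplus> r \<otimes> w | i r. i \<in> Idl (set ws) \<and> r \<in> carrier R}"
    using Idl_insert[OF c] by simp
  also have "\<dots> = {lincomb (w # ws) cs | cs. length cs = length (w # ws) \<and> set cs \<subseteq> carrier R}"
    (is "?L = ?R")
  proof
    show "?L \<subseteq> ?R"
    proof
      fix x assume "x \<in> ?L"
      then obtain cs r where "x = lincomb ws cs \<oplus> r \<otimes> w" "length cs = length ws" "set cs \<subseteq> carrier R"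
        "r \<in> carrier R" unfolding Cons.IH[OF c(1)] by blast
      then show "x \<in> ?R" by (intro CollectI exI[of _ "r # cs"]) simp
    qed
    show "?R \<subseteq> ?L"
    proof
      fix x assume "x \<in> ?R"
      then obtain cs where cs: "x = lincomb (w # ws) cs" "length cs = length (w # ws)" "set cs \<subseteq> carrier R"
        by blast
      then obtain r cs' where "cs = r # cs'" by (cases cs) auto
      then show "x \<in> ?L" using cs unfolding Cons.IH[OF c(1)] by auto
    qed
  qed
  finally show ?case .
qed

text \<open>
  A Skolem function for membership in finitely generated ideals. A subring \<open>A\<close> that is closed under it
  satisfies \<open>I R \<inter> A = I\<close> for each of its finitely generated ideals \<open>I\<close>.
\<close>

definition coefficients :: "'a \<Rightarrow> 'a list \<Rightarrow> 'a list"
  where "coefficients u ws = (SOME cs. length cs = length ws \<and> set cs \<subseteq> carrier R \<and> u = lincomb ws cs)"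

lemma coefficients:
  assumes "set ws \<subseteq> carrier R" "u \<in> Idl (set ws)"
  shows "length (coefficients u ws) = length ws \<and> set (coefficients u ws) \<subseteq> carrier R \<and>
    u = lincomb ws (coefficients u ws)"
proof -
  have "\<exists>cs. length cs = length ws \<and> set cs \<subseteq> carrier R \<and> u = lincomb ws cs"
    using assms(2) unfolding Idl_list[OF assms(1)] by blast
  then show ?thesis unfolding coefficients_def by (rule someI_ex)
qed

text \<open>
  All ring operations and all coefficient functions, packed into one family of operations on
  lists for \<open>closure_lepoll\<close>. For \<open>n \<ge> 4\<close> the list holds an element followed by generators of an
  ideal, and the value is the coefficient with index \<open>n - 4\<close>. The default \<open>\<one>\<close> keeps values in
  the carrier when the arguments are out of range.
\<close>

definition ring_op :: "nat \<Rightarrow> 'a list \<Rightarrow> 'a"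
  where "ring_op n l = (let v = (if n = 0 then \<one> else if n = 1 then l ! 0 \<oplus> l ! 1
      else if n = 2 then l ! 0 \<otimes> l ! 1 else if n = 3 then \<ominus> (l ! 0)
      else coefficients (hd l) (tl l) ! (n - 4)) in if v \<in> carrier R then v else \<one>)"

lemma small_subring:
  assumes inf: "infinite (UNIV :: 'v set)" and H: "H \<subseteq> carrier R" "H \<lesssim> (UNIV :: 'v set)"
  obtains A where "H \<subseteq> A" "A \<subseteq> carrier R" "A \<lesssim> (UNIV :: 'v set)" "\<one> \<in> A"
    "\<And>a b. a \<in> A \<Longrightarrow> b \<in> A \<Longrightarrow> a \<oplus> b \<in> A" "\<And>a b. a \<in> A \<Longrightarrow> b \<in> A \<Longrightarrow> a \<otimes> b \<in> A"
    "\<And>a. a \<in> A \<Longrightarrow> \<ominus> a \<in> A"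
    "\<And>u ws. u \<in> A \<Longrightarrow> set ws \<subseteq> A \<Longrightarrow> u \<in> Idl (set ws) \<Longrightarrow>
      \<exists>cs. length cs = length ws \<and> set cs \<subseteq> A \<and> u = lincomb ws cs"
proof -
  obtain A' where A': "H \<subseteq> A'" "\<And>n l. set l \<subseteq> A' \<Longrightarrow> ring_op n l \<in> A'" "A' \<lesssim> (UNIV :: 'v set)"
    using closure_lepoll[OF inf H(2), of ring_op] by blast
  let ?A = "A' \<inter> carrier R"
  have opc: "ring_op n l \<in> ?A" if "set l \<subseteq> A'" for n l
    using A'(2)[OF that] unfolding ring_op_def Let_def by auto
  show ?thesis
  proof (rule that[of ?A])
    show "H \<subseteq> ?A" using A'(1) H(1) by blast
    show "?A \<lesssim> (UNIV :: 'v set)" using A'(3) lepoll_trans[OF subset_imp_lepoll[of ?A A']] by blast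
    show "\<one> \<in> ?A" using opc[of "[]" 0] by (simp add: ring_op_def Let_def)
    fix a b assume a: "a \<in> ?A"
    show "\<ominus> a \<in> ?A" using opc[of "[a]" 3] a by (simp add: ring_op_def Let_def)
    assume b: "b \<in> ?A"
    show "a \<oplus> b \<in> ?A" using opc[of "[a, b]" 1] a b by (simp add: ring_op_def Let_def)
    show "a \<otimes> b \<in> ?A" using opc[of "[a, b]" 2] a b by (simp add: ring_op_def Let_def)
  next
    fix u ws assume u: "u \<in> ?A" "set ws \<subseteq> ?A" "u \<in> Idl (set ws)"
    let ?cs = "coefficients u ws"
    have cs: "length ?cs = length ws" "set ?cs \<subseteq> carrier R" "u = lincomb ws ?cs"
      using coefficients[of ws u] u by auto
    have "?cs ! i \<in> ?A" if i: "i < length ?cs" for i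
    proof -
      have "?cs ! i \<in> carrier R" using cs(2) i by auto
      then have "ring_op (i + 4) (u # ws) = ?cs ! i" by (simp add: ring_op_def Let_def)
      then show ?thesis using opc[of "u # ws" "i + 4"] u by simp
    qed
    then have "set ?cs \<subseteq> ?A" by (auto simp: in_set_conv_nth)
    then show "\<exists>cs. length cs = length ws \<and> set cs \<subseteq> ?A \<and> u = lincomb ws cs" using cs by blast
  qed simp
qed

end

section \<open>Algebras\<close>

lemma algebra_cring: "algebra R S \<Longrightarrow> cring S"
  and algebra_base_cring: "algebra R S \<Longrightarrow> cring R"
  by (simp_all add: algebra.M_cring algebra.R_cring)

text \<open>
  An algebra over \<open>R\<close> amounts to a commutative ring with a homomorphism from \<open>R\<close>; this is the
  homomorphism. The constructions below are carried out for rings and become algebras through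
  it.
\<close>

definition structure_map :: "('a, 'b, 'l) module_scheme \<Rightarrow> 'a \<Rightarrow> 'b"
  where "structure_map S r = r \<odot>\<^bsub>S\<^esub> \<one>\<^bsub>S\<^esub>"

lemma structure_map_hom:
  assumes "algebra R S"
  shows "structure_map S \<in> ring_hom R S"
proof -
  interpret algebra R S by fact
  interpret S: cring S by (rule M_cring)
  show ?thesis
  proof (rule ring_hom_memI)
    fix x y assume "x \<in> carrier R" "y \<in> carrier R"
    then show "structure_map S (x \<otimes>\<^bsub>R\<^esub> y) = structure_map S x \<otimes>\<^bsub>S\<^esub> structure_map S y"
      by (simp add: structure_map_def smult_assoc1 smult_assoc2)
  qed (auto simp: structure_map_def smult_l_distr)
qed

lemma smult_structure_map:
  assumes "algebra R S" "r \<in> carrier R" "s \<in> carrier S"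
  shows "r \<odot>\<^bsub>S\<^esub> s = structure_map S r \<otimes>\<^bsub>S\<^esub> s"
proof -
  interpret algebra R S by fact
  interpret S: cring S by (rule M_cring)
  show ?thesis using assms(2,3) by (simp add: structure_map_def smult_assoc2)
qed

lemma extended_ideal_eq: "extended_ideal S A = Idl\<^bsub>S\<^esub> (structure_map S ` A)"
  unfolding extended_ideal_def structure_map_def ..

lemma algebra_homI:
  assumes "algebra R S" "algebra R T" "h \<in> ring_hom S T"
    and "\<And>r. r \<in> carrier R \<Longrightarrow> h (structure_map S r) = structure_map T r"
  shows "h \<in> algebra_hom R S T"
proof -
  have "h (r \<odot>\<^bsub>S\<^esub> s) = r \<odot>\<^bsub>T\<^esub> h s" if "r \<in> carrier R" "s \<in> carrier S" for r s
    using that assms ring_hom_closed[OF structure_map_hom[OF assms(1)]] ring_hom_closed[OF assms(3)]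
    by (simp add: smult_structure_map ring_hom_mult[OF assms(3)])
  then show ?thesis using assms(3) unfolding algebra_hom_def by blast
qed

lemma algebra_homD:
  assumes "algebra R S" "algebra R T" "h \<in> algebra_hom R S T"
  shows "h \<in> ring_hom S T" and "\<And>r. r \<in> carrier R \<Longrightarrow> h (structure_map S r) = structure_map T r"
proof -
  interpret S: cring S by (rule algebra_cring[OF assms(1)])
  show h: "h \<in> ring_hom S T" using assms(3) unfolding algebra_hom_def by blast
  show "h (structure_map S r) = structure_map T r" if "r \<in> carrier R" for r
    using assms(3) that ring_hom_one[OF h] unfolding algebra_hom_def structure_map_def by simp
qed

text \<open>
  The homomorphism \<open>h\<close> makes \<open>A\<close> an \<open>R\<close>-algebra through \<open>S\<close>. The subalgebra generated by the
  image of \<open>S\<close> and a choice of coefficients embeds into the type \<open>'v\<close>; its ring structure is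
  transported along this embedding, and \<open>k\<close> is the inclusion of the result into \<open>A\<close>. By the last
  property, statements about ideals generated by finitely many elements of \<open>R\<close>, such as
  triviality of a colon ideal, descend from \<open>A\<close> to \<open>T\<close>.
\<close>

theorem small_algebra:
  fixes A :: "('c, 'e) ring_scheme" and S :: "('a, 'b, 'l) module_scheme"
  assumes A: "cring A" and S: "algebra R S" and h: "h \<in> ring_hom S A"
    and inf: "infinite (UNIV :: 'v set)" and card: "carrier S \<lesssim> (UNIV :: 'v set)"
  obtains T :: "('a, 'v) module" and k f where
    "algebra R T" "f \<in> algebra_hom R S T" "k \<in> ring_hom T A"
    "\<forall>r\<in>carrier R. k (structure_map T r) = h (structure_map S r)"
    "\<forall>Y u. finite Y \<longrightarrow> Y \<subseteq> carrier R \<longrightarrow> u \<in> carrier T \<longrightarrow>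
      k u \<in> Idl\<^bsub>A\<^esub> ((\<lambda>r. h (structure_map S r)) ` Y) \<longrightarrow> u \<in> extended_ideal T Y"
proof -
  interpret A: cring A by fact
  interpret S: cring S by (rule algebra_cring[OF S])
  interpret R: cring R by (rule algebra_base_cring[OF S])
  note hc = ring_hom_closed[OF h]
  note sm = structure_map_hom[OF S]
  note smc = ring_hom_closed[OF sm]
  have H: "h ` carrier S \<subseteq> carrier A" using hc by blast
  have Hcard: "h ` carrier S \<lesssim> (UNIV :: 'v set)" using card image_lepoll lepoll_trans by blast
  obtain C where C: "h ` carrier S \<subseteq> C" "C \<subseteq> carrier A" "C \<lesssim> (UNIV :: 'v set)" "\<one>\<^bsub>A\<^esub> \<in> C"
    "\<And>a b. a \<in> C \<Longrightarrow> b \<in> C \<Longrightarrow> a \<oplus>\<^bsub>A\<^esub> b \<in> C" "\<And>a b. a \<in> C \<Longrightarrow> b \<in> C \<Longrightarrow> a \<otimes>\<^bsub>A\<^esub> b \<in> C"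
    "\<And>a. a \<in> C \<Longrightarrow> \<ominus>\<^bsub>A\<^esub> a \<in> C"
    and coeff: "\<And>u ws. u \<in> C \<Longrightarrow> set ws \<subseteq> C \<Longrightarrow> u \<in> Idl\<^bsub>A\<^esub> (set ws) \<Longrightarrow>
      \<exists>cs. length cs = length ws \<and> set cs \<subseteq> C \<and> u = A.lincomb ws cs"
    using A.small_subring[OF inf H Hcard] by blast
  have Cc: "a \<in> carrier A" if "a \<in> C" for a using that C(2) by blast
  obtain g :: "_ \<Rightarrow> 'v" where g: "inj_on g C" using C(3) unfolding lepoll_def by blast
  define k where "k = inv_into C g"
  have kg: "k (g a) = a" if "a \<in> C" for a unfolding k_def by (rule inv_into_f_f[OF g that])
  have "\<one>\<^bsub>A\<^esub> \<oplus>\<^bsub>A\<^esub> \<ominus>\<^bsub>A\<^esub> \<one>\<^bsub>A\<^esub> \<in> C" using C(4,5,7) by blast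
  then have C0: "\<zero>\<^bsub>A\<^esub> \<in> C" by (simp add: A.r_neg)
  have hC: "h s \<in> C" if "s \<in> carrier S" for s using C(1) that by blast
  define T :: "('a, 'v) module" where "T = \<lparr>carrier = g ` C,
    monoid.mult = (\<lambda>a b. g (k a \<otimes>\<^bsub>A\<^esub> k b)), monoid.one = g \<one>\<^bsub>A\<^esub>, ring.zero = g \<zero>\<^bsub>A\<^esub>,
    ring.add = (\<lambda>a b. g (k a \<oplus>\<^bsub>A\<^esub> k b)), smult = (\<lambda>r a. g (h (structure_map S r) \<otimes>\<^bsub>A\<^esub> k a))\<rparr>"
  have Tsimps: "carrier T = g ` C" "a \<otimes>\<^bsub>T\<^esub> b = g (k a \<otimes>\<^bsub>A\<^esub> k b)" "\<one>\<^bsub>T\<^esub> = g \<one>\<^bsub>A\<^esub>" "\<zero>\<^bsub>T\<^esub> = g \<zero>\<^bsub>A\<^esub>"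
    "a \<oplus>\<^bsub>T\<^esub> b = g (k a \<oplus>\<^bsub>A\<^esub> k b)" "r \<odot>\<^bsub>T\<^esub> a = g (h (structure_map S r) \<otimes>\<^bsub>A\<^esub> k a)" for a b r
    unfolding T_def by simp_all
  have Tcring: "cring T"
  proof (rule cringI)
    show "abelian_group T"
    proof (rule abelian_groupI)
      fix x assume "x \<in> carrier T"
      then obtain a where a: "a \<in> C" "x = g a" unfolding Tsimps by blast
      have "g (\<ominus>\<^bsub>A\<^esub> a) \<oplus>\<^bsub>T\<^esub> x = \<zero>\<^bsub>T\<^esub>" using a C(7) Cc by (simp add: Tsimps kg A.l_neg)
      then show "\<exists>y\<in>carrier T. y \<oplus>\<^bsub>T\<^esub> x = \<zero>\<^bsub>T\<^esub>" using a C(7) unfolding Tsimps(1) by blast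
    qed (auto simp: Tsimps kg C Cc C0 A.a_ac)
    show "comm_monoid T" by (rule comm_monoidI) (auto simp: Tsimps kg C Cc A.m_ac)
  qed (auto simp: Tsimps kg C Cc A.l_distr)
  have smC: "h (structure_map S r) \<in> C" if "r \<in> carrier R" for r using hC smc that by blast
  have Talg: "algebra R T"
  proof (rule algebraI[OF R.is_cring Tcring])
    fix a b x assume ab: "a \<in> carrier R" "b \<in> carrier R" "x \<in> carrier T"
    show "(a \<oplus>\<^bsub>R\<^esub> b) \<odot>\<^bsub>T\<^esub> x = a \<odot>\<^bsub>T\<^esub> x \<oplus>\<^bsub>T\<^esub> b \<odot>\<^bsub>T\<^esub> x"
      using ab smC smc Cc C by (auto simp: Tsimps kg ring_hom_add[OF sm] ring_hom_add[OF h] A.l_distr)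
    show "(a \<otimes>\<^bsub>R\<^esub> b) \<odot>\<^bsub>T\<^esub> x = a \<odot>\<^bsub>T\<^esub> (b \<odot>\<^bsub>T\<^esub> x)"
      using ab smC smc Cc C by (auto simp: Tsimps kg ring_hom_mult[OF sm] ring_hom_mult[OF h] A.m_assoc)
  next
    fix x assume "x \<in> carrier T"
    then show "\<one>\<^bsub>R\<^esub> \<odot>\<^bsub>T\<^esub> x = x"
      using Cc by (auto simp: Tsimps kg ring_hom_one[OF sm] ring_hom_one[OF h])
  qed (use smC Cc C in \<open>auto simp: Tsimps kg A.r_distr A.m_assoc\<close>)
  have kT: "k \<in> ring_hom T A"
    by (rule ring_hom_memI) (auto simp: Tsimps kg C Cc)
  have ksm: "k (structure_map T r) = h (structure_map S r)" if "r \<in> carrier R" for r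
    using that smC C Cc by (simp add: structure_map_def[of T] Tsimps kg)
  have fT: "(\<lambda>s. g (h s)) \<in> ring_hom S T"
    by (rule ring_hom_memI)
      (auto simp: Tsimps kg hC ring_hom_mult[OF h] ring_hom_add[OF h] ring_hom_one[OF h])
  have gsm: "g (h (structure_map S r)) = structure_map T r" if "r \<in> carrier R" for r
    using that smC C Cc by (simp add: structure_map_def[of T] Tsimps kg)
  have f: "(\<lambda>s. g (h s)) \<in> algebra_hom R S T"
    by (rule algebra_homI[OF S Talg fT gsm])
  have fin: "u \<in> extended_ideal T Y" if Y: "finite Y" "Y \<subseteq> carrier R" and u: "u \<in> carrier T"
    and ku: "k u \<in> Idl\<^bsub>A\<^esub> ((\<lambda>r. h (structure_map S r)) ` Y)" for Y u
  proof -
    interpret T: cring T by (rule Tcring)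
    obtain rs where rs: "set rs = Y" using finite_list[OF Y(1)] by blast
    let ?ws = "map (\<lambda>r. h (structure_map S r)) rs"
    have wsC: "set ?ws \<subseteq> C" using rs Y smC by auto
    have kuC: "k u \<in> C" using u by (auto simp: Tsimps kg)
    obtain cs where cs: "length cs = length ?ws" "set cs \<subseteq> C" "k u = A.lincomb ?ws cs"
      using coeff[OF kuC wsC] ku rs by auto
    have "g (A.lincomb (map (\<lambda>r. h (structure_map S r)) rs) cs) = T.lincomb (map (structure_map T) rs) (map g cs)
      \<and> A.lincomb (map (\<lambda>r. h (structure_map S r)) rs) cs \<in> C"
      if "length cs = length rs" "set cs \<subseteq> C" "set rs \<subseteq> carrier R" for rs cs
      using that
    proof (induction rs arbitrary: cs)
      case Nil
      then show ?case using C0 by (simp add: Tsimps)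
    next
      case (Cons r rs)
      then obtain c cs' where cs: "cs = c # cs'" by (cases cs) auto
      let ?l = "A.lincomb (map (\<lambda>r. h (structure_map S r)) rs) cs'"
      have IH: "g ?l = T.lincomb (map (structure_map T) rs) (map g cs')" "?l \<in> C"
        using Cons.IH[of cs'] Cons.prems cs by auto
      have r: "r \<in> carrier R" and c: "c \<in> C" using Cons.prems cs by auto
      show ?case using IH(2) c smC[OF r] C(5,6)
        by (simp add: cs IH(1)[symmetric] gsm[OF r, symmetric] Tsimps kg)
    qed
    from this[of cs rs] have "g (k u) = T.lincomb (map (structure_map T) rs) (map g cs)"
      using cs rs Y(2) by simp
    moreover have "g (k u) = u" using u by (auto simp: Tsimps kg)
    moreover have "set (map (structure_map T) rs) \<subseteq> carrier T"
      using rs Y(2) ring_hom_closed[OF structure_map_hom[OF Talg]] by auto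
    moreover have "set (map g cs) \<subseteq> carrier T" using cs(2) by (auto simp: Tsimps)
    moreover have "length (map g cs) = length (map (structure_map T) rs)" using cs(1) by simp
    ultimately have "u \<in> Idl\<^bsub>T\<^esub> (set (map (structure_map T) rs))"
      using T.Idl_list[of "map (structure_map T) rs"] by force
    then show ?thesis unfolding extended_ideal_eq using rs by simp
  qed
  show ?thesis by (rule that[OF Talg f kT]) (use ksm fin in blast)+
qed

section \<open>Frobenius powers of parameter ideals\<close>

context cring
begin

definition frobenius_power :: "nat \<Rightarrow> 'a list \<Rightarrow> nat \<Rightarrow> 'a set"
  where "frobenius_power p xs N = Idl ((\<lambda>x. x [^] (p ^ N)) ` set xs)"

lemma frobenius_power_ideal: "set xs \<subseteq> carrier R \<Longrightarrow> ideal (frobenius_power p xs N) R"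
  unfolding frobenius_power_def by (rule genideal_ideal) auto

lemma frobenius_power_gen:
  "set xs \<subseteq> carrier R \<Longrightarrow> x \<in> set xs \<Longrightarrow> x [^] (p ^ N) \<in> frobenius_power p xs N"
  unfolding frobenius_power_def
  using genideal_self[of "(\<lambda>x. x [^] (p ^ N)) ` set xs"] by fastforce

lemma frobenius_power_pow:
  "set xs \<subseteq> carrier R \<Longrightarrow> x \<in> set xs \<Longrightarrow> p ^ N \<le> n \<Longrightarrow> x [^] (n::nat) \<in> frobenius_power p xs N"
  using ideal_pow_mono[OF frobenius_power_ideal _ frobenius_power_gen] by blast

lemma frobenius_power_antimono:
  assumes xs: "set xs \<subseteq> carrier R" and p: "Factorial_Ring.prime p" and le: "N \<le> M"
  shows "frobenius_power p xs M \<subseteq> frobenius_power p xs N"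
  unfolding frobenius_power_def[of p xs M]
proof (rule genideal_minimal[OF frobenius_power_ideal[OF xs]])
  have "p ^ N \<le> p ^ M" by (rule power_increasing[OF le prime_ge_1_nat[OF p]])
  then show "(\<lambda>x. x [^] (p ^ M)) ` set xs \<subseteq> frobenius_power p xs N"
    using frobenius_power_pow[OF xs] by blast
qed

text \<open>
  Additivity of the Frobenius turns a single containment into a comparison of all Frobenius
  powers with the same shift \<open>s\<close>.
\<close>

lemma frobenius_power_compare:
  assumes p: "Factorial_Ring.prime p" "char_dvd p"
    and xs: "set xs \<subseteq> carrier R" and ys: "set ys \<subseteq> carrier R"
    and rad: "\<And>x. x \<in> set xs \<Longrightarrow> x [^] (p ^ s) \<in> Idl (set ys)"
  shows "frobenius_power p xs (s + M) \<subseteq> frobenius_power p ys M"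
  unfolding frobenius_power_def[of p xs]
proof (rule genideal_minimal[OF frobenius_power_ideal[OF ys]])
  have "x [^] (p ^ (s + M)) \<in> frobenius_power p ys M" if x: "x \<in> set xs" for x
  proof -
    have "(x [^] (p ^ s)) [^] (p ^ M) \<in> frobenius_power p ys M"
      unfolding frobenius_power_def by (rule frobenius_Idl[OF p ys rad[OF x]])
    then show ?thesis using x xs by (simp add: nat_pow_pow power_add subsetD)
  qed
  then show "(\<lambda>x. x [^] (p ^ (s + M))) ` set xs \<subseteq> frobenius_power p ys M" by blast
qed

lemma Idl_Un_split:
  assumes W: "W \<subseteq> carrier R" and J: "ideal J R" and a: "a \<in> Idl (W \<union> J)"
  obtains v where "v \<in> Idl W" "a \<ominus> v \<in> J"
proof -
  have I: "ideal (Idl W) R" by (rule genideal_ideal[OF W])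
  note c = ideal_subset[OF I] ideal_subset[OF J]
  have "W \<union> J \<subseteq> Idl W \<union> J" using genideal_self[OF W] by blast
  then have "Idl (W \<union> J) \<subseteq> Idl (Idl W \<union> J)" using c by (intro Idl_mono) auto
  then have "a \<in> Idl W <+> J" using a union_genideal[OF I J] by blast
  then obtain v j where vj: "v \<in> Idl W" "j \<in> J" "a = v \<oplus> j"
    unfolding set_add_def set_mult_def by auto
  have vc: "v \<in> carrier R" "j \<in> carrier R" using vj c by auto
  have "(v \<oplus> j) \<ominus> v = j" using vc by algebra
  then show ?thesis using that vj by auto
qed

lemma Idl_UnI:
  assumes W: "W \<subseteq> carrier R" and J: "ideal J R" and v: "v \<in> Idl W" and a: "a \<in> carrier R" "a \<ominus> v \<in> J"
  shows "a \<in> Idl (W \<union> J)"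
proof -
  have WJ: "W \<union> J \<subseteq> carrier R" using W ideal_subset[OF J] by blast
  have "v \<in> Idl (W \<union> J)" using v Idl_mono[of W "W \<union> J"] WJ by blast
  moreover have "a \<ominus> v \<in> Idl (W \<union> J)" using a(2) genideal_self[OF WJ] by blast
  ultimately have "v \<oplus> (a \<ominus> v) \<in> Idl (W \<union> J)" by (rule ideal_add[OF genideal_ideal[OF WJ]])
  moreover have "v \<in> carrier R" using v ideal_subset[OF genideal_ideal[OF W]] by blast
  then have "v \<oplus> (a \<ominus> v) = a" using a(1) by algebra
  ultimately show ?thesis by simp
qed

text \<open>
  Let \<open>y\<close> be entry \<open>k\<close> of \<open>ys\<close> and \<open>q\<close> a large power of \<open>p\<close>. Modulo \<open>(ys^q)\<close> the hypothesis
  becomes \<open>y^t f = i + r y^q\<close> with \<open>i\<close> in the ideal generated by the \<open>t\<close>-th powers of the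
  entries before \<open>y\<close> and the \<open>q\<close>-th powers of those after it. Hence \<open>y^t (f - r y^(q-t))\<close> lies
  in this ideal, and \<open>colon_trivial_of_regular\<close>, applied to \<open>y^t\<close> and these powers, removes the
  factor \<open>y^t\<close>. The terms that remain besides \<open>t\<close>-th powers have exponents at least \<open>q - t \<ge>
  p^(M-1)\<close>. Passing from \<open>xs\<close> to \<open>ys\<close> and back costs the shifts \<open>s\<close> and \<open>s'\<close>, and the
  subtraction of \<open>t\<close> costs at most \<open>1 + t\<close>.
\<close>

lemma colon_approximation:
  assumes p: "Factorial_Ring.prime p" "char_dvd p" and xs: "weakly_regular xs"
    and ys: "set ys \<subseteq> carrier R" and len: "length ys = length xs"
    and rad: "\<And>x. x \<in> set xs \<Longrightarrow> x [^] (p ^ s) \<in> Idl (set ys)"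
      "\<And>y. y \<in> set ys \<Longrightarrow> y [^] (p ^ s') \<in> Idl (set xs)"
    and k: "k < length ys" and N: "s + s' + 1 + t \<le> N" and f: "f \<in> carrier R"
    and mem: "(ys ! k) [^] (t::nat) \<otimes> f
      \<in> Idl ((\<lambda>y. y [^] t) ` set (take k ys) \<union> frobenius_power p xs N)"
  shows "f \<in> Idl ((\<lambda>y. y [^] t) ` set (take k ys) \<union> frobenius_power p xs (N - (s + s' + 1 + t)))"
proof -
  define y where "y = ys ! k"
  define M where "M = N - s"
  define q where "q = p ^ M"
  have xc: "set xs \<subseteq> carrier R" using xs unfolding weakly_regular_def by blast
  have yc: "y \<in> carrier R" unfolding y_def using ys k by auto
  have p2: "2 \<le> p" by (rule prime_ge_2_nat[OF p(1)])
  have M: "M = Suc (M - 1)" "t \<le> M - 1" "s + M = N" unfolding M_def using N by auto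
  have "M - 1 < p ^ (M - 1)" using p2 by (intro power_gt_expt) auto
  then have tq: "t \<le> p ^ (M - 1)" using M(2) by linarith
  have "q = p * p ^ (M - 1)" unfolding q_def by (subst M(1)) simp
  then have "2 * p ^ (M - 1) \<le> q" using p2 by simp
  then have q: "p ^ (M - 1) \<le> q - t" "t \<le> q" "p ^ (M - 1) \<le> q" using tq by linarith+
  define zs where "zs = map (\<lambda>y. y [^] t) (take k ys) @ map (\<lambda>y. y [^] q) (drop (Suc k) ys)"
  have sub: "set (take k ys) \<subseteq> carrier R" "set (drop (Suc k) ys) \<subseteq> carrier R"
    using ys set_take_subset[of k ys] set_drop_subset[of "Suc k" ys] by blast+
  have zsc: "set zs \<subseteq> carrier R" unfolding zs_def using sub by auto
  have zlen: "length xs = Suc (length zs)" unfolding zs_def using k len by simp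
  have split: "set ys = set (take k ys) \<union> {y} \<union> set (drop (Suc k) ys)"
  proof -
    have "set ys = set (take k ys @ ys ! k # drop (Suc k) ys)"
      by (rule arg_cong[OF id_take_nth_drop[OF k]])
    then show ?thesis unfolding y_def by (simp only: set_append list.set(2) Un_insert_right Un_insert_left Un_empty_right)
  qed
  let ?Z = "Idl (insert (y [^] q) (set zs))"
  have Zc: "insert (y [^] q) (set zs) \<subseteq> carrier R" using yc zsc by simp
  have Zi: "ideal ?Z R" by (rule genideal_ideal[OF Zc])
  have Zself: "insert (y [^] q) (set zs) \<subseteq> ?Z" by (rule genideal_self[OF Zc])
  have JZ: "frobenius_power p ys M \<subseteq> ?Z"
    unfolding frobenius_power_def
  proof (rule genideal_minimal[OF Zi])
    have "w [^] q \<in> ?Z" if "w \<in> set ys" for w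
    proof -
      have "w \<in> set (take k ys) \<union> {y} \<union> set (drop (Suc k) ys)" using that by (simp only: split)
      then consider "w \<in> set (take k ys)" | "w = y" | "w \<in> set (drop (Suc k) ys)" by blast
      then show ?thesis
      proof cases
        case 1
        then have "w [^] t \<in> ?Z" using Zself unfolding zs_def by auto
        moreover have "w \<in> carrier R" using 1 sub by blast
        ultimately show ?thesis using ideal_pow_mono[OF Zi _ _ q(2)] by blast
      qed (use Zself in \<open>auto simp: zs_def\<close>)
    qed
    then show "(\<lambda>x. x [^] (p ^ M)) ` set ys \<subseteq> ?Z" unfolding q_def by blast
  qed
  have cmp: "frobenius_power p xs N \<subseteq> frobenius_power p ys M"
    unfolding M(3)[symmetric] by (rule frobenius_power_compare[OF p xc ys rad(1)])
  let ?T = "(\<lambda>y. y [^] t) ` set (take k ys)"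
  have "y [^] t \<otimes> f \<in> ?Z"
  proof -
    have "?T \<union> frobenius_power p xs N \<subseteq> ?Z"
      using cmp JZ Zself unfolding zs_def by auto
    then have "Idl (?T \<union> frobenius_power p xs N) \<subseteq> ?Z" by (rule genideal_minimal[OF Zi])
    then show ?thesis using mem unfolding y_def by blast
  qed
  then obtain i r where ir: "i \<in> Idl (set zs)" "r \<in> carrier R" "y [^] t \<otimes> f = i \<oplus> r \<otimes> y [^] q"
    unfolding Idl_insert[OF zsc nat_pow_closed[OF yc]] by blast
  have ic: "i \<in> carrier R" using ir(1) ideal_subset[OF genideal_ideal[OF zsc]] by blast
  define g where "g = f \<ominus> r \<otimes> y [^] (q - t)"
  have gc: "g \<in> carrier R" unfolding g_def using f ir(2) yc by simp
  have "y [^] q = y [^] t \<otimes> y [^] (q - t)" using yc q(2) by (simp add: nat_pow_mult)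
  then have "y [^] t \<otimes> f = i \<oplus> r \<otimes> (y [^] t \<otimes> y [^] (q - t))" using ir(3) by simp
  moreover have "a \<otimes> (f \<ominus> r \<otimes> b) = a \<otimes> f \<ominus> r \<otimes> (a \<otimes> b)"
    if "a \<in> carrier R" "b \<in> carrier R" for a b using that f ir(2) by algebra
  moreover have "(i \<oplus> a) \<ominus> a = i" if "a \<in> carrier R" for a using that ic by algebra
  ultimately have "y [^] t \<otimes> g = i" unfolding g_def using yc ir(2) by simp
  then have ygi: "y [^] t \<otimes> g \<in> Idl (set zs)" using ir(1) by simp
  have gz: "g \<in> Idl (set zs)"
  proof (rule colon_trivial_of_regular[OF xs nat_pow_closed[OF yc] zsc zlen _ gc ygi])
    fix x assume x: "x \<in> set xs"
    let ?Y = "insert (y [^] t) (set zs)"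
    have Yc: "?Y \<subseteq> carrier R" using yc zsc by simp
    have Yself: "?Y \<subseteq> Idl ?Y" by (rule genideal_self[OF Yc])
    have "y [^] q \<in> Idl ?Y"
      by (rule ideal_pow_mono[OF genideal_ideal[OF Yc] yc _ q(2)]) (use Yself in blast)
    then have "?Z \<subseteq> Idl ?Y"
      by (intro genideal_minimal[OF genideal_ideal[OF Yc]]) (use Yself in auto)
    moreover have "x [^] (p ^ N) \<in> ?Z" using frobenius_power_gen[OF xc x] cmp JZ by blast
    ultimately show "\<exists>K::nat. x [^] K \<in> Idl ?Y" by blast
  qed
  let ?F = "frobenius_power p xs (N - (s + s' + 1 + t))"
  let ?W = "?T \<union> ?F"
  have Wc: "?W \<subseteq> carrier R" using sub ideal_subset[OF frobenius_power_ideal[OF xc]] by auto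
  have Wi: "ideal (Idl ?W) R" by (rule genideal_ideal[OF Wc])
  have Wself: "?W \<subseteq> Idl ?W" by (rule genideal_self[OF Wc])
  have "frobenius_power p ys (M - 1) \<subseteq> ?F"
  proof -
    have "frobenius_power p ys (s' + (M - 1 - s')) \<subseteq> frobenius_power p xs (M - 1 - s')"
      by (rule frobenius_power_compare[OF p ys xc rad(2)])
    moreover have "s' + (M - 1 - s') = M - 1" "N - (s + s' + 1 + t) \<le> M - 1 - s'"
      unfolding M_def using N by auto
    ultimately show ?thesis
      using frobenius_power_antimono[OF xc p(1), of "N - (s + s' + 1 + t)" "M - 1 - s'"] by simp
  qed
  then have pw: "w [^] n \<in> Idl ?W" if "w \<in> set ys" "p ^ (M - 1) \<le> n" for w n
    using frobenius_power_pow[OF ys that] Wself by blast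
  have "Idl (set zs) \<subseteq> Idl ?W"
  proof (rule genideal_minimal[OF Wi])
    show "set zs \<subseteq> Idl ?W"
      unfolding zs_def using Wself pw[OF _ q(3)] set_drop_subset[of "Suc k" ys] by auto
  qed
  then have "g \<in> Idl ?W" using gz by blast
  moreover have "r \<otimes> y [^] (q - t) \<in> Idl ?W"
    using ideal_mult[OF Wi pw[OF _ q(1), of y] ir(2)] k unfolding y_def by simp
  ultimately have "g \<oplus> r \<otimes> y [^] (q - t) \<in> Idl ?W" by (rule ideal_add[OF Wi])
  moreover have "(f \<ominus> a) \<oplus> a = f" if "a \<in> carrier R" for a using that f by algebra
  ultimately show ?thesis unfolding g_def using ir(2) yc by simp
qed

lemma char_dvd_ring_char: "char_dvd (ring_char R)"
proof -
  have "\<one> [^]\<^bsub>add_monoid R\<^esub> (group.ord (add_monoid R) \<one>) = \<one>\<^bsub>add_monoid R\<^esub>"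
    by (rule group.pow_ord_eq_1[OF a_group]) simp
  then show ?thesis unfolding char_dvd_def ring_char_def add_pow_def by simp
qed

end

lemma hom_char_dvd:
  assumes A: "cring A" and B: "cring B" and h: "h \<in> ring_hom A B" and p: "cring.char_dvd A p"
  shows "cring.char_dvd B p"
proof -
  interpret A: cring A by fact
  interpret B: cring B by fact
  have "h ([n] \<cdot>\<^bsub>A\<^esub> \<one>\<^bsub>A\<^esub>) = [n] \<cdot>\<^bsub>B\<^esub> \<one>\<^bsub>B\<^esub>" for n :: nat
    by (induction n) (simp_all add: ring_hom_add[OF h] ring_hom_one[OF h]
        ring_hom_zero[OF h A.ring_axioms B.ring_axioms])
  then show ?thesis using p ring_hom_zero[OF h A.ring_axioms B.ring_axioms]
    unfolding A.char_dvd_def B.char_dvd_def by metis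
qed

section \<open>Frobenius twists and parameters\<close>

lemma const_hom: "(\<lambda>b e. b) \<in> ring_hom A (seq_ring A)"
  by (rule ring_hom_memI) (auto simp: seq_ring_simps fun_eq_iff)

text \<open>
  The homomorphism that makes the \<open>e\<close>-th factor of the sequence ring an algebra through the
  \<open>e\<close>-th power of the Frobenius.
\<close>

lemma frobenius_seq_hom:
  assumes A: "cring A" and p: "Factorial_Ring.prime p" "cring.char_dvd A p"
  shows "(\<lambda>a e. a [^]\<^bsub>A\<^esub> (p ^ e)) \<in> ring_hom A (seq_ring A)"
proof -
  interpret cring A by fact
  show ?thesis
    by (rule ring_hom_memI)
      (auto simp: seq_ring_simps fun_eq_iff nat_pow_distrib frobenius_add[OF p])
qed

lemma (in cring) quot_carrier: "carrier (R Quot I) = (+>) I ` carrier R"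
  unfolding FactRing_def A_RCOSETS_def RCOSETS_def a_r_coset_def by auto

text \<open>
  Two systems of parameters generate ideals with the same radical \<open>m\<close>; a common exponent \<open>p^s\<close>
  suffices for the finitely many elements.
\<close>

lemma (in cring) sop_frobenius:
  fixes p :: nat
  assumes m: "ideal m R" and p: "Factorial_Ring.prime p"
    and xs: "system_of_parameters R m xs" and ys: "system_of_parameters R m ys"
  obtains s where "\<forall>x\<in>set xs. x [^] (p ^ s) \<in> Idl (set ys)"
proof -
  have xm: "set xs \<subseteq> m" and ym: "set ys \<subseteq> m" and rad: "\<And>a. a \<in> m \<Longrightarrow> \<exists>k::nat. a [^] k \<in> Idl (set ys)"
    using xs ys unfolding system_of_parameters_def by auto
  have yc: "set ys \<subseteq> carrier R" using ym ideal_subset[OF m] by blast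
  have "\<forall>x\<in>set xs. \<exists>k::nat. x [^] k \<in> Idl (set ys)" using rad xm by blast
  then obtain k :: "_ \<Rightarrow> nat" where k: "\<forall>x\<in>set xs. x [^] k x \<in> Idl (set ys)" by (rule bchoice[THEN exE])
  define s where "s = Max (insert 0 (k ` set xs))"
  have "x [^] (p ^ s) \<in> Idl (set ys)" if x: "x \<in> set xs" for x
  proof -
    have "k x \<le> s" unfolding s_def using x by (intro Max_ge) auto
    moreover have "s < p ^ s" using prime_gt_1_nat[OF p] by (intro power_gt_expt) simp
    ultimately have "k x \<le> p ^ s" by linarith
    moreover have "x \<in> carrier R" using x xm ideal_subset[OF m] by blast
    ultimately show ?thesis using ideal_pow_mono[OF genideal_ideal[OF yc], of x "k x" "p ^ s"] k x by blast
  qed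
  then show ?thesis using that by blast
qed

lemma (in cring) ideal_power_basics:
  assumes m: "ideal m R"
  shows "ideal (ideal_power R m k) R"
    and "a \<in> m \<Longrightarrow> a [^] k \<in> ideal_power R m k"
    and "ideal_power R m (Suc k) \<subseteq> m"
proof -
  have id: "ideal (ideal_power R m k) R" for k
    by (induction k) (simp_all add: oneideal ideal_prod_is_ideal[OF _ m])
  show "ideal (ideal_power R m k) R" by (rule id)
  have mc: "m \<subseteq> carrier R" by (rule ideal_subset[OF m])
  show "a [^] k \<in> ideal_power R m k" if a: "a \<in> m"
  proof (induction k)
    case (Suc k)
    then show ?case using a ideal_prod.prod[of "a [^] k" "ideal_power R m k" a m R] by simp
  qed simp
  show "ideal_power R m (Suc k) \<subseteq> m" using ideal_prod_inter[OF id[of k] m] by auto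
qed

section \<open>From a big Cohen--Macaulay algebra to a durable colon-killer\<close>

text \<open>
  The ring \<open>A\<close> of sequences modulo null sequences plays the role of a completion of \<open>B\<close>. An
  inclusion that holds in \<open>B\<close> up to Frobenius powers of the parameters, with a uniform loss of
  exponent, becomes exact in \<open>A\<close>: the coefficients are chosen separately in every component, and
  the error is a null sequence. So \<open>A\<close>, and with it the small subalgebra \<open>T\<close>, has trivial colon
  ideals for every system of parameters.
\<close>

lemma durable_colon_killer_of_seed:
  fixes R :: "('a, 'k) ring_scheme" and S :: "('a, 'b, 'l) module_scheme"
    and B :: "('a, 'u, 'n) module_scheme"
  assumes R: "cring R" and m: "ideal m R" and p: "Factorial_Ring.prime p" "ring_char R = p"
    and S: "algebra R S" and B: "algebra R B" and h: "h \<in> algebra_hom R S B"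
    and xs: "system_of_parameters R m xs" and reg: "regular_sequence B xs"
    and inf: "infinite (UNIV :: 'v set)" and card: "carrier S \<lesssim> (UNIV :: 'v set)"
  shows "\<exists>(T :: ('a, 'v) module) f c.
    algebra R T \<and> f \<in> algebra_hom R S T \<and> durable_colon_killer R m T c"
proof -
  interpret R: cring R by fact
  interpret B: cring B by (rule algebra_cring[OF B])
  let ?s = "structure_map B"
  note sm = structure_map_hom[OF B]
  note smc = ring_hom_closed[OF sm]
  note hh = algebra_homD[OF S B h]
  have mc: "m \<subseteq> carrier R" by (rule R.ideal_subset[OF m])
  have charR: "R.char_dvd p" using R.char_dvd_ring_char p(2) by simp
  have charB: "B.char_dvd p" by (rule hom_char_dvd[OF R B.is_cring sm charR])
  have xm: "set xs \<subseteq> m" using xs unfolding system_of_parameters_def by blast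
  define xB where "xB = map ?s xs"
  have xBc: "set xB \<subseteq> carrier B" unfolding xB_def using xm mc smc by auto
  have wreg: "B.weakly_regular xB"
    unfolding B.weakly_regular_def
  proof (intro conjI allI impI ballI)
    fix k u assume k: "k < length xB" and u: "u \<in> carrier B"
      and mem: "xB ! k \<otimes>\<^bsub>B\<^esub> u \<in> Idl\<^bsub>B\<^esub> (set (take k xB))"
    have "xs ! k \<in> set xs" using k unfolding xB_def by simp
    then have "xs ! k \<in> carrier R" using xm mc by blast
    then have "xs ! k \<odot>\<^bsub>B\<^esub> u = xB ! k \<otimes>\<^bsub>B\<^esub> u"
      using smult_structure_map[OF B _ u] k unfolding xB_def by simp
    moreover have "extended_ideal B (set (take k xs)) = Idl\<^bsub>B\<^esub> (set (take k xB))"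
      unfolding extended_ideal_eq xB_def by (simp add: take_map)
    ultimately show "u \<in> Idl\<^bsub>B\<^esub> (set (take k xB))"
      using reg k u mem unfolding regular_sequence_def xB_def by auto
  qed (rule xBc)
  have xI: "ideal (Idl\<^bsub>B\<^esub> (set xB)) B" by (rule B.genideal_ideal[OF xBc])
  have proper: "\<one>\<^bsub>B\<^esub> \<notin> Idl\<^bsub>B\<^esub> (set xB)"
    using reg ideal.one_imp_carrier[OF xI] unfolding regular_sequence_def extended_ideal_eq xB_def by auto
  have image_Idl: "?s a \<in> Idl\<^bsub>B\<^esub> (?s ` W)" if "W \<subseteq> carrier R" "a \<in> Idl\<^bsub>R\<^esub> W" for a W
    by (rule hom_Idl[OF R B.is_cring sm that])
  have spow: "?s (a [^]\<^bsub>R\<^esub> (n::nat)) = ?s a [^]\<^bsub>B\<^esub> n" if "a \<in> carrier R" for a n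
    by (rule hom_pow[OF R B.is_cring sm that])
  have proper_m: "\<one>\<^bsub>B\<^esub> \<notin> Idl\<^bsub>B\<^esub> (?s ` m)"
  proof (rule B.eventual_frobenius_proper[OF p(1) charB xI proper])
    fix b assume "b \<in> ?s ` m"
    then obtain a where a: "a \<in> m" "b = ?s a" by blast
    then obtain k :: nat where "a [^]\<^bsub>R\<^esub> k \<in> Idl\<^bsub>R\<^esub> (set xs)"
      using xs unfolding system_of_parameters_def by blast
    moreover have "a \<in> carrier R" "set xs \<subseteq> carrier R" using a xm mc by blast+
    ultimately have "b [^]\<^bsub>B\<^esub> k \<in> Idl\<^bsub>B\<^esub> (set xB)" "b \<in> carrier B"
      using image_Idl[of "set xs" "a [^]\<^bsub>R\<^esub> k"] spow smc a(2) unfolding xB_def by auto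
    then show "b \<in> carrier B \<and> (\<exists>k::nat. b [^]\<^bsub>B\<^esub> k \<in> Idl\<^bsub>B\<^esub> (set xB))" by blast
  qed
  define I where "I N = B.frobenius_power p xB N" for N
  have Ii: "ideal (I N) B" for N unfolding I_def by (rule B.frobenius_power_ideal[OF xBc])
  have Idec: "I M \<subseteq> I N" if "N \<le> M" for N M
    unfolding I_def by (rule B.frobenius_power_antimono[OF xBc p(1) that])
  define Q where "Q = seq_ring B"
  have Qc: "cring Q" unfolding Q_def by (rule seq_ring_cring[OF B.is_cring])
  interpret Q: cring Q by (rule Qc)
  have Qcar: "f \<in> carrier Q \<longleftrightarrow> (\<forall>e. f e \<in> carrier B)" for f unfolding Q_def by (rule seq_ring_simps)
  \<comment> \<open>The shift \<open>s\<close> makes this set absorb the loss of exponent in \<open>colon_approximation\<close>.\<close>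
  define null where "null = {f \<in> carrier Q. \<exists>s. \<forall>e\<ge>s. f e \<in> I (e - s)}"
  have null: "ideal null Q"
  proof (rule Q.ideal_closedI)
    show "null \<subseteq> carrier Q" unfolding null_def by blast
    show "\<zero>\<^bsub>Q\<^esub> \<in> null" unfolding null_def
      using Q.zero_closed B.ideal_zero[OF Ii] by (auto simp: Q_def seq_ring_simps)
  next
    fix f g assume "f \<in> null" "g \<in> null"
    then obtain s t where *: "f \<in> carrier Q" "g \<in> carrier Q" "\<forall>e\<ge>s. f e \<in> I (e - s)" "\<forall>e\<ge>t. g e \<in> I (e - t)"
      unfolding null_def by blast
    have "(f \<oplus>\<^bsub>Q\<^esub> g) e \<in> I (e - max s t)" if e: "e \<ge> max s t" for e
    proof -
      have "I (e - s) \<subseteq> I (e - max s t)" "I (e - t) \<subseteq> I (e - max s t)"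
        by (rule Idec; simp)+
      then have "f e \<in> I (e - max s t)" and "g e \<in> I (e - max s t)" using *(3,4) e by auto
      then show ?thesis using B.ideal_add[OF Ii] by (simp add: Q_def seq_ring_simps)
    qed
    then show "f \<oplus>\<^bsub>Q\<^esub> g \<in> null" unfolding null_def using *(1,2) by blast
  next
    fix r f assume r: "r \<in> carrier Q" and "f \<in> null"
    then obtain s where *: "f \<in> carrier Q" "\<forall>e\<ge>s. f e \<in> I (e - s)" unfolding null_def by blast
    have "(r \<otimes>\<^bsub>Q\<^esub> f) e \<in> I (e - s)" if "e \<ge> s" for e
      using *(2) that B.ideal_mult[OF Ii] r by (simp add: Q_def seq_ring_simps)
    then show "r \<otimes>\<^bsub>Q\<^esub> f \<in> null" unfolding null_def using *(1) r by blast
  qed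
  define A where "A = Q Quot null"
  define proj where "proj = (+>\<^bsub>Q\<^esub>) null"
  have Ac: "cring A" unfolding A_def by (rule ideal.quotient_is_cring[OF null Qc])
  interpret A: cring A by (rule Ac)
  have proj: "proj \<in> ring_hom Q A" unfolding A_def proj_def by (rule ideal.rcos_ring_hom[OF null])
  have surj: "carrier A = proj ` carrier Q" unfolding A_def proj_def by (rule Q.quot_carrier)
  have proj_eq: "proj f = proj g \<longleftrightarrow> f \<ominus>\<^bsub>Q\<^esub> g \<in> null" if "f \<in> carrier Q" "g \<in> carrier Q" for f g
    unfolding proj_def using Q.quotient_eq_iff_same_a_r_cos[OF null that] by simp
  have c: "(\<lambda>b e. b) \<in> ring_hom B Q" unfolding Q_def by (rule const_hom)
  define H where "H s = proj (\<lambda>e. h s)" for s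
  have H: "H \<in> ring_hom S A"
    using ring_hom_trans[OF ring_hom_trans[OF hh(1) c] proj] unfolding H_def comp_def .
  have Hsm: "H (structure_map S r) = proj (\<lambda>e. ?s r)" if "r \<in> carrier R" for r
    unfolding H_def using hh(2)[OF that] by simp
  obtain T :: "('a, 'v) module" and k f where T: "algebra R T" and f: "f \<in> algebra_hom R S T"
    and k: "k \<in> ring_hom T A"
    and ksm': "\<forall>r\<in>carrier R. k (structure_map T r) = H (structure_map S r)"
    and pure': "\<forall>Y u. finite Y \<longrightarrow> Y \<subseteq> carrier R \<longrightarrow> u \<in> carrier T \<longrightarrow>
      k u \<in> Idl\<^bsub>A\<^esub> ((\<lambda>r. H (structure_map S r)) ` Y) \<longrightarrow> u \<in> extended_ideal T Y"
    by (rule small_algebra[OF Ac S H inf card])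
  note ksm = bspec[OF ksm']
  have pure: "u \<in> extended_ideal T Y" if "finite Y" "Y \<subseteq> carrier R" "u \<in> carrier T"
    "k u \<in> Idl\<^bsub>A\<^esub> ((\<lambda>r. H (structure_map S r)) ` Y)" for Y u
    using pure' that by blast
  interpret T: cring T by (rule algebra_cring[OF T])
  note smT = structure_map_hom[OF T]
  have cQ: "(\<lambda>e. ?s r) \<in> carrier Q" if "r \<in> carrier R" for r using smc[OF that] by (simp add: Qcar)
  have gens: "(\<lambda>r. H (structure_map S r)) ` Y = proj ` ((\<lambda>r e. ?s r) ` Y)" if "Y \<subseteq> carrier R" for Y
    using that Hsm by (auto simp: image_image intro!: image_cong)
  have IdlA: "Idl\<^bsub>A\<^esub> ((\<lambda>r. H (structure_map S r)) ` Y) = proj ` (Idl\<^bsub>Q\<^esub> ((\<lambda>r e. ?s r) ` Y))"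
    if "Y \<subseteq> carrier R" for Y
    unfolding gens[OF that] by (rule surj_hom_Idl[OF Qc Ac proj surj]) (use that cQ in blast)
  have k_ext: "k u \<in> proj ` (Idl\<^bsub>Q\<^esub> ((\<lambda>r e. ?s r) ` Y))" if Y: "Y \<subseteq> carrier R" and u: "u \<in> extended_ideal T Y" for Y u
  proof -
    have sub: "structure_map T ` Y \<subseteq> carrier T" using Y ring_hom_closed[OF smT] by blast
    have "k u \<in> Idl\<^bsub>A\<^esub> (k ` structure_map T ` Y)"
      by (rule hom_Idl[OF T.is_cring Ac k sub]) (use u in \<open>simp add: extended_ideal_eq\<close>)
    moreover have "k ` structure_map T ` Y = (\<lambda>r. H (structure_map S r)) ` Y"
      using ksm Y by (auto simp: image_image intro!: image_cong)
    ultimately show ?thesis using IdlA[OF Y] by simp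
  qed
  have killing: "colon_killing R T \<one>\<^bsub>T\<^esub> ys" if ys: "system_of_parameters R m ys" for ys
    unfolding colon_killing_def
  proof (intro allI impI)
    fix j t :: nat assume j: "j < length ys" and t: "1 \<le> t"
    let ?Y = "(\<lambda>x. x [^]\<^bsub>R\<^esub> t) ` set (take j ys)"
    let ?y = "(ys ! j) [^]\<^bsub>R\<^esub> t"
    have ym: "set ys \<subseteq> m" using ys unfolding system_of_parameters_def by blast
    then have ycR: "set ys \<subseteq> carrier R" using mc by blast
    have xcR: "set xs \<subseteq> carrier R" using xm mc by blast
    have takeR: "set (take j ys) \<subseteq> carrier R" using ycR set_take_subset[of j ys] by blast
    have Yc: "?Y \<subseteq> carrier R" using takeR by auto
    have yj: "ys ! j \<in> carrier R" using ycR j by auto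
    then have yc: "?y \<in> carrier R" by simp
    define yB where "yB = map ?s ys"
    have yBc: "set yB \<subseteq> carrier B" unfolding yB_def using ycR smc by auto
    have len: "length yB = length xB"
    proof -
      have "enat (length ys) = enat (length xs)" using xs ys unfolding system_of_parameters_def by simp
      then show ?thesis unfolding yB_def xB_def by simp
    qed
    have pw: "w [^]\<^bsub>B\<^esub> (p ^ s) \<in> Idl\<^bsub>B\<^esub> (set (map ?s vs))"
      if w: "w \<in> set (map ?s us)" and us: "set us \<subseteq> carrier R" and vs: "set vs \<subseteq> carrier R"
        and rad: "\<forall>x\<in>set us. x [^]\<^bsub>R\<^esub> (p ^ s) \<in> Idl\<^bsub>R\<^esub> (set vs)" for w s us vs
    proof -
      obtain x where x: "x \<in> set us" "w = ?s x" using w by auto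
      then have "x \<in> carrier R" using us by blast
      then have "w [^]\<^bsub>B\<^esub> (p ^ s) = ?s (x [^]\<^bsub>R\<^esub> (p ^ s))" using spow x(2) by simp
      then show ?thesis using image_Idl[OF vs bspec[OF rad x(1)]] by simp
    qed
    obtain s1 where s1: "\<forall>x\<in>set xs. x [^]\<^bsub>R\<^esub> (p ^ s1) \<in> Idl\<^bsub>R\<^esub> (set ys)"
      by (rule R.sop_frobenius[OF m p(1) xs ys])
    have rad1: "w [^]\<^bsub>B\<^esub> (p ^ s1) \<in> Idl\<^bsub>B\<^esub> (set yB)" if "w \<in> set xB" for w
      using pw[OF _ xcR ycR s1] that unfolding xB_def yB_def by simp
    obtain s2 where s2: "\<forall>x\<in>set ys. x [^]\<^bsub>R\<^esub> (p ^ s2) \<in> Idl\<^bsub>R\<^esub> (set xs)"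
      by (rule R.sop_frobenius[OF m p(1) ys xs])
    have rad2: "w [^]\<^bsub>B\<^esub> (p ^ s2) \<in> Idl\<^bsub>B\<^esub> (set xB)" if "w \<in> set yB" for w
      using pw[OF _ ycR xcR s2] that unfolding xB_def yB_def by simp
    define d where "d = s1 + s2 + 1 + t"
    have imY: "?s ` ?Y = (\<lambda>y. y [^]\<^bsub>B\<^esub> t) ` set (take j yB)"
      unfolding yB_def take_map using takeR spow by (auto simp: image_image intro!: image_cong)
    have sYc: "?s ` ?Y \<subseteq> carrier B" using Yc smc by blast
    have yBj: "?s ?y = (yB ! j) [^]\<^bsub>B\<^esub> t" unfolding yB_def using j yj spow by simp
    let ?Z = "(\<lambda>r e. ?s r) ` ?Y"
    have Zc: "?Z \<subseteq> carrier Q" using Yc cQ by blast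
    have Zmem: "v \<in> Idl\<^bsub>Q\<^esub> ?Z \<longleftrightarrow> (\<forall>e. v e \<in> Idl\<^bsub>B\<^esub> (?s ` ?Y))" if v: "v \<in> carrier Q" for v
    proof -
      have im: "(\<lambda>f. f e) ` ?Z = ?s ` ?Y" for e by (auto simp: image_image)
      have "v \<in> Idl\<^bsub>Q\<^esub> ?Z \<longleftrightarrow> (\<forall>e. v e \<in> Idl\<^bsub>B\<^esub> ((\<lambda>f. f e) ` ?Z))"
        unfolding Q_def by (rule seq_ring_Idl[OF B.is_cring]) (use Zc v in \<open>simp_all add: Q_def\<close>)
      then show ?thesis by (simp only: im)
    qed
    show "(\<lambda>u. \<one>\<^bsub>T\<^esub> \<otimes>\<^bsub>T\<^esub> u) ` colon_ideal T (extended_ideal T ?Y) ?y \<subseteq> extended_ideal T ?Y"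
    proof (rule image_subsetI)
      fix u assume "u \<in> colon_ideal T (extended_ideal T ?Y) ?y"
      then have u: "u \<in> carrier T" and yu: "?y \<odot>\<^bsub>T\<^esub> u \<in> extended_ideal T ?Y"
        unfolding colon_ideal_def by auto
      obtain g where g: "g \<in> carrier Q" "k u = proj g"
        using ring_hom_closed[OF k u] surj by auto
      let ?c = "\<lambda>e::nat. ?s ?y"
      have cy: "?c \<in> carrier Q" by (rule cQ[OF yc])
      have "k (?y \<odot>\<^bsub>T\<^esub> u) = k (structure_map T ?y) \<otimes>\<^bsub>A\<^esub> k u"
        using smult_structure_map[OF T yc u] ring_hom_mult[OF k] ring_hom_closed[OF smT yc] u by simp
      also have "\<dots> = proj (?c \<otimes>\<^bsub>Q\<^esub> g)"
        unfolding ksm[OF yc] Hsm[OF yc] g(2) by (rule ring_hom_mult[OF proj cy g(1), symmetric])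
      finally have "proj (?c \<otimes>\<^bsub>Q\<^esub> g) \<in> proj ` (Idl\<^bsub>Q\<^esub> ?Z)" using k_ext[OF Yc yu] by simp
      then obtain w where w: "w \<in> Idl\<^bsub>Q\<^esub> ?Z" "proj (?c \<otimes>\<^bsub>Q\<^esub> g) = proj w" by auto
      have wc: "w \<in> carrier Q" using w(1) Q.ideal_subset[OF Q.genideal_ideal[OF Zc]] by blast
      have "(?c \<otimes>\<^bsub>Q\<^esub> g) \<ominus>\<^bsub>Q\<^esub> w \<in> null" using w(2) proj_eq[OF _ wc] cy g(1) by simp
      then obtain s where s: "\<And>e. e \<ge> s \<Longrightarrow> ((?c \<otimes>\<^bsub>Q\<^esub> g) \<ominus>\<^bsub>Q\<^esub> w) e \<in> I (e - s)"
        unfolding null_def by blast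
      have ge: "g e \<in> carrier B" for e using g(1) Qcar by blast
      \<comment> \<open>The bound \<open>d\<close> does not depend on \<open>e\<close>, so the error terms form a null sequence.\<close>
      have approx: "\<exists>v\<in>Idl\<^bsub>B\<^esub> (?s ` ?Y). g e \<ominus>\<^bsub>B\<^esub> v \<in> I (e - (s + d))" if e: "e \<ge> s + d" for e
      proof -
        have "((?c \<otimes>\<^bsub>Q\<^esub> g) \<ominus>\<^bsub>Q\<^esub> w) e = ?s ?y \<otimes>\<^bsub>B\<^esub> g e \<ominus>\<^bsub>B\<^esub> w e"
          using seq_ring_minus[OF B.is_cring, of "?c \<otimes>\<^bsub>Q\<^esub> g" w e] cy g(1) wc Q.m_closed[OF cy g(1)]
          unfolding Q_def by (simp add: seq_ring_simps)
        then have "?s ?y \<otimes>\<^bsub>B\<^esub> g e \<ominus>\<^bsub>B\<^esub> w e \<in> I (e - s)" using s[of e] e by simp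
        moreover have "w e \<in> Idl\<^bsub>B\<^esub> (?s ` ?Y)" using w(1) Zmem[OF wc] by blast
        ultimately have "?s ?y \<otimes>\<^bsub>B\<^esub> g e \<in> Idl\<^bsub>B\<^esub> (?s ` ?Y \<union> I (e - s))"
          using smc[OF yc] ge by (intro B.Idl_UnI[OF sYc Ii]) auto
        then have "(yB ! j) [^]\<^bsub>B\<^esub> t \<otimes>\<^bsub>B\<^esub> g e
          \<in> Idl\<^bsub>B\<^esub> ((\<lambda>y. y [^]\<^bsub>B\<^esub> t) ` set (take j yB) \<union> B.frobenius_power p xB (e - s))"
          unfolding yBj imY I_def .
        then have "g e \<in> Idl\<^bsub>B\<^esub> ((\<lambda>y. y [^]\<^bsub>B\<^esub> t) ` set (take j yB)
            \<union> B.frobenius_power p xB (e - s - (s1 + s2 + 1 + t)))"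
          by (intro B.colon_approximation[OF p(1) charB wreg yBc len rad1 rad2 _ _ ge])
            (use j e in \<open>auto simp: yB_def d_def\<close>)
        moreover have "e - s - (s1 + s2 + 1 + t) = e - (s + d)" unfolding d_def by simp
        ultimately have "g e \<in> Idl\<^bsub>B\<^esub> (?s ` ?Y \<union> I (e - (s + d)))" unfolding imY I_def by simp
        then show ?thesis using B.Idl_Un_split[OF sYc Ii] by blast
      qed
      have zero: "\<zero>\<^bsub>B\<^esub> \<in> Idl\<^bsub>B\<^esub> (?s ` ?Y)" by (rule B.ideal_zero[OF B.genideal_ideal[OF sYc]])
      have "\<forall>e. \<exists>v. v \<in> Idl\<^bsub>B\<^esub> (?s ` ?Y) \<and> (e \<ge> s + d \<longrightarrow> g e \<ominus>\<^bsub>B\<^esub> v \<in> I (e - (s + d)))"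
        using approx zero by blast
      from choice[OF this] obtain v where v: "\<And>e. v e \<in> Idl\<^bsub>B\<^esub> (?s ` ?Y)"
        "\<And>e. e \<ge> s + d \<Longrightarrow> g e \<ominus>\<^bsub>B\<^esub> v e \<in> I (e - (s + d))" by blast
      have vc: "v \<in> carrier Q" using v(1) B.ideal_subset[OF B.genideal_ideal[OF sYc]] by (auto simp: Qcar)
      have vZ: "v \<in> Idl\<^bsub>Q\<^esub> ?Z" using Zmem[OF vc] v(1) by blast
      have "(g \<ominus>\<^bsub>Q\<^esub> v) e = g e \<ominus>\<^bsub>B\<^esub> v e" for e
        using seq_ring_minus[OF B.is_cring, of g v e] g(1) vc unfolding Q_def by simp
      then have "g \<ominus>\<^bsub>Q\<^esub> v \<in> null" unfolding null_def using v(2) g(1) vc by auto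
      then have "k u = proj v" using proj_eq[OF g(1) vc] g(2) by simp
      then have "k u \<in> Idl\<^bsub>A\<^esub> ((\<lambda>r. H (structure_map S r)) ` ?Y)" using IdlA[OF Yc] vZ by blast
      then have "u \<in> extended_ideal T ?Y" using pure[of ?Y u] Yc u by simp
      then show "\<one>\<^bsub>T\<^esub> \<otimes>\<^bsub>T\<^esub> u \<in> extended_ideal T ?Y" using u by simp
    qed
  qed
  have "\<one>\<^bsub>T\<^esub> \<notin> extended_ideal T (ideal_power R m 1)"
  proof
    assume one: "\<one>\<^bsub>T\<^esub> \<in> extended_ideal T (ideal_power R m 1)"
    have m1: "ideal_power R m 1 \<subseteq> m" using R.ideal_power_basics(3)[OF m, of 0] by simp
    let ?Z = "(\<lambda>r e. ?s r) ` ideal_power R m 1"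
    have Zc: "?Z \<subseteq> carrier Q" using m1 mc cQ by blast
    have "k \<one>\<^bsub>T\<^esub> \<in> proj ` (Idl\<^bsub>Q\<^esub> ?Z)" by (rule k_ext[OF _ one]) (use m1 mc in blast)
    then have "proj \<one>\<^bsub>Q\<^esub> \<in> proj ` (Idl\<^bsub>Q\<^esub> ?Z)" using ring_hom_one[OF k] ring_hom_one[OF proj] by simp
    then obtain w where w: "w \<in> Idl\<^bsub>Q\<^esub> ?Z" "proj \<one>\<^bsub>Q\<^esub> = proj w" by auto
    have wc: "w \<in> carrier Q" using w(1) Q.ideal_subset[OF Q.genideal_ideal[OF Zc]] by blast
    have "\<one>\<^bsub>Q\<^esub> \<ominus>\<^bsub>Q\<^esub> w \<in> null" using w(2) proj_eq[OF _ wc] by simp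
    then obtain s where "(\<one>\<^bsub>Q\<^esub> \<ominus>\<^bsub>Q\<^esub> w) s \<in> I 0" unfolding null_def by force
    moreover have "(\<one>\<^bsub>Q\<^esub> \<ominus>\<^bsub>Q\<^esub> w) s = \<one>\<^bsub>B\<^esub> \<ominus>\<^bsub>B\<^esub> w s"
      using seq_ring_minus[OF B.is_cring, of "\<one>\<^bsub>Q\<^esub>" w s] Q.one_closed wc unfolding Q_def by (simp add: seq_ring_simps)
    moreover have smB: "?s ` m \<subseteq> carrier B" using mc smc by blast
    moreover have "I 0 \<subseteq> Idl\<^bsub>B\<^esub> (?s ` m)"
    proof -
      have "I 0 = Idl\<^bsub>B\<^esub> (set xB)" unfolding I_def B.frobenius_power_def using xBc by (simp add: image_def subset_iff cong: conj_cong)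
      also have "\<dots> \<subseteq> Idl\<^bsub>B\<^esub> (?s ` m)" by (rule B.Idl_mono[OF _ smB]) (use xm in \<open>auto simp: xB_def\<close>)
      finally show ?thesis .
    qed
    moreover have "w s \<in> Idl\<^bsub>B\<^esub> (?s ` m)"
    proof -
      have "(\<lambda>f. f s) w \<in> Idl\<^bsub>B\<^esub> ((\<lambda>f. f s) ` ?Z)"
        using hom_Idl[OF Qc B.is_cring _ Zc w(1), of "\<lambda>f. f s"] seq_ring_eval_hom unfolding Q_def by blast
      moreover have "(\<lambda>f. f s) ` ?Z \<subseteq> ?s ` m" using m1 by auto
      ultimately show ?thesis using B.Idl_mono[OF _ smB] by blast
    qed
    ultimately have "(\<one>\<^bsub>B\<^esub> \<ominus>\<^bsub>B\<^esub> w s) \<oplus>\<^bsub>B\<^esub> w s \<in> Idl\<^bsub>B\<^esub> (?s ` m)"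
      using B.ideal_add[OF B.genideal_ideal[OF smB]] by auto
    moreover have "(\<one>\<^bsub>B\<^esub> \<ominus>\<^bsub>B\<^esub> w s) \<oplus>\<^bsub>B\<^esub> w s = \<one>\<^bsub>B\<^esub>"
      using wc Qcar by (simp add: B.minus_eq B.a_assoc B.l_neg)
    ultimately show False using proper_m by simp
  qed
  then have "powers_escape R m T \<one>\<^bsub>T\<^esub>" unfolding powers_escape_def by auto
  then have "durable_colon_killer R m T \<one>\<^bsub>T\<^esub>"
    unfolding durable_colon_killer_def using killing by simp
  then show ?thesis using T f by blast
qed

section \<open>From a weak durable colon-killer to a big Cohen--Macaulay algebra\<close>

text \<open>
  The ring \<open>L\<close> is the localisation of the Frobenius-twisted product at the constant sequence
  \<open>c\<close>. Since \<open>c\<close> is constant, one exponent \<open>K\<close> serves all components; this uniformity is what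
  the condition on the powers of \<open>c\<close> contradicts if the parameters generate the unit ideal.
\<close>

lemma big_CM_algebra_of_weak_durable_colon_killer:
  fixes R :: "('a, 'k) ring_scheme" and S :: "('a, 'b, 'l) module_scheme"
    and T :: "('a, 'v, 'n) module_scheme"
  assumes R: "cring R" and m: "ideal m R" and p: "Factorial_Ring.prime p" "ring_char R = p"
    and S: "algebra R S" and T: "algebra R T" and h: "h \<in> algebra_hom R S T"
    and c: "weak_durable_colon_killer R m T c"
    and inf: "infinite (UNIV :: 'u set)" and card: "carrier S \<lesssim> (UNIV :: 'u set)"
  shows "\<exists>(B :: ('a, 'u) module) f. big_CM_algebra R m B \<and> f \<in> algebra_hom R S B"
proof -
  interpret R: cring R by fact
  interpret T: cring T by (rule algebra_cring[OF T])
  let ?s = "structure_map T"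
  note sm = structure_map_hom[OF T]
  note smc = ring_hom_closed[OF sm]
  note hh = algebra_homD[OF S T h]
  have mc: "m \<subseteq> carrier R" by (rule R.ideal_subset[OF m])
  have charR: "R.char_dvd p" using R.char_dvd_ring_char p(2) by simp
  have charT: "T.char_dvd p" by (rule hom_char_dvd[OF R T.is_cring sm charR])
  obtain xs where cT: "c \<in> carrier T" and xs: "system_of_parameters R m xs" and kill: "colon_killing R T c xs"
    and esc: "powers_escape R m T c" using c unfolding weak_durable_colon_killer_def by blast
  have xm: "set xs \<subseteq> m" using xs unfolding system_of_parameters_def by blast
  then have xc: "set xs \<subseteq> carrier R" using mc by blast
  define Q where "Q = seq_ring T"
  have Qc: "cring Q" unfolding Q_def by (rule seq_ring_cring[OF T.is_cring])
  interpret Q: cring Q by (rule Qc)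
  have Qcar: "f \<in> carrier Q \<longleftrightarrow> (\<forall>e. f e \<in> carrier T)" for f unfolding Q_def by (rule seq_ring_simps)
  define g where "g = (\<lambda>e::nat. c)"
  have gQ: "g \<in> carrier Q" unfolding g_def using cT by (simp add: Qcar)
  define Fr where "Fr a = (\<lambda>e. a [^]\<^bsub>T\<^esub> (p ^ e))" for a
  have Fr: "Fr \<in> ring_hom T Q"
    using frobenius_seq_hom[OF T.is_cring p(1) charT] unfolding Fr_def Q_def .
  define L where "L = Q.localisation g"
  have Lc: "cring L" unfolding L_def by (rule Q.localisation_cring[OF gQ])
  interpret L: cring L by (rule Lc)
  let ?i = "\<lambda>u. Q.frac g u 0"
  have i: "?i \<in> ring_hom Q L" unfolding L_def by (rule Q.localisation_hom[OF gQ])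
  define H where "H s = ?i (Fr (h s))" for s
  have H: "H \<in> ring_hom S L"
    using ring_hom_trans[OF ring_hom_trans[OF hh(1) Fr] i] unfolding H_def comp_def .
  have Hsm: "H (structure_map S r) = ?i (Fr (?s r))" if "r \<in> carrier R" for r
    unfolding H_def using hh(2)[OF that] by simp
  have FrQ: "Fr (?s r) \<in> carrier Q" if "r \<in> carrier R" for r
    by (rule ring_hom_closed[OF Fr smc[OF that]])
  obtain B :: "('a, 'u) module" and k f where B: "algebra R B" and f: "f \<in> algebra_hom R S B"
    and k: "k \<in> ring_hom B L"
    and ksm': "\<forall>r\<in>carrier R. k (structure_map B r) = H (structure_map S r)"
    and pure': "\<forall>Y u. finite Y \<longrightarrow> Y \<subseteq> carrier R \<longrightarrow> u \<in> carrier B \<longrightarrow>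
      k u \<in> Idl\<^bsub>L\<^esub> ((\<lambda>r. H (structure_map S r)) ` Y) \<longrightarrow> u \<in> extended_ideal B Y"
    by (rule small_algebra[OF Lc S H inf card])
  note ksm = bspec[OF ksm']
  have pure: "u \<in> extended_ideal B Y" if "finite Y" "Y \<subseteq> carrier R" "u \<in> carrier B"
    "k u \<in> Idl\<^bsub>L\<^esub> ((\<lambda>r. H (structure_map S r)) ` Y)" for Y u
    using pure' that by blast
  interpret B: cring B by (rule algebra_cring[OF B])
  note smB = structure_map_hom[OF B]
  have gens: "(\<lambda>r. H (structure_map S r)) ` Y = ?i ` ((\<lambda>r. Fr (?s r)) ` Y)" if "Y \<subseteq> carrier R" for Y
    using that Hsm by (auto simp: image_image intro!: image_cong)
  have k_ext: "k u \<in> Idl\<^bsub>L\<^esub> (?i ` ((\<lambda>r. Fr (?s r)) ` Y))"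
    if Y: "Y \<subseteq> carrier R" and u: "u \<in> extended_ideal B Y" for Y u
  proof -
    have sub: "structure_map B ` Y \<subseteq> carrier B" using Y ring_hom_closed[OF smB] by blast
    have "k u \<in> Idl\<^bsub>L\<^esub> (k ` structure_map B ` Y)"
      by (rule hom_Idl[OF B.is_cring Lc k sub]) (use u in \<open>simp add: extended_ideal_eq\<close>)
    moreover have "k ` structure_map B ` Y = (\<lambda>r. H (structure_map S r)) ` Y"
      using ksm Y by (auto simp: image_image intro!: image_cong)
    ultimately show ?thesis using gens[OF Y] by simp
  qed
  \<comment> \<open>Membership in an extended ideal is tested componentwise, up to a power of \<open>c\<close>.\<close>
  have L_mem: "Q.frac g w N \<in> Idl\<^bsub>L\<^esub> (?i ` ((\<lambda>r. Fr (?s r)) ` Y)) \<longleftrightarrow>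
      (\<exists>K::nat. \<forall>e. c [^]\<^bsub>T\<^esub> K \<otimes>\<^bsub>T\<^esub> w e \<in> extended_ideal T ((\<lambda>x. x [^]\<^bsub>R\<^esub> (p ^ e)) ` Y))"
    if Y: "finite Y" "Y \<subseteq> carrier R" and w: "w \<in> carrier Q" for Y w N
  proof -
    have sub: "(\<lambda>r. Fr (?s r)) ` Y \<subseteq> carrier Q" using Y(2) FrQ by blast
    have im: "(\<lambda>f. f e) ` ((\<lambda>r. Fr (?s r)) ` Y) = ?s ` ((\<lambda>x. x [^]\<^bsub>R\<^esub> (p ^ e)) ` Y)" for e
      using Y(2) hom_pow[OF R T.is_cring sm] unfolding Fr_def by (auto simp: image_image intro!: image_cong)
    have gw: "g [^]\<^bsub>Q\<^esub> K \<otimes>\<^bsub>Q\<^esub> w \<in> carrier Q" for K :: nat using gQ w by simp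
    have comp: "(g [^]\<^bsub>Q\<^esub> K \<otimes>\<^bsub>Q\<^esub> w) e = c [^]\<^bsub>T\<^esub> K \<otimes>\<^bsub>T\<^esub> w e" for K :: nat and e
      unfolding Q_def g_def by (simp add: seq_ring_simps seq_ring_pow)
    have "g [^]\<^bsub>Q\<^esub> K \<otimes>\<^bsub>Q\<^esub> w \<in> Idl\<^bsub>Q\<^esub> ((\<lambda>r. Fr (?s r)) ` Y) \<longleftrightarrow>
      (\<forall>e. c [^]\<^bsub>T\<^esub> K \<otimes>\<^bsub>T\<^esub> w e \<in> extended_ideal T ((\<lambda>x. x [^]\<^bsub>R\<^esub> (p ^ e)) ` Y))" for K :: nat
    proof -
      have "g [^]\<^bsub>Q\<^esub> K \<otimes>\<^bsub>Q\<^esub> w \<in> Idl\<^bsub>Q\<^esub> ((\<lambda>r. Fr (?s r)) ` Y) \<longleftrightarrow>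
        (\<forall>e. (g [^]\<^bsub>Q\<^esub> K \<otimes>\<^bsub>Q\<^esub> w) e \<in> Idl\<^bsub>T\<^esub> ((\<lambda>f. f e) ` ((\<lambda>r. Fr (?s r)) ` Y)))"
        unfolding Q_def by (rule seq_ring_Idl[OF T.is_cring]) (use Y(1) sub gw[of K] in \<open>simp_all add: Q_def\<close>)
      then show ?thesis by (simp only: im comp extended_ideal_eq)
    qed
    then show ?thesis unfolding L_def using Q.localisation_Idl[OF gQ sub w, of N] by simp
  qed
  have pos: "1 \<le> p ^ e" for e using prime_ge_1_nat[OF p(1)] by simp
  have "regular_sequence B xs"
    unfolding regular_sequence_def
  proof (intro conjI allI impI ballI)
    fix j b assume j: "j < length xs" and b: "b \<in> carrier B"
      and mem: "xs ! j \<odot>\<^bsub>B\<^esub> b \<in> extended_ideal B (set (take j xs))"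
    let ?Y = "set (take j xs)"
    have Y: "finite ?Y" "?Y \<subseteq> carrier R" using xc set_take_subset[of j xs] by auto
    have xj: "xs ! j \<in> carrier R" using xc j by auto
    obtain w N where w: "w \<in> carrier Q" "k b = Q.frac g w N"
      using ring_hom_closed[OF k b] unfolding L_def by (rule Q.localisation_carrierE)
    let ?x = "Fr (?s (xs ! j))"
    have xw: "?x \<otimes>\<^bsub>Q\<^esub> w \<in> carrier Q" using FrQ[OF xj] w(1) by simp
    have "k (xs ! j \<odot>\<^bsub>B\<^esub> b) = ?i ?x \<otimes>\<^bsub>L\<^esub> Q.frac g w N"
      using smult_structure_map[OF B xj b] ring_hom_mult[OF k ring_hom_closed[OF smB xj] b]
        ksm[OF xj] Hsm[OF xj] w(2) by simp
    also have "\<dots> = Q.frac g (?x \<otimes>\<^bsub>Q\<^esub> w) N"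
      unfolding L_def using Q.localisation_mult[OF gQ FrQ[OF xj] w(1), of 0 N] by simp
    finally have "Q.frac g (?x \<otimes>\<^bsub>Q\<^esub> w) N \<in> Idl\<^bsub>L\<^esub> (?i ` ((\<lambda>r. Fr (?s r)) ` ?Y))"
      using k_ext[OF Y(2) mem] by simp
    then obtain K :: nat where K: "\<And>e. c [^]\<^bsub>T\<^esub> K \<otimes>\<^bsub>T\<^esub> (?x \<otimes>\<^bsub>Q\<^esub> w) e
      \<in> extended_ideal T ((\<lambda>x. x [^]\<^bsub>R\<^esub> (p ^ e)) ` ?Y)" using L_mem[OF Y xw, of N] by blast
    have "c [^]\<^bsub>T\<^esub> Suc K \<otimes>\<^bsub>T\<^esub> w e \<in> extended_ideal T ((\<lambda>x. x [^]\<^bsub>R\<^esub> (p ^ e)) ` ?Y)" for e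
    proof -
      let ?E = "extended_ideal T ((\<lambda>x. x [^]\<^bsub>R\<^esub> (p ^ e)) ` ?Y)"
      let ?xe = "(xs ! j) [^]\<^bsub>R\<^esub> (p ^ e)"
      have we: "w e \<in> carrier T" using w(1) Qcar by blast
      have xe: "?xe \<in> carrier R" using xj by simp
      have cw: "c [^]\<^bsub>T\<^esub> K \<otimes>\<^bsub>T\<^esub> w e \<in> carrier T" using cT we by simp
      have "(?x \<otimes>\<^bsub>Q\<^esub> w) e = ?s ?xe \<otimes>\<^bsub>T\<^esub> w e"
        unfolding Q_def Fr_def using hom_pow[OF R T.is_cring sm xj] by (simp add: seq_ring_simps)
      then have "c [^]\<^bsub>T\<^esub> K \<otimes>\<^bsub>T\<^esub> (?x \<otimes>\<^bsub>Q\<^esub> w) e = ?xe \<odot>\<^bsub>T\<^esub> (c [^]\<^bsub>T\<^esub> K \<otimes>\<^bsub>T\<^esub> w e)"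
        using smult_structure_map[OF T xe cw] smc[OF xe] cT we by (simp add: T.m_lcomm)
      then have "c [^]\<^bsub>T\<^esub> K \<otimes>\<^bsub>T\<^esub> w e \<in> colon_ideal T ?E ?xe"
        unfolding colon_ideal_def using K[of e] cw by simp
      then have "c \<otimes>\<^bsub>T\<^esub> (c [^]\<^bsub>T\<^esub> K \<otimes>\<^bsub>T\<^esub> w e) \<in> ?E"
        using kill j pos[of e] unfolding colon_killing_def by blast
      moreover have "c \<otimes>\<^bsub>T\<^esub> (c [^]\<^bsub>T\<^esub> K \<otimes>\<^bsub>T\<^esub> w e) = c [^]\<^bsub>T\<^esub> Suc K \<otimes>\<^bsub>T\<^esub> w e"
        using cT we by (simp add: T.m_ac)
      ultimately show ?thesis by simp
    qed
    then have "k b \<in> Idl\<^bsub>L\<^esub> (?i ` ((\<lambda>r. Fr (?s r)) ` ?Y))"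
      unfolding w(2) L_mem[OF Y w(1)] by blast
    then show "b \<in> extended_ideal B ?Y" using pure[OF Y b] gens[OF Y(2)] by simp
  next
    show "extended_ideal B (set xs) \<noteq> carrier B"
    proof
      assume "extended_ideal B (set xs) = carrier B"
      then have "k \<one>\<^bsub>B\<^esub> \<in> Idl\<^bsub>L\<^esub> (?i ` ((\<lambda>r. Fr (?s r)) ` set xs))"
        using k_ext[OF xc, of "\<one>\<^bsub>B\<^esub>"] by simp
      moreover have "k \<one>\<^bsub>B\<^esub> = Q.frac g \<one>\<^bsub>Q\<^esub> 0"
        using ring_hom_one[OF k] unfolding L_def Q.localisation_one .
      ultimately obtain K :: nat where K: "\<And>e. c [^]\<^bsub>T\<^esub> K \<otimes>\<^bsub>T\<^esub> \<one>\<^bsub>Q\<^esub> e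
        \<in> extended_ideal T ((\<lambda>x. x [^]\<^bsub>R\<^esub> (p ^ e)) ` set xs)"
        using L_mem[OF _ xc Q.one_closed, of 0] by auto
      \<comment> \<open>Durability concerns positive exponents, hence \<open>Suc K\<close> instead of \<open>K\<close>.\<close>
      obtain n where n: "c [^]\<^bsub>T\<^esub> Suc K \<notin> extended_ideal T (ideal_power R m n)"
        using esc unfolding powers_escape_def by (metis le_add1 plus_1_eq_Suc)
      have np: "n \<le> p ^ n" using prime_gt_1_nat[OF p(1)] by (simp add: power_gt_expt less_imp_le)
      let ?P = "ideal_power R m n"
      have Pi: "ideal ?P R" by (rule R.ideal_power_basics(1)[OF m])
      have Pc: "?P \<subseteq> carrier R" by (rule R.ideal_subset[OF Pi])
      have "(\<lambda>x. x [^]\<^bsub>R\<^esub> (p ^ n)) ` set xs \<subseteq> ?P"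
      proof (rule image_subsetI)
        fix x assume "x \<in> set xs"
        then have "x \<in> m" using xm by blast
        then show "x [^]\<^bsub>R\<^esub> (p ^ n) \<in> ?P"
          using R.ideal_pow_mono[OF Pi _ R.ideal_power_basics(2)[OF m] np] mc by blast
      qed
      moreover have sPc: "?s ` ?P \<subseteq> carrier T" using Pc smc by blast
      ultimately have "extended_ideal T ((\<lambda>x. x [^]\<^bsub>R\<^esub> (p ^ n)) ` set xs) \<subseteq> extended_ideal T ?P"
        unfolding extended_ideal_eq by (intro T.Idl_mono) auto
      then have "c [^]\<^bsub>T\<^esub> K \<in> extended_ideal T ?P"
        using K[of n] cT unfolding Q_def by (auto simp: seq_ring_simps)
      then have "c \<otimes>\<^bsub>T\<^esub> c [^]\<^bsub>T\<^esub> K \<in> extended_ideal T ?P"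
        using T.ideal_mult[OF T.genideal_ideal[OF sPc] _ cT] unfolding extended_ideal_eq by blast
      then show False using n cT by (simp add: T.m_comm)
    qed
  qed
  then have "big_CM_algebra R m B" unfolding big_CM_algebra_def using B xs by blast
  then show ?thesis using f by blast
qed

section \<open>Seeds and durable colon-killers\<close>

theorem theorem4p8:
  fixes R :: "'a ring" and m :: "'a set" and p :: nat
    and S :: "('a, 'b) module"
  assumes "noetherian_local_ring R m"
    and "Factorial_Ring.prime p" and "ring_char R = p"
    and "algebra R S"
    and "infinite (UNIV :: 'u set)" and "carrier S \<lesssim> (UNIV :: 'u set)"
    and "infinite (UNIV :: 'v set)" and "carrier S \<lesssim> (UNIV :: 'v set)"
  shows "(seed TYPE('u) R m S \<longleftrightarrow>
           (\<exists>(T :: ('a, 'v) module) h c.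
              algebra R T \<and> h \<in> algebra_hom R S T \<and> durable_colon_killer R m T c)) \<and>
         (seed TYPE('u) R m S \<longleftrightarrow>
           (\<exists>(T :: ('a, 'v) module) h c.
              algebra R T \<and> h \<in> algebra_hom R S T \<and> weak_durable_colon_killer R m T c))"
proof -
  have R: "cring R" and noeth: "noetherian_ring R" and max: "maximalideal m R"
    and loc: "\<forall>m'. maximalideal m' R \<longrightarrow> m' = m"
    using assms(1) unfolding noetherian_local_ring_def by blast+
  interpret noetherian_local R m
    by (rule noetherian_local.intro[OF R noetherian_local_axioms.intro[OF noeth max]]) (use loc in blast)
  obtain ys where ys: "system_of_parameters R m ys" by (rule system_of_parameters_exists)
  let ?seed = "seed TYPE('u) R m S"
  let ?durable = "\<exists>(T :: ('a, 'v) module) h c.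
              algebra R T \<and> h \<in> algebra_hom R S T \<and> durable_colon_killer R m T c"
  let ?weak = "\<exists>(T :: ('a, 'v) module) h c.
              algebra R T \<and> h \<in> algebra_hom R S T \<and> weak_durable_colon_killer R m T c"
  have 1: ?durable if seed: ?seed
  proof -
    obtain B :: "('a, 'u) module" and h xs where B: "algebra R B" "h \<in> algebra_hom R S B"
      "system_of_parameters R m xs" "regular_sequence B xs"
      using seed unfolding seed_def big_CM_algebra_def by blast
    show ?thesis
      by (rule durable_colon_killer_of_seed[OF R m_ideal assms(2-4) B assms(7,8)])
  qed
  \<comment> \<open>Here the existence of a system of parameters enters.\<close>
  have 2: ?weak if ?durable
    using that ys unfolding durable_colon_killer_def weak_durable_colon_killer_def by blast
  have 3: ?seed if weak: ?weak
  proof -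
    obtain T :: "('a, 'v) module" and h c where T: "algebra R T" "h \<in> algebra_hom R S T"
      "weak_durable_colon_killer R m T c" using weak by blast
    have "\<exists>(B :: ('a, 'u) module) f. big_CM_algebra R m B \<and> f \<in> algebra_hom R S B"
      by (rule big_CM_algebra_of_weak_durable_colon_killer[OF R m_ideal assms(2-4) T assms(5,6)])
    then show ?thesis using assms(4) unfolding seed_def by blast
  qed
  show ?thesis using 1 2 3 by blast
qed

end
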